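(* Let $N\ge1$, let $\mathbf{W}$ be a $T'\times N'$ complex orthogonal design in $K'$ real symbols with $N=LN'$ for an integer $L\ge1$, and let $n\ge1$. Consider any DSTBC in the relay network of the context whose design is $\mathbf{X}_{N,\mathbf{W},1,n}$ (i.e. the construction of the context with $\lambda=1$), with each symbol encoded by a finite set $\mathcal{A}_i\subset Q\mathbb{Z}$, where $Q\in\mathbb{R}^{1\times1}$ is a rotation matrix. Then this DSTBC gives full diversity with ZF decoding, and with ZF-SIC decoding under any successive interference cancellation ordering.
   Context: **Complex orthogonal design (COD).** A $T'\times N'$ COD $\mathbf{W}$ in $K'$ real symbols is a design $\mathbf{W}=\sum_{i=1}^{K'}s_iA'_i$, with real variables $s_i$ and weight matrices $A'_i\in\mathbb{C}^{T'\times N'}$ satisfying $A_i'^HA'_j+A_j'^HA'_i=2\delta_{i,j}I_{N'}$. **The design $\mathbf{X}_{N,\mathbf{W},\lambda,n}$.** Let $N=LN'$, $1\le\lambda\le L$, $n\ge1$. The design uses $K=\lambda nK'$ real symbols $x_1,\ldots,x_K$. For $1\le m\le n$, $1\le\ell\le\lambda$, $\mathbf{W}(m,\ell)$ is the COD $\mathbf{W}$ in the $K'$ symbols $x_{\lambda K'(m-1)+\ell},x_{\lambda K'(m-1)+\ell+\lambda},\ldots,x_{\lambda K'(m-1)+\ell+\lambda(K'-1)}$; for $\lambda<\ell\le L$, recursively $\mathbf{W}(m,\ell)=\mathbf{W}(m,\ell-\lambda)$. $\mathbf{X}_{N,\mathbf{W},\lambda,n}$ is the $(n+L-1)T'\times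 N$ block matrix with $(n+L-1)\times L$ blocks of size $T'\times N'$ whose block in block row $r$ and block column $\ell$ is $\mathbf{W}(r-\ell+1,\ell)$ if $1\le r-\ell+1\le n$ and $\mathbf{0}$ otherwise. (So $T_2=(n+L-1)T'$.) For $\lambda=1$ all $\mathbf{W}(m,\ell)$, $1\le\ell\le L$, coincide with $\mathbf{W}(m,1)$. Writing $\mathbf{X}_{N,\mathbf{W},\lambda,n}=\sum_{i=1}^Kx_iA_i$ defines the weight matrices $A_i\in\mathbb{C}^{T_2\times N}$. **Network and DSTBC.** $A^*$ denotes entrywise complex conjugate and $A^H$ conjugate transpose. Fix integers $N,N_D,K,T_1,T_2\ge 1$, a subset $\mathcal{S}\subset\{1,\ldots,N\}$, vectors $\nu_1,\ldots,\nu_K\in\mathbb{C}^{T_1}$ linearly independent over $\mathbb{R}$, matrices $B_1,\ldots,B_N\in\mathbb{C}^{T_2\times T_1}$, and a finite signal set $\mathcal{A}\subset\mathbb{R}^K$ (here $\mathcal{A}=\mathcal{A}_1\times\cdots\times\mathcal{A}_K$). For $j\in\{1,\ldots,N\}$ put $\kappa_j(C)=C^*$ if $j\in\mathcal{S}$ and $\kappa_j(C)=C$ otherwise. Constants $\pi_1,\pi_2>0$ are fixed with $\pi_1T_1+\pi_2RT_2=T_1+T_2$, where $R=\frac{K}{2(T_1+T_2)}$; $P>0$ is the average power. The channel gains $f_j$ (source to relay $j$) and $g_{j,l}$ (relay $j$ to destination antenna $l$), $1\le j\le N$, $1\le l\le N_D$, are independent circularly symmetric complex Gaussian variables of mean $0$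 and variance $1$, constant during a transmission cycle and known to the destination. The noises $v_j\in\mathbb{C}^{T_1}$ (relays) and $w_l\in\mathbb{C}^{T_2}$ (destination antennas) are circularly symmetric complex Gaussian with zero mean and covariances $I_{T_1}$, $I_{T_2}$; all gains, noises and the information vector are mutually independent. The information vector $x=[x_1,\ldots,x_K]^T$ takes values in $\mathcal{A}$, $z=\sum_i x_i\nu_i$, and $\mathcal{A},\nu_i$ are chosen so that $\mathsf{E}\|z\|^2=T_1$. Relay $j$ receives $r_j=f_j\sqrt{\pi_1P}\,z+v_j$ and sends $t_j=\sqrt{\tfrac{\pi_2P}{\pi_1P+1}}\,\kappa_j(B_jr_j)$; antenna $l$ of the destination receives $y_l=\sum_j g_{j,l}t_j+w_l$. Hence $Y=[y_1\cdots y_{N_D}]=\sqrt{\tfrac{\pi_1\pi_2P^2}{\pi_1P+1}}\,XH+U$, where $X=[\kappa_1(B_1z)\cdots\kappa_N(B_Nz)]\in\mathbb{C}^{T_2\times N}$, $H\in\mathbb{C}^{N\times N_D}$ has $(j,l)$ entry $\kappa_j(f_j)g_{j,l}$, and $U$ has columns $u_l=\sum_j\sqrt{\tfrac{\pi_2P}{\pi_1P+1}}\,g_{j,l}\,\kappa_j(B_jv_j)+w_l$. The weight matrices are $A_i=[\kappa_1(B_1\nu_i)\cdots\kappa_N(B_N\nu_i)]$, so $X=\sum_i x_iA_i$; the set of all codewords $X$ is the distributed space-time block code (DSTBC) with design $\sum_ix_iA_i$. A DSTBC has design $\mathbf{X}_{N,\mathbf{W},\lambda,n}$ if its $A_i$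 are the weight matrices of $\mathbf{X}_{N,\mathbf{W},\lambda,n}$. **ZF and ZF-SIC decoders.** For a complex matrix $A$, $\widetilde{vec}(A)=[vec(A_{Re})^T\ vec(A_{Im})^T]^T$. Let $G'=\sqrt{\tfrac{\pi_1\pi_2P^2}{\pi_1P+1}}\,[\widetilde{vec}(A_1H)\cdots\widetilde{vec}(A_KH)]$, let $\Gamma$ be the covariance matrix of $\widetilde{vec}(U)$ given the channel gains, $G=\Gamma^{-1/2}G'=[g_1\cdots g_K]$ (symmetric positive definite square root), and $y=\Gamma^{-1/2}\widetilde{vec}(Y)=Gx+n$. ZF decoding: for each $i$, with $P_i$ the orthogonal projection onto the orthogonal complement of $\mathrm{span}\{g_{i'}: i'\ne i\}$, output $\hat x_i\in\arg\min_{b\in\mathcal{A}_i}\|P_iy-P_ig_ib\|^2$. ZF-SIC decoding with ordering $\sigma$ (a permutation of $\{1,\ldots,K\}$): set $y_1=y$ and, successively for $k=1,\ldots,K$, with $\tilde P_k$ the orthogonal projection onto the orthogonal complement of $\mathrm{span}\{g_{\sigma(\ell)}:\ell>k\}$, output $\hat x_{\sigma(k)}\in\arg\min_{b\in\mathcal{A}_{\sigma(k)}}\|\tilde P_ky_k-\tilde P_kg_{\sigma(k)}b\|^2$ and set $y_{k+1}=y_k-g_{\sigma(k)}\hat x_{\sigma(k)}$. **Full diversity.** A decoder achieves a diversity of $d=d(P)$ if there is a constant $c_0>0$ such that for all sufficiently large $P$ and every transmitted $x\in\mathcal{A}$, the probability (over channel gains and noises) that the decoded vector differs from $x$ is at most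 $c_0P^{-d(P)}$. Full diversity means $d(P)=N\left(1-\frac{\log(\log P)}{\log P}\right)$ if $N_D=1$ and $d(P)=N$ if $N_D>1$. *)

theory Defs
  imports
    "HOL-Probability.Probability"
    "HOL-Combinatorics.Permutations"
    "Jordan_Normal_Form.Schur_Decomposition"
    "Jordan_Normal_Form.VS_Connect"
begin

text \<open>Matrices and vectors of variable size are those of \<^theory>\<open>Jordan_Normal_Form.Matrix\<close>.
  All indices (relays, antennas, symbols, time slots, blocks) start at 0.\<close>

hide_const (open) Finite_Cartesian_Product.mat Finite_Cartesian_Product.vec

section \<open>Designs\<close>

definition linear_design ::
  "nat \<Rightarrow> nat \<Rightarrow> nat \<Rightarrow> (nat \<Rightarrow> complex mat) \<Rightarrow> (nat \<Rightarrow> real) \<Rightarrow> complex mat" where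
  "linear_design nr nc k A s = mat nr nc (\<lambda>(a, b). \<Sum>i<k. complex_of_real (s i) * A i $$ (a, b))"

definition complex_orthogonal_design :: "nat \<Rightarrow> nat \<Rightarrow> nat \<Rightarrow> (nat \<Rightarrow> complex mat) \<Rightarrow> bool" where
  "complex_orthogonal_design T' N' K' W \<longleftrightarrow>
     (\<forall>i<K'. W i \<in> carrier_mat T' N') \<and>
     (\<forall>i<K'. \<forall>j<K'. mat_adjoint (W i) * W j + mat_adjoint (W j) * W i
                      = (if i = j then 2 else 0) \<cdot>\<^sub>m 1\<^sub>m N')"

text \<open>\<open>W_block\<close> is the block \<open>\<^bold>W(m,l)\<close>, evaluated at the real symbols \<open>x\<close>. The recursion
  \<open>\<^bold>W(m,l) = \<^bold>W(m,l-\<lambda>)\<close> for \<open>l \<ge> \<lambda>\<close> amounts to reducing \<open>l\<close> modulo \<open>\<lambda>\<close>.\<close>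

definition W_block ::
  "nat \<Rightarrow> nat \<Rightarrow> nat \<Rightarrow> (nat \<Rightarrow> complex mat) \<Rightarrow> nat \<Rightarrow> nat \<Rightarrow> nat \<Rightarrow> (nat \<Rightarrow> real) \<Rightarrow> complex mat" where
  "W_block T' N' K' W lam m l x =
     linear_design T' N' K' W (\<lambda>k. x (lam * K' * m + l mod lam + lam * k))"

definition X_design ::
  "nat \<Rightarrow> nat \<Rightarrow> nat \<Rightarrow> (nat \<Rightarrow> complex mat) \<Rightarrow> nat \<Rightarrow> nat \<Rightarrow> nat \<Rightarrow> (nat \<Rightarrow> real) \<Rightarrow> complex mat" where
  "X_design T' N' K' W L lam n x =
     mat ((n + L - 1) * T') (L * N') (\<lambda>(a, b).
       let r = a div T'; l = b div N' in
       if l \<le> r \<and> r - l < n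
       then W_block T' N' K' W lam (r - l) l x $$ (a mod T', b mod N') else 0)"

section \<open>Relay network and distributed space-time block code\<close>

text \<open>\<open>relays\<close> is \<open>N\<close>, \<open>ants\<close> is \<open>N\<^sub>D\<close>, \<open>syms\<close> is \<open>K\<close>, \<open>len1\<close> and \<open>len2\<close> are \<open>T\<^sub>1\<close> and \<open>T\<^sub>2\<close>,
  \<open>conj_relays\<close> is \<open>S\<close>, \<open>relay_mat\<close>, \<open>src_vec\<close>, \<open>alph\<close> are the \<open>B\<^sub>j\<close>, \<open>\<nu>\<^sub>i\<close>, \<open>A\<^sub>i\<close>,
  and \<open>pow1\<close>, \<open>pow2\<close> are \<open>\<pi>\<^sub>1\<close>, \<open>\<pi>\<^sub>2\<close>.\<close>

record dstbc =
  relays :: nat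
  ants :: nat
  syms :: nat
  len1 :: nat
  len2 :: nat
  conj_relays :: "nat set"
  relay_mat :: "nat \<Rightarrow> complex mat"
  src_vec :: "nat \<Rightarrow> complex vec"
  alph :: "nat \<Rightarrow> real set"
  pow1 :: real
  pow2 :: real

definition signal_set :: "dstbc \<Rightarrow> (nat \<Rightarrow> real) set" where
  "signal_set c = PiE {..<syms c} (alph c)"

definition source_signal :: "dstbc \<Rightarrow> (nat \<Rightarrow> real) \<Rightarrow> complex vec" where
  "source_signal c x =
     vec (len1 c) (\<lambda>t. \<Sum>i<syms c. complex_of_real (x i) * vec_index (src_vec c i) t)"

definition rate :: "dstbc \<Rightarrow> real" where
  "rate c = real (syms c) / (2 * (real (len1 c) + real (len2 c)))"

definition valid_dstbc :: "dstbc \<Rightarrow> bool" where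
  "valid_dstbc c \<longleftrightarrow>
     relays c \<ge> 1 \<and> ants c \<ge> 1 \<and> syms c \<ge> 1 \<and> len1 c \<ge> 1 \<and> len2 c \<ge> 1 \<and>
     conj_relays c \<subseteq> {..<relays c} \<and>
     (\<forall>j<relays c. relay_mat c j \<in> carrier_mat (len2 c) (len1 c)) \<and>
     (\<forall>i<syms c. src_vec c i \<in> carrier_vec (len1 c)) \<and>
     (\<forall>a. source_signal c a = 0\<^sub>v (len1 c) \<longrightarrow> (\<forall>i<syms c. a i = 0)) \<and>
     pow1 c > 0 \<and> pow2 c > 0 \<and>
     pow1 c * real (len1 c) + pow2 c * rate c * real (len2 c) = real (len1 c) + real (len2 c)"

definition conj_op :: "dstbc \<Rightarrow> nat \<Rightarrow> complex \<Rightarrow> complex" where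
  "conj_op c j = (if j \<in> conj_relays c then cnj else id)"

definition weight_mat :: "dstbc \<Rightarrow> nat \<Rightarrow> complex mat" where
  "weight_mat c i = mat_of_cols (len2 c)
     (map (\<lambda>j. map_vec (conj_op c j) (relay_mat c j *\<^sub>v src_vec c i)) [0..<relays c])"

definition has_design :: "dstbc \<Rightarrow> ((nat \<Rightarrow> real) \<Rightarrow> complex mat) \<Rightarrow> bool" where
  "has_design c X \<longleftrightarrow>
     (\<forall>x. X x = linear_design (len2 c) (relays c) (syms c) (weight_mat c) x)"

text \<open>In the following, \<open>f j\<close> and \<open>g j l\<close> are the channel gains and \<open>v j t\<close> and \<open>w l t\<close> are the
  entries of the noise vectors \<open>v\<^sub>j\<close> and \<open>w\<^sub>l\<close>.\<close>

definition relay_gain :: "dstbc \<Rightarrow> real \<Rightarrow> real" where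
  "relay_gain c P = sqrt (pow2 c * P / (pow1 c * P + 1))"

definition relay_received ::
  "dstbc \<Rightarrow> real \<Rightarrow> (nat \<Rightarrow> real) \<Rightarrow> (nat \<Rightarrow> complex) \<Rightarrow> (nat \<Rightarrow> nat \<Rightarrow> complex) \<Rightarrow> nat \<Rightarrow> complex vec" where
  "relay_received c P x f v j =
     (f j * complex_of_real (sqrt (pow1 c * P))) \<cdot>\<^sub>v source_signal c x + vec (len1 c) (v j)"

definition relay_sent ::
  "dstbc \<Rightarrow> real \<Rightarrow> (nat \<Rightarrow> real) \<Rightarrow> (nat \<Rightarrow> complex) \<Rightarrow> (nat \<Rightarrow> nat \<Rightarrow> complex) \<Rightarrow> nat \<Rightarrow> complex vec" where
  "relay_sent c P x f v j =
     complex_of_real (relay_gain c P) \<cdot>\<^sub>v map_vec (conj_op c j) (relay_mat c j *\<^sub>v relay_received c P x f v j)"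

definition received_mat ::
  "dstbc \<Rightarrow> real \<Rightarrow> (nat \<Rightarrow> real) \<Rightarrow> (nat \<Rightarrow> complex) \<Rightarrow> (nat \<Rightarrow> nat \<Rightarrow> complex) \<Rightarrow>
   (nat \<Rightarrow> nat \<Rightarrow> complex) \<Rightarrow> (nat \<Rightarrow> nat \<Rightarrow> complex) \<Rightarrow> complex mat" where
  "received_mat c P x f g v w = mat (len2 c) (ants c) (\<lambda>(t, l).
     (\<Sum>j<relays c. g j l * vec_index (relay_sent c P x f v j) t) + w l t)"

definition channel_mat ::
  "dstbc \<Rightarrow> (nat \<Rightarrow> complex) \<Rightarrow> (nat \<Rightarrow> nat \<Rightarrow> complex) \<Rightarrow> complex mat" where
  "channel_mat c f g = mat (relays c) (ants c) (\<lambda>(j, l). conj_op c j (f j) * g j l)"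

definition noise_mat ::
  "dstbc \<Rightarrow> real \<Rightarrow> (nat \<Rightarrow> nat \<Rightarrow> complex) \<Rightarrow> (nat \<Rightarrow> nat \<Rightarrow> complex) \<Rightarrow> (nat \<Rightarrow> nat \<Rightarrow> complex) \<Rightarrow>
   complex mat" where
  "noise_mat c P g v w = mat (len2 c) (ants c) (\<lambda>(t, l).
     (\<Sum>j<relays c. complex_of_real (relay_gain c P) * g j l *
        vec_index (map_vec (conj_op c j) (relay_mat c j *\<^sub>v vec (len1 c) (v j))) t) + w l t)"

section \<open>Probabilistic model\<close>

datatype rv_index = Gain_f nat | Gain_g nat nat | Noise_v nat nat | Noise_w nat nat

definition rv_indices :: "dstbc \<Rightarrow> rv_index set" where
  "rv_indices c =
     {Gain_f j | j. j < relays c} \<union>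
     {Gain_g j l | j l. j < relays c \<and> l < ants c} \<union>
     {Noise_v j t | j t. j < relays c \<and> t < len1 c} \<union>
     {Noise_w l t | l t. l < ants c \<and> t < len2 c}"

text \<open>Circularly symmetric complex Gaussian with mean 0 and variance 1: real and imaginary part have
  variance 1/2 each, and \<open>normal_density\<close> takes the standard deviation.\<close>

definition std_complex_normal :: "'w measure \<Rightarrow> ('w \<Rightarrow> complex) \<Rightarrow> bool" where
  "std_complex_normal M X \<longleftrightarrow>
     prob_space.indep_var M borel (\<lambda>\<omega>. Re (X \<omega>)) borel (\<lambda>\<omega>. Im (X \<omega>)) \<and>
     distributed M lborel (\<lambda>\<omega>. Re (X \<omega>)) (normal_density 0 (sqrt (1 / 2))) \<and>
     distributed M lborel (\<lambda>\<omega>. Im (X \<omega>)) (normal_density 0 (sqrt (1 / 2)))"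

text \<open>A circularly symmetric complex Gaussian vector with covariance \<open>I\<close> is a vector with
  independent standard complex normal entries. Hence the mutual independence of all gains, noise
  vectors and the information vector \<open>info\<close> is that of all entries \<open>Z s\<close> and \<open>info\<close>.\<close>

definition network_model ::
  "'w measure \<Rightarrow> dstbc \<Rightarrow> (rv_index \<Rightarrow> 'w \<Rightarrow> complex) \<Rightarrow> ('w \<Rightarrow> nat \<Rightarrow> real) \<Rightarrow> bool" where
  "network_model M c Z info \<longleftrightarrow>
     prob_space M \<and>
     prob_space.indep_vars M (\<lambda>_. borel) Z (rv_indices c) \<and>
     (\<forall>s\<in>rv_indices c. std_complex_normal M (Z s)) \<and>
     info \<in> measurable M (count_space (signal_set c)) \<and>
     prob_space.indep_set M
       (sets (vimage_algebra (space M) (\<lambda>\<omega>. \<lambda>s\<in>rv_indices c. Z s \<omega>)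
                (PiM (rv_indices c) (\<lambda>_. borel))))
       (sets (vimage_algebra (space M) info (count_space (signal_set c)))) \<and>
     prob_space.expectation M
       (\<lambda>\<omega>. \<Sum>t<len1 c. (cmod (vec_index (source_signal c (info \<omega>)) t))\<^sup>2) = real (len1 c)"

definition covariance :: "'w measure \<Rightarrow> ('w \<Rightarrow> real) \<Rightarrow> ('w \<Rightarrow> real) \<Rightarrow> real" where
  "covariance M X Y =
     prob_space.expectation M (\<lambda>\<omega>. (X \<omega> - prob_space.expectation M X) * (Y \<omega> - prob_space.expectation M Y))"

definition vec_cols :: "'a mat \<Rightarrow> 'a vec" where
  "vec_cols A = vec (dim_row A * dim_col A) (\<lambda>p. A $$ (p mod dim_row A, p div dim_row A))"

definition vec_tilde :: "complex mat \<Rightarrow> real vec" where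
  "vec_tilde A = vec_cols (map_mat Re A) @\<^sub>v vec_cols (map_mat Im A)"

text \<open>As the gains are independent of the noises, the covariance given the gains \<open>g\<close> is the
  covariance over the noises with \<open>g\<close> held fixed; \<open>noise_mat\<close> does not involve the gains \<open>f\<close>.\<close>

definition noise_cov ::
  "'w measure \<Rightarrow> dstbc \<Rightarrow> (rv_index \<Rightarrow> 'w \<Rightarrow> complex) \<Rightarrow> real \<Rightarrow> (nat \<Rightarrow> nat \<Rightarrow> complex) \<Rightarrow> real mat" where
  "noise_cov M c Z P g =
     (let u = (\<lambda>\<omega>. vec_tilde (noise_mat c P g (\<lambda>j t. Z (Noise_v j t) \<omega>) (\<lambda>l t. Z (Noise_w l t) \<omega>)));
          d = 2 * (len2 c * ants c)
      in mat d d (\<lambda>(p, q). covariance M (\<lambda>\<omega>. vec_index (u \<omega>) p) (\<lambda>\<omega>. vec_index (u \<omega>) q)))"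

definition pos_def_mat :: "real mat \<Rightarrow> bool" where
  "pos_def_mat A \<longleftrightarrow> square_mat A \<and> transpose_mat A = A \<and>
     (\<forall>a\<in>carrier_vec (dim_row A). a \<noteq> 0\<^sub>v (dim_row A) \<longrightarrow> a \<bullet> (A *\<^sub>v a) > 0)"

text \<open>For symmetric positive definite \<open>A\<close>, the matrix \<open>A\<^sup>-\<^sup>1\<^sup>/\<^sup>2\<close>; it exists and is unique.\<close>

definition inv_sqrt_mat :: "real mat \<Rightarrow> real mat" where
  "inv_sqrt_mat A = (SOME B. B \<in> carrier_mat (dim_row A) (dim_row A) \<and> pos_def_mat B \<and>
     inverts_mat A (B * B) \<and> inverts_mat (B * B) A)"

definition equiv_channel ::
  "'w measure \<Rightarrow> dstbc \<Rightarrow> (rv_index \<Rightarrow> 'w \<Rightarrow> complex) \<Rightarrow> real \<Rightarrow> 'w \<Rightarrow> real mat" where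
  "equiv_channel M c Z P \<omega> =
     (let f = (\<lambda>j. Z (Gain_f j) \<omega>); g = (\<lambda>j l. Z (Gain_g j l) \<omega>);
          G' = sqrt (pow1 c * pow2 c * P\<^sup>2 / (pow1 c * P + 1)) \<cdot>\<^sub>m
                 mat_of_cols (2 * (len2 c * ants c))
                   (map (\<lambda>i. vec_tilde (weight_mat c i * channel_mat c f g)) [0..<syms c])
      in inv_sqrt_mat (noise_cov M c Z P g) * G')"

definition equiv_received ::
  "'w measure \<Rightarrow> dstbc \<Rightarrow> (rv_index \<Rightarrow> 'w \<Rightarrow> complex) \<Rightarrow> real \<Rightarrow> (nat \<Rightarrow> real) \<Rightarrow> 'w \<Rightarrow> real vec" where
  "equiv_received M c Z P x \<omega> =
     (let f = (\<lambda>j. Z (Gain_f j) \<omega>); g = (\<lambda>j l. Z (Gain_g j l) \<omega>);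
          v = (\<lambda>j t. Z (Noise_v j t) \<omega>); w = (\<lambda>l t. Z (Noise_w l t) \<omega>)
      in inv_sqrt_mat (noise_cov M c Z P g) *\<^sub>v vec_tilde (received_mat c P x f g v w))"

section \<open>Zero-forcing decoders\<close>

definition proj_compl :: "nat \<Rightarrow> real vec set \<Rightarrow> real vec \<Rightarrow> real vec" where
  "proj_compl d S y = (THE p. p \<in> carrier_vec d \<and> (\<forall>s\<in>S. p \<bullet> s = 0) \<and>
     y - p \<in> LinearCombinations.module.span class_ring (module_vec TYPE(real) d) S)"

definition zf_output :: "dstbc \<Rightarrow> real mat \<Rightarrow> real vec \<Rightarrow> (nat \<Rightarrow> real) \<Rightarrow> bool" where
  "zf_output c G y xhat \<longleftrightarrow> (\<forall>i<syms c.
     let p = proj_compl (dim_row G) (col G ` ({..<syms c} - {i})) in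
     is_arg_min (\<lambda>b. let e = p y - b \<cdot>\<^sub>v p (col G i) in e \<bullet> e) (\<lambda>b. b \<in> alph c i) (xhat i))"

primrec sic_residual ::
  "real mat \<Rightarrow> (nat \<Rightarrow> nat) \<Rightarrow> (nat \<Rightarrow> real) \<Rightarrow> real vec \<Rightarrow> nat \<Rightarrow> real vec" where
  "sic_residual G \<sigma> xhat y 0 = y"
| "sic_residual G \<sigma> xhat y (Suc k) = sic_residual G \<sigma> xhat y k - xhat (\<sigma> k) \<cdot>\<^sub>v col G (\<sigma> k)"

definition zf_sic_output ::
  "dstbc \<Rightarrow> (nat \<Rightarrow> nat) \<Rightarrow> real mat \<Rightarrow> real vec \<Rightarrow> (nat \<Rightarrow> real) \<Rightarrow> bool" where
  "zf_sic_output c \<sigma> G y xhat \<longleftrightarrow> (\<forall>k<syms c.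
     let p = proj_compl (dim_row G) (col G ` \<sigma> ` {k<..<syms c}) in
     is_arg_min (\<lambda>b. let e = p (sic_residual G \<sigma> xhat y k) - b \<cdot>\<^sub>v p (col G (\<sigma> k)) in e \<bullet> e)
       (\<lambda>b. b \<in> alph c (\<sigma> k)) (xhat (\<sigma> k)))"

text \<open>A decoder is a function of \<open>G\<close> and \<open>y\<close>; ties in the minimizations may be broken arbitrarily.\<close>

type_synonym decoder = "real mat \<Rightarrow> real vec \<Rightarrow> nat \<Rightarrow> real"

definition zf_decoder :: "dstbc \<Rightarrow> decoder \<Rightarrow> bool" where
  "zf_decoder c D \<longleftrightarrow>
     (\<forall>G\<in>carrier_mat (2 * (len2 c * ants c)) (syms c). \<forall>y\<in>carrier_vec (2 * (len2 c * ants c)).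
        zf_output c G y (D G y))"

definition zf_sic_decoder :: "dstbc \<Rightarrow> (nat \<Rightarrow> nat) \<Rightarrow> decoder \<Rightarrow> bool" where
  "zf_sic_decoder c \<sigma> D \<longleftrightarrow>
     (\<forall>G\<in>carrier_mat (2 * (len2 c * ants c)) (syms c). \<forall>y\<in>carrier_vec (2 * (len2 c * ants c)).
        zf_sic_output c \<sigma> G y (D G y))"

section \<open>Diversity\<close>

text \<open>The transmitted vector \<open>x\<close> is fixed, so the randomness is that of the gains and noises only.
  With arbitrary tie-breaking the error event need not be measurable. The outer measure avoids the
  convention that a non-measurable set has measure 0; on events it is the probability.\<close>

definition achieves_diversity ::
  "'w measure \<Rightarrow> dstbc \<Rightarrow> (rv_index \<Rightarrow> 'w \<Rightarrow> complex) \<Rightarrow> decoder \<Rightarrow> (real \<Rightarrow> real) \<Rightarrow> bool" where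
  "achieves_diversity M c Z D d \<longleftrightarrow>
     (\<exists>c0>0. \<forall>\<^sub>F P in at_top. \<forall>x\<in>signal_set c.
        outer_measure_of M {\<omega> \<in> space M. \<exists>i<syms c.
            D (equiv_channel M c Z P \<omega>) (equiv_received M c Z P x \<omega>) i \<noteq> x i}
          \<le> ennreal (c0 * P powr (- d P)))"

definition full_diversity ::
  "'w measure \<Rightarrow> dstbc \<Rightarrow> (rv_index \<Rightarrow> 'w \<Rightarrow> complex) \<Rightarrow> decoder \<Rightarrow> bool" where
  "full_diversity M c Z D \<longleftrightarrow> achieves_diversity M c Z D
     (\<lambda>P. if ants c = 1 then real (relays c) * (1 - ln (ln P) / ln P) else real (relays c))"

end

theory Submission
  imports Defs
begin

unbundle no vec_syntax
unbundle no inner_syntax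

text \<open>At a decoding error, the projection \<open>q\<close> of some column of \<open>G\<close> onto the orthogonal complement of
  some other columns satisfies \<open>|q| \<le> 2 |n|\<close>, where \<open>n\<close> is the whitened noise (for SIC, look at the
  first wrong decision). Here \<open>q = G a\<close> with a coefficient \<open>a\<^sub>i = 1\<close>. For \<open>\<lambda> = 1\<close> the matrix
  \<open>\<Sum>a\<^sub>iA\<^sub>i\<close> is block Toeplitz with blocks from an orthogonal design, so \<open>(\<Sum>a\<^sub>iA\<^sub>i) h = 0\<close> only if
  \<open>a = 0\<close> or \<open>h = 0\<close>, and by compactness the norm of this product is at least a constant times
  \<open>|a| |h|\<close>. Bounding the noise covariance from both sides, every error lies in the event
  \<open>P \<Sum>|f\<^sub>j|\<^sup>2 |g\<^sub>j\<^sub>l|\<^sup>2 \<le> C (1 + |g|\<^sup>2)\<^sup>2 |noise|\<^sup>2\<close>, which involves neither the decoder nor the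
  transmitted symbols. Its probability is bounded by an exponential moment: integrating out the \<open>f\<^sub>j\<close>
  leaves the factors \<open>1 / (1 + A \<Sum>\<^sub>l |g\<^sub>j\<^sub>l|\<^sup>2)\<close> with \<open>A\<close> proportional to \<open>P\<close>, whose
  expectation is of order \<open>ln P / P\<close> for one antenna and \<open>1 / P\<close> for several.\<close>

section \<open>Inverse square roots of positive definite matrices\<close>

text \<open>The obstacle is the factor (1 + |g|^2)^2 in the event: it couples the gains of all
  relays and antennas, whereas the expectation can be computed only for products over independent
  variables. Dividing the Chernoff exponent by it keeps the integral over the f_j explicit. The
  inequality 1 / (1 + t / q) \<le> q / (1 + t) for q \<ge> 1 then moves it out of the denominators,
  where it leaves a power of 1 + |g|^2. This power is at most a constant times exp (|g|^2 / 2),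
  which splits over the single gains and consumes only half of the Gaussian exponent. The noise gets
  the weight exp (|noise|^2 / 2) for the same reason: its expectation stays finite. The logarithm
  for one antenna counts the dyadic scales of |g|^2 from 1 / A up to about 1, all of which
  contribute equally. When two antennas share the decay, the contributions form a geometric series
  and the logarithm disappears.\<close>

lemma scalar_prod_self_nonneg: "0 \<le> (v :: real vec) \<bullet> v"
  by (auto simp: scalar_prod_def intro!: sum_nonneg)

lemma scalar_prod_self_eq_0_iff:
  "v \<in> carrier_vec n \<Longrightarrow> (v :: real vec) \<bullet> v = 0 \<longleftrightarrow> v = 0\<^sub>v n"
  by (auto simp: scalar_prod_def sum_nonneg_eq_0_iff)

lemma scalar_prod_self_pos:
  assumes "v \<in> carrier_vec n" "v \<noteq> 0\<^sub>v n"
  shows "0 < (v :: real vec) \<bullet> v"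
  using scalar_prod_self_nonneg[of v] scalar_prod_self_eq_0_iff[of v n] assms by linarith

lemma symmetric_mat_scalar_prod:
  fixes A :: "real mat"
  assumes "A \<in> carrier_mat n n" "transpose_mat A = A" "x \<in> carrier_vec n" "y \<in> carrier_vec n"
  shows "(A *\<^sub>v x) \<bullet> y = x \<bullet> (A *\<^sub>v y)"
  using transpose_vec_mult_scalar[of A n n y x] assms by simp

text \<open>Over the complex numbers an eigenvector x + iy exists. Comparing (A x) . y with x . (A
  y) gives Im z (|x|^2 + |y|^2) = 0, so the eigenvalue is real, and whichever of x and y is nonzero
  is a real eigenvector.\<close>

lemma symmetric_mat_eigenvector:
  fixes A :: "real mat"
  assumes A: "A \<in> carrier_mat n n" and sym: "transpose_mat A = A" and n: "n > 0"
  obtains v e where "v \<in> carrier_vec n" "v \<noteq> 0\<^sub>v n" "A *\<^sub>v v = e \<cdot>\<^sub>v v"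
proof -
  let ?C = "map_mat complex_of_real A"
  have C: "?C \<in> carrier_mat n n" using A by simp
  obtain as where as: "char_poly ?C = (\<Prod>a\<leftarrow>as. [:- a, 1:])" "length as = n"
    using char_poly_factorized[OF C] by auto
  then obtain z as' where "as = z # as'" using n by (cases as) auto
  then have "poly (char_poly ?C) z = 0" using as by simp
  then obtain w where w: "w \<in> carrier_vec n" "w \<noteq> 0\<^sub>v n" "?C *\<^sub>v w = z \<cdot>\<^sub>v w"
    using eigenvalue_root_char_poly[OF C] C by (auto simp: eigenvalue_def eigenvector_def)
  define x y where "x = map_vec Re w" and "y = map_vec Im w"
  have xy: "x \<in> carrier_vec n" "y \<in> carrier_vec n" using w by (auto simp: x_def y_def)
  have entry: "(\<Sum>j = 0..<n. complex_of_real (A $$ (i, j)) * w $ j) = z * w $ i" if "i < n" for i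
    using arg_cong[OF w(3), of "\<lambda>v. v $ i"] that w(1) A
    by (simp add: scalar_prod_def)
  have Ax: "A *\<^sub>v x = Re z \<cdot>\<^sub>v x - Im z \<cdot>\<^sub>v y"
  proof (rule eq_vecI)
    fix i assume "i < dim_vec (Re z \<cdot>\<^sub>v x - Im z \<cdot>\<^sub>v y)"
    then have "i < n" using xy by simp
    then show "(A *\<^sub>v x) $ i = (Re z \<cdot>\<^sub>v x - Im z \<cdot>\<^sub>v y) $ i"
      using arg_cong[OF entry, of i Re] A xy w by (simp add: scalar_prod_def x_def y_def)
  qed (use A xy in auto)
  have Ay: "A *\<^sub>v y = Re z \<cdot>\<^sub>v y + Im z \<cdot>\<^sub>v x"
  proof (rule eq_vecI)
    fix i assume "i < dim_vec (Re z \<cdot>\<^sub>v y + Im z \<cdot>\<^sub>v x)"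
    then have "i < n" using xy by simp
    then show "(A *\<^sub>v y) $ i = (Re z \<cdot>\<^sub>v y + Im z \<cdot>\<^sub>v x) $ i"
      using arg_cong[OF entry, of i Im] A xy w by (simp add: scalar_prod_def x_def y_def)
  qed (use A xy in auto)
  have "(A *\<^sub>v x) \<bullet> y = Re z * (x \<bullet> y) - Im z * (y \<bullet> y)"
    unfolding Ax using xy by (simp add: minus_scalar_prod_distrib)
  moreover have "x \<bullet> (A *\<^sub>v y) = Re z * (x \<bullet> y) + Im z * (x \<bullet> x)"
    unfolding Ay using xy by (simp add: scalar_prod_add_distrib)
  ultimately have "Im z * (x \<bullet> x + y \<bullet> y) = 0"
    using symmetric_mat_scalar_prod[OF A sym xy] by (simp add: algebra_simps)
  moreover have nz: "x \<noteq> 0\<^sub>v n \<or> y \<noteq> 0\<^sub>v n"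
  proof (rule ccontr)
    assume "\<not> ?thesis"
    then have *: "x = 0\<^sub>v n" "y = 0\<^sub>v n" by auto
    have "w $ i = 0" if "i < n" for i
      using arg_cong[OF *(1), of "\<lambda>v. v $ i"] arg_cong[OF *(2), of "\<lambda>v. v $ i"] that w
      by (simp add: x_def y_def complex_eq_iff)
    then show False using w by (metis carrier_vecD dim_vec eq_vecI index_zero_vec(1) zero_carrier_vec)
  qed
  then have "x \<bullet> x + y \<bullet> y > 0"
    using scalar_prod_self_pos[OF xy(1)] scalar_prod_self_pos[OF xy(2)]
      scalar_prod_self_nonneg[of x] scalar_prod_self_nonneg[of y] by fastforce
  ultimately have "Im z = 0" by simp
  then have "A *\<^sub>v x = Re z \<cdot>\<^sub>v x" "A *\<^sub>v y = Re z \<cdot>\<^sub>v y"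
    unfolding Ax Ay using xy by auto
  then show thesis using nz xy that by blast
qed

text \<open>Reflection in the hyperplane orthogonal to u = v - e_0; it swaps e_0 and v because both
  have length 1. For v = e_0 there is no such hyperplane and the identity serves. As a symmetric
  involution it can be conjugated with and undone without inverses or transposes.\<close>

lemma householder:
  fixes v :: "real vec"
  assumes v: "v \<in> carrier_vec n" "v \<bullet> v = 1" and n: "n > 0"
  obtains W where "W \<in> carrier_mat n n" "transpose_mat W = W" "W * W = 1\<^sub>m n"
    "W *\<^sub>v unit_vec n 0 = v"
proof (cases "v = unit_vec n 0")
  case True
  then show thesis using that[of "1\<^sub>m n"] by auto
next
  case False
  define u where "u = v - unit_vec n 0"
  have u: "u \<in> carrier_vec n" using v by (auto simp: u_def)
  have "u \<noteq> 0\<^sub>v n"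
  proof
    assume eq: "u = 0\<^sub>v n"
    have "v = unit_vec n 0"
    proof (rule eq_vecI)
      fix i assume "i < dim_vec (unit_vec n 0)"
      then show "v $ i = (unit_vec n 0) $ i"
        using arg_cong[OF eq, of "\<lambda>v. v $ i"] v by (simp add: u_def)
    qed (use v in auto)
    with False show False by simp
  qed
  then have upos: "u \<bullet> u > 0" using scalar_prod_self_pos[OF u] by simp
  define b where "b = 2 / (u \<bullet> u)"
  have buu: "b * (u \<bullet> u) = 2" using upos by (simp add: b_def)
  define W where "W = mat n n (\<lambda>(i, j). (if i = j then 1 else 0) - b * u $ i * u $ j)"
  have W: "W \<in> carrier_mat n n" by (simp add: W_def)
  have uu: "u \<bullet> u = (\<Sum>k = 0..<n. u $ k * u $ k)" using u by (simp add: scalar_prod_def)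
  have WW: "W * W = 1\<^sub>m n"
  proof (rule eq_matI)
    fix i j assume "i < dim_row (1\<^sub>m n)" "j < dim_col (1\<^sub>m n)"
    then have ij: "i < n" "j < n" by auto
    have "(W * W) $$ (i, j) = (\<Sum>k = 0..<n. ((if i = k then 1 else 0) - b * u $ i * u $ k) *
        ((if k = j then 1 else 0) - b * u $ k * u $ j))"
      using ij by (simp add: W_def scalar_prod_def)
    also have "\<dots> = (\<Sum>k = 0..<n. (if i = k then (if k = j then 1 else 0) else 0)
        - (if i = k then b * u $ k * u $ j else 0)
        - (if k = j then b * u $ i * u $ k else 0)
        + b * b * u $ i * u $ j * (u $ k * u $ k))"
      by (intro sum.cong refl) (auto simp: algebra_simps)
    also have "\<dots> = (if i = j then 1 else 0) - 2 * b * u $ i * u $ j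
        + b * b * u $ i * u $ j * (u \<bullet> u)"
      using ij by (simp add: sum.distrib sum_subtractf uu sum_distrib_left)
    also have "b * b * u $ i * u $ j * (u \<bullet> u) = b * u $ i * u $ j * (b * (u \<bullet> u))"
      by (simp add: algebra_simps)
    finally show "(W * W) $$ (i, j) = 1\<^sub>m n $$ (i, j)" using ij buu by simp
  qed (use W in auto)
  have u0: "u $ 0 = v $ 0 - 1" using n v by (simp add: u_def)
  \<comment> \<open>Both v and e_0 have length 1, so |u|^2 = 2 - 2 v_0 = -2 u_0. Hence b u_0 = -1,
    which turns column 0 of \<open>W\<close> into v.\<close>
  have "u \<bullet> u = v \<bullet> v - v \<bullet> unit_vec n 0 - (unit_vec n 0 \<bullet> v - unit_vec n 0 \<bullet> unit_vec n 0)"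
    using v unfolding u_def by (simp add: minus_scalar_prod_distrib[of _ n] scalar_prod_minus_distrib[of _ n])
  also have "\<dots> = - 2 * u $ 0"
    using n v u0 by (simp add: scalar_prod_left_unit scalar_prod_right_unit)
  finally have "- 2 * (b * u $ 0) = 2" using buu by simp
  then have bu0: "b * u $ 0 = - 1" by simp
  have "W *\<^sub>v unit_vec n 0 = v"
  proof (rule eq_vecI)
    fix i assume "i < dim_vec v"
    then have i: "i < n" using v by simp
    have "(W *\<^sub>v unit_vec n 0) $ i = W $$ (i, 0)"
      using i n W by (simp add: scalar_prod_right_unit)
    also have "\<dots> = (if i = 0 then 1 else 0) - u $ i * (b * u $ 0)"
      using i n by (simp add: W_def)
    also have "\<dots> = v $ i" unfolding bu0 using i v by (simp add: u_def)
    finally show "(W *\<^sub>v unit_vec n 0) $ i = v $ i" .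
  qed (use W v in auto)
  moreover have "transpose_mat W = W" by (rule eq_matI) (auto simp: W_def)
  ultimately show thesis using that W WW by blast
qed

lemma four_block_diag_mult:
  fixes a b :: real
  assumes "A \<in> carrier_mat k k" "B \<in> carrier_mat k k"
  shows "four_block_mat (mat 1 1 (\<lambda>_. a)) (0\<^sub>m 1 k) (0\<^sub>m k 1) A *
      four_block_mat (mat 1 1 (\<lambda>_. b)) (0\<^sub>m 1 k) (0\<^sub>m k 1) B =
      four_block_mat (mat 1 1 (\<lambda>_. a * b)) (0\<^sub>m 1 k) (0\<^sub>m k 1) (A * B)"
proof -
  have "mat 1 1 (\<lambda>_. a) * mat 1 1 (\<lambda>_. b) = mat 1 1 (\<lambda>_. a * b)"
    by (rule eq_matI) (auto simp: scalar_prod_def)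
  then show ?thesis
    using assms by (subst mult_four_block_mat[of _ 1 1 _ k _ k]) auto
qed

lemma four_block_diag_form:
  fixes a :: real
  assumes A: "A \<in> carrier_mat k k" and x: "x \<in> carrier_vec 1" and y: "y \<in> carrier_vec k"
  shows "(x @\<^sub>v y) \<bullet> (four_block_mat (mat 1 1 (\<lambda>_. a)) (0\<^sub>m 1 k) (0\<^sub>m k 1) A *\<^sub>v (x @\<^sub>v y)) =
    a * (x $ 0)\<^sup>2 + y \<bullet> (A *\<^sub>v y)"
proof -
  have 1: "mat 1 1 (\<lambda>_. a) *\<^sub>v x = a \<cdot>\<^sub>v x"
    using x by (intro eq_vecI) (auto simp: scalar_prod_def)
  have "four_block_mat (mat 1 1 (\<lambda>_. a)) (0\<^sub>m 1 k) (0\<^sub>m k 1) A *\<^sub>v (x @\<^sub>v y) = (a \<cdot>\<^sub>v x) @\<^sub>v (A *\<^sub>v y)"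
    using A x y by (subst four_block_mat_mult_vec[of _ 1 1 _ k _ k]) (auto simp: 1 simp del: One_nat_def)
  moreover have "x \<bullet> (a \<cdot>\<^sub>v x) = a * (x $ 0)\<^sup>2"
    using x by (simp add: scalar_prod_def power2_eq_square)
  ultimately show ?thesis
    using A x y by (simp add: scalar_prod_append[of _ 1 _ k])
qed

text \<open>Deflation: a reflection carries a unit eigenvector to e_0 and makes the conjugated
  matrix block diagonal, with the eigenvalue e > 0 in the corner. The corner gets 1 / sqrt e, the
  remaining block gets its inverse root by induction, and the same reflection carries the result
  back.\<close>

lemma pos_def_inverse_sqrt:
  assumes "A \<in> carrier_mat n n" "pos_def_mat A"
  shows "\<exists>B\<in>carrier_mat n n. pos_def_mat B \<and> B * B * A = 1\<^sub>m n"
  using assms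
proof (induction n arbitrary: A)
  case 0
  then show ?case by (intro bexI[of _ A]) auto
next
  case (Suc k)
  let ?n = "Suc k"
  have A: "A \<in> carrier_mat ?n ?n" and symA: "transpose_mat A = A"
    and posA: "\<And>a. a \<in> carrier_vec ?n \<Longrightarrow> a \<noteq> 0\<^sub>v ?n \<Longrightarrow> a \<bullet> (A *\<^sub>v a) > 0"
    using Suc.prems by (auto simp: pos_def_mat_def)
  obtain v0 e where v0: "v0 \<in> carrier_vec ?n" "v0 \<noteq> 0\<^sub>v ?n" "A *\<^sub>v v0 = e \<cdot>\<^sub>v v0"
    using symmetric_mat_eigenvector[OF A symA] by auto
  have v0pos: "v0 \<bullet> v0 > 0" using scalar_prod_self_pos v0 by blast
  define v where "v = (1 / sqrt (v0 \<bullet> v0)) \<cdot>\<^sub>v v0"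
  have v: "v \<in> carrier_vec ?n" using v0 by (simp add: v_def)
  have vv: "v \<bullet> v = 1" using v0 v0pos by (simp add: v_def)
  have Av: "A *\<^sub>v v = e \<cdot>\<^sub>v v"
    using A v0 by (simp add: v_def mult_mat_vec smult_smult_assoc mult.commute)
  have "v \<noteq> 0\<^sub>v ?n" using vv v by auto
  then have e: "e > 0" using posA[OF v] Av v vv by simp
  obtain W where W: "W \<in> carrier_mat ?n ?n" "transpose_mat W = W" "W * W = 1\<^sub>m ?n"
    "W *\<^sub>v unit_vec ?n 0 = v"
    using householder[OF v vv] by blast
  have WWx: "W *\<^sub>v (W *\<^sub>v x) = x" if "x \<in> carrier_vec ?n" for x
    using that W by (simp add: assoc_mult_mat_vec[symmetric])
  define M where "M = W * A * W"
  have M: "M \<in> carrier_mat ?n ?n" using W A by (simp add: M_def)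
  have symM: "transpose_mat M = M"
    using W A symA by (simp add: M_def transpose_mult[of _ ?n ?n _ ?n] assoc_mult_mat[of _ ?n ?n _ ?n _ ?n])
  have Mx: "M *\<^sub>v x = W *\<^sub>v (A *\<^sub>v (W *\<^sub>v x))" if "x \<in> carrier_vec ?n" for x
    using that W A by (simp add: M_def assoc_mult_mat_vec[of _ ?n ?n _ ?n])
  have Me: "M *\<^sub>v unit_vec ?n 0 = e \<cdot>\<^sub>v unit_vec ?n 0"
    using Mx[of "unit_vec ?n 0"] W v Av WWx[of "unit_vec ?n 0"] by (simp add: mult_mat_vec)
  have M0: "M $$ (i, 0) = (if i = 0 then e else 0)" if "i < ?n" for i
    using arg_cong[OF Me, of "\<lambda>v. v $ i"] that M by (simp add: scalar_prod_right_unit)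
  have M0': "M $$ (0, i) = (if i = 0 then e else 0)" if "i < ?n" for i
    using M0[OF that] that M symM by (metis carrier_matD index_transpose_mat(1) zero_less_Suc)
  define M1 where "M1 = mat k k (\<lambda>(i, j). M $$ (Suc i, Suc j))"
  have M1: "M1 \<in> carrier_mat k k" by (simp add: M1_def)
  have MM1: "M = four_block_mat (mat 1 1 (\<lambda>_. e)) (0\<^sub>m 1 k) (0\<^sub>m k 1) M1"
    by (rule eq_matI) (use M M0 M0' in \<open>auto simp: M1_def\<close>)
  have posM: "x \<bullet> (M *\<^sub>v x) > 0" if x: "x \<in> carrier_vec ?n" "x \<noteq> 0\<^sub>v ?n" for x
  proof -
    have "W *\<^sub>v x \<noteq> 0\<^sub>v ?n"
    proof
      assume "W *\<^sub>v x = 0\<^sub>v ?n"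
      then show False using WWx[OF x(1)] x W by auto
    qed
    moreover have "x \<bullet> (M *\<^sub>v x) = (W *\<^sub>v x) \<bullet> (A *\<^sub>v (W *\<^sub>v x))"
      unfolding Mx[OF x(1)] using W A x
      by (subst symmetric_mat_scalar_prod[symmetric, of W ?n]) auto
    ultimately show ?thesis using posA[of "W *\<^sub>v x"] W x by auto
  qed
  have "pos_def_mat M1"
    unfolding pos_def_mat_def
  proof (intro conjI ballI impI)
    show "square_mat M1" using M1 by auto
    show "transpose_mat M1 = M1"
    proof (rule eq_matI)
      fix i j assume "i < dim_row M1" "j < dim_col M1"
      then have "i < k" "j < k" using M1 by auto
      then show "transpose_mat M1 $$ (i, j) = M1 $$ (i, j)"
        using M symM by (simp add: M1_def) (metis Suc_mono carrier_matD index_transpose_mat(1))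
    qed (use M1 in auto)
    fix a :: "real vec" assume "a \<in> carrier_vec (dim_row M1)" "a \<noteq> 0\<^sub>v (dim_row M1)"
    then have a: "a \<in> carrier_vec k" "a \<noteq> 0\<^sub>v k" using M1 by auto
    have ne: "(0\<^sub>v 1 @\<^sub>v a) \<noteq> 0\<^sub>v ?n"
    proof
      assume eq: "(0\<^sub>v 1 @\<^sub>v a) = 0\<^sub>v ?n"
      have "a $ i = 0" if "i < k" for i
        using arg_cong[OF eq, of "\<lambda>v. v $ (Suc i)"] that a by simp
      then show False using a by (metis carrier_vecD dim_vec eq_vecI index_zero_vec(1) zero_carrier_vec)
    qed
    moreover have "(0\<^sub>v 1 @\<^sub>v a) \<in> carrier_vec ?n" using a by (metis append_carrier_vec plus_1_eq_Suc zero_carrier_vec)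
    ultimately have "(0\<^sub>v 1 @\<^sub>v a) \<bullet> (M *\<^sub>v (0\<^sub>v 1 @\<^sub>v a)) > 0" using posM by blast
    then show "a \<bullet> (M1 *\<^sub>v a) > 0"
      unfolding MM1 using four_block_diag_form[OF M1, of "0\<^sub>v 1" a e] a by simp
  qed
  then obtain B1 where B1: "B1 \<in> carrier_mat k k" "pos_def_mat B1" "B1 * B1 * M1 = 1\<^sub>m k"
    using Suc.IH[OF M1] by blast
  define N where "N = four_block_mat (mat 1 1 (\<lambda>_. 1 / sqrt e)) (0\<^sub>m 1 k) (0\<^sub>m k 1) B1"
  have N: "N \<in> carrier_mat ?n ?n" unfolding N_def using B1 by (metis four_block_carrier_mat mat_carrier plus_1_eq_Suc)
  have symB1: "transpose_mat B1 = B1" using B1 by (simp add: pos_def_mat_def)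
  have symN: "transpose_mat N = N"
    unfolding N_def
    by (subst transpose_four_block_mat[of _ 1 1 _ k _ k]) (use B1 symB1 in \<open>auto intro!: cong_four_block_mat eq_matI\<close>)
  have "N * N * M = four_block_mat (mat 1 1 (\<lambda>_. 1 / sqrt e * (1 / sqrt e) * e)) (0\<^sub>m 1 k) (0\<^sub>m k 1) (B1 * B1 * M1)"
    unfolding N_def MM1 using B1 M1 by (simp add: four_block_diag_mult[of _ k] del: One_nat_def)
  also have "\<dots> = 1\<^sub>m ?n"
    using e B1 by (intro eq_matI) auto
  finally have NNM: "N * N * M = 1\<^sub>m ?n" .
  define B where "B = W * N * W"
  have B: "B \<in> carrier_mat ?n ?n" using W N by (simp add: B_def)
  have symB: "transpose_mat B = B"
    using W N symN by (simp add: B_def transpose_mult[of _ ?n ?n _ ?n] assoc_mult_mat[of _ ?n ?n _ ?n _ ?n])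
  have AM: "A = W * M * W"
  proof -
    have "W * M * W = (W * W) * A * (W * W)"
      unfolding M_def using W(1) A by (simp add: assoc_mult_mat[of _ ?n ?n _ ?n _ ?n])
    then show ?thesis using W A by simp
  qed
  have "B * B * A = W * N * (W * W) * N * (W * W) * M * W"
    unfolding B_def AM using W(1) N M by (simp add: assoc_mult_mat[of _ ?n ?n _ ?n _ ?n])
  also have "\<dots> = W * (N * N * M) * W"
    using W N M by (simp add: assoc_mult_mat[of _ ?n ?n _ ?n _ ?n])
  also have "\<dots> = 1\<^sub>m ?n" unfolding NNM using W by simp
  finally have BBA: "B * B * A = 1\<^sub>m ?n" .
  have "a \<bullet> (B *\<^sub>v a) > 0" if a: "a \<in> carrier_vec ?n" "a \<noteq> 0\<^sub>v ?n" for a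
  proof -
    define b where "b = W *\<^sub>v a"
    have b: "b \<in> carrier_vec ?n" using W a by (simp add: b_def)
    have "W *\<^sub>v 0\<^sub>v ?n = 0\<^sub>v ?n" using W(1) by (intro eq_vecI) auto
    then have bne: "b \<noteq> 0\<^sub>v ?n" using WWx[OF a(1)] a unfolding b_def by metis
    have "a \<bullet> (B *\<^sub>v a) = b \<bullet> (N *\<^sub>v b)"
      using W N a symmetric_mat_scalar_prod[OF W(1,2) a(1), of "N *\<^sub>v b"]
      by (simp add: B_def b_def assoc_mult_mat_vec[of _ ?n ?n _ ?n])
    define x y where "x = vec_first b 1" and "y = vec_last b k"
    have xy: "x \<in> carrier_vec 1" "y \<in> carrier_vec k" "b = x @\<^sub>v y"
      using b by (auto simp: x_def y_def vec_first_last_append)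
    have form: "b \<bullet> (N *\<^sub>v b) = 1 / sqrt e * (x $ 0)\<^sup>2 + y \<bullet> (B1 *\<^sub>v y)"
      unfolding N_def xy(3) using four_block_diag_form[OF B1(1) xy(1,2)] .
    show ?thesis
    proof (cases "y = 0\<^sub>v k")
      case True
      have "x $ 0 \<noteq> 0"
      proof
        assume "x $ 0 = 0"
        then have "b = 0\<^sub>v ?n" unfolding xy(3) True using xy(1) by (intro eq_vecI) auto
        with bne show False by simp
      qed
      then show ?thesis using \<open>a \<bullet> (B *\<^sub>v a) = b \<bullet> (N *\<^sub>v b)\<close> form True e B1 xy by simp
    next
      case False
      then have "y \<bullet> (B1 *\<^sub>v y) > 0" using B1 xy by (auto simp: pos_def_mat_def)
      moreover have "1 / sqrt e * (x $ 0)\<^sup>2 \<ge> 0" using e by simp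
      ultimately show ?thesis using \<open>a \<bullet> (B *\<^sub>v a) = b \<bullet> (N *\<^sub>v b)\<close> form by linarith
    qed
  qed
  then have "pos_def_mat B" using B symB by (auto simp: pos_def_mat_def)
  then show ?case using B BBA by blast
qed

text \<open>\<open>inv_sqrt_mat\<close> is a choice, so existence has to come first. The witness
  gives a left inverse of \<open>A\<close>; for square matrices this is a right inverse too, as the
  chosen predicate demands.\<close>

lemma inv_sqrt_mat_props:
  assumes A: "A \<in> carrier_mat n n" and pd: "pos_def_mat A"
  shows "inv_sqrt_mat A \<in> carrier_mat n n" "transpose_mat (inv_sqrt_mat A) = inv_sqrt_mat A"
    "A * (inv_sqrt_mat A * inv_sqrt_mat A) = 1\<^sub>m n"
proof -
  let ?P = "\<lambda>B. B \<in> carrier_mat (dim_row A) (dim_row A) \<and> pos_def_mat B \<and>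
     inverts_mat A (B * B) \<and> inverts_mat (B * B) A"
  obtain B where B: "B \<in> carrier_mat n n" "pos_def_mat B" "B * B * A = 1\<^sub>m n"
    using pos_def_inverse_sqrt[OF A pd] by blast
  moreover have "A * (B * B) = 1\<^sub>m n"
    by (rule mat_mult_left_right_inverse[of _ n]) (use A B in auto)
  ultimately have "?P B" using A by (simp add: inverts_mat_def)
  then have "?P (inv_sqrt_mat A)" unfolding inv_sqrt_mat_def by (rule someI)
  then show "inv_sqrt_mat A \<in> carrier_mat n n" "transpose_mat (inv_sqrt_mat A) = inv_sqrt_mat A"
    "A * (inv_sqrt_mat A * inv_sqrt_mat A) = 1\<^sub>m n"
    using A by (auto simp: pos_def_mat_def inverts_mat_def)
qed

section \<open>Whitening and orthogonal projection\<close>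

text \<open>The squared length of the whitened \<open>u\<close> is the quadratic form of the inverse
  of \<open>A\<close> at \<open>u\<close>. The vector \<open>b\<close> stands for that inverse
  applied to \<open>u\<close>, so that bounds on the form of \<open>A\<close> can be applied
  directly.\<close>

lemma inv_sqrt_mat_form:
  assumes A: "A \<in> carrier_mat d d" and pd: "pos_def_mat A" and u: "u \<in> carrier_vec d"
  obtains b where "b \<in> carrier_vec d" "A *\<^sub>v b = u"
    "(inv_sqrt_mat A *\<^sub>v u) \<bullet> (inv_sqrt_mat A *\<^sub>v u) = b \<bullet> u"
proof -
  let ?B = "inv_sqrt_mat A"
  note B = inv_sqrt_mat_props[OF A pd]
  define b where "b = ?B *\<^sub>v (?B *\<^sub>v u)"
  have "A *\<^sub>v b = (A * (?B * ?B)) *\<^sub>v u"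
    using A B(1) u by (simp add: b_def assoc_mult_mat_vec[of _ d d _ d])
  then have "A *\<^sub>v b = u" using B(3) u by simp
  moreover have "(?B *\<^sub>v u) \<bullet> (?B *\<^sub>v u) = b \<bullet> u"
    unfolding b_def using B u symmetric_mat_scalar_prod[OF B(1,2), of "?B *\<^sub>v u" u] by simp
  moreover have "b \<in> carrier_vec d" using B u by (simp add: b_def)
  ultimately show thesis using that by blast
qed

text \<open>Nonnegativity of |b / 2 - u|^2 gives b . u \<le> |b|^2 / 4 + |u|^2, and the lower bound
  on the form gives |b|^2 / 4 \<le> (b . u) / 2. The 1/2 in that bound is the variance of the real
  and imaginary parts of the destination noise.\<close>

lemma inv_sqrt_mat_upper:
  assumes A: "A \<in> carrier_mat d d" and pd: "pos_def_mat A" and u: "u \<in> carrier_vec d"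
    and lower: "\<And>a. a \<in> carrier_vec d \<Longrightarrow> a \<bullet> a / 2 \<le> a \<bullet> (A *\<^sub>v a)"
  shows "(inv_sqrt_mat A *\<^sub>v u) \<bullet> (inv_sqrt_mat A *\<^sub>v u) \<le> 2 * (u \<bullet> u)"
proof -
  obtain b where b: "b \<in> carrier_vec d" "A *\<^sub>v b = u"
    and eq: "(inv_sqrt_mat A *\<^sub>v u) \<bullet> (inv_sqrt_mat A *\<^sub>v u) = b \<bullet> u"
    using inv_sqrt_mat_form[OF A pd u] by blast
  have "0 \<le> ((1 / 2) \<cdot>\<^sub>v b - u) \<bullet> ((1 / 2) \<cdot>\<^sub>v b - u)" by (rule scalar_prod_self_nonneg)
  also have "\<dots> = b \<bullet> b / 4 - b \<bullet> u + u \<bullet> u"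
    using b(1) u by (simp add: minus_scalar_prod_distrib[of _ d] scalar_prod_minus_distrib[of _ d]
        comm_scalar_prod[of u d b] diff_divide_distrib)
  finally show ?thesis using lower[OF b(1)] b(2) eq by simp
qed

text \<open>Cauchy-Schwarz for the form of \<open>A\<close>: |u|^4 = (b . A u)^2 \<le> (b . A b) (u
  . A u) with A b = u.\<close>

lemma inv_sqrt_mat_lower:
  assumes A: "A \<in> carrier_mat d d" and pd: "pos_def_mat A" and u: "u \<in> carrier_vec d"
    and upper: "\<And>a. a \<in> carrier_vec d \<Longrightarrow> a \<bullet> (A *\<^sub>v a) \<le> r * (a \<bullet> a)"
  shows "u \<bullet> u \<le> r * ((inv_sqrt_mat A *\<^sub>v u) \<bullet> (inv_sqrt_mat A *\<^sub>v u))"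
proof (cases "u = 0\<^sub>v d")
  case True
  have "inv_sqrt_mat A *\<^sub>v u = 0\<^sub>v d"
    using inv_sqrt_mat_props(1)[OF A pd] True by (intro eq_vecI) auto
  then show ?thesis using True by simp
next
  case False
  obtain b where b: "b \<in> carrier_vec d" "A *\<^sub>v b = u"
    and eq: "(inv_sqrt_mat A *\<^sub>v u) \<bullet> (inv_sqrt_mat A *\<^sub>v u) = b \<bullet> u"
    using inv_sqrt_mat_form[OF A pd u] by blast
  have symA: "transpose_mat A = A" and posA: "\<And>a. a \<in> carrier_vec d \<Longrightarrow> a \<noteq> 0\<^sub>v d \<Longrightarrow> a \<bullet> (A *\<^sub>v a) > 0"
    using pd A by (auto simp: pos_def_mat_def)
  have "b \<noteq> 0\<^sub>v d"
  proof
    assume "b = 0\<^sub>v d"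
    then have "u = 0\<^sub>v d" unfolding b(2)[symmetric] using A by (intro eq_vecI) auto
    with False show False by simp
  qed
  define q where "q = b \<bullet> u"
  have q: "q > 0" using posA[OF b(1) \<open>b \<noteq> 0\<^sub>v d\<close>] b(2) by (simp add: q_def)
  \<comment> \<open>The minimizer of the form at u - t b, which as a function of t is u . A u - 2 t
    |u|^2 + t^2 q.\<close>
  define t where "t = (u \<bullet> u) / q"
  have uu: "u \<bullet> u > 0" using scalar_prod_self_pos[OF u False] .
  define x where "x = u - t \<cdot>\<^sub>v b"
  have x: "x \<in> carrier_vec d" using u b by (simp add: x_def)
  have Ax: "A *\<^sub>v x = A *\<^sub>v u - t \<cdot>\<^sub>v u"
    using A b u by (simp add: x_def mult_minus_distrib_mat_vec[of _ d d] mult_mat_vec)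
  have bAu: "b \<bullet> (A *\<^sub>v u) = u \<bullet> u"
    using symmetric_mat_scalar_prod[OF A symA b(1) u] b(2) by simp
  have "0 \<le> x \<bullet> (A *\<^sub>v x)" using posA[OF x] A x by (cases "x = 0\<^sub>v d") fastforce+
  also have "\<dots> = u \<bullet> (A *\<^sub>v u) - 2 * t * (u \<bullet> u) + t * t * q"
    unfolding Ax unfolding x_def using A u b(1) bAu
    by (simp add: minus_scalar_prod_distrib[of _ d] scalar_prod_minus_distrib[of _ d] q_def algebra_simps)
  also have "\<dots> = u \<bullet> (A *\<^sub>v u) - t * (u \<bullet> u)" using q by (simp add: t_def)
  finally have "t * (u \<bullet> u) \<le> r * (u \<bullet> u)" using upper[OF u] by linarith
  then have "t \<le> r" using uu by simp
  then show ?thesis using q eq by (simp add: t_def q_def divide_le_eq)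
qed

section \<open>Spans and projection onto an orthogonal complement\<close>

abbreviation vec_span :: "nat \<Rightarrow> real vec set \<Rightarrow> real vec set" where
  "vec_span d \<equiv> LinearCombinations.module.span class_ring (module_vec TYPE(real) d)"

lemma vec_span_induct [consumes 2, case_names zero base add smult]:
  assumes "S \<subseteq> carrier_vec d" "x \<in> vec_span d S"
    and "P (0\<^sub>v d)"
    and "\<And>s. s \<in> S \<Longrightarrow> P s"
    and "\<And>u v. u \<in> carrier_vec d \<Longrightarrow> v \<in> carrier_vec d \<Longrightarrow> P u \<Longrightarrow> P v \<Longrightarrow> P (u + v)"
    and "\<And>c u. u \<in> carrier_vec d \<Longrightarrow> P u \<Longrightarrow> P (c \<cdot>\<^sub>v u)"
  shows "P x"
proof -
  interpret vec_space "TYPE(real)" d .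
  have "LinearCombinations.submodule class_ring {x \<in> carrier_vec d. P x} (module_vec TYPE(real) d)"
    unfolding LinearCombinations.submodule_def using assms(3-) by (auto simp: module_axioms module_vec_simps)
  then have "vec_span d S \<subseteq> {x \<in> carrier_vec d. P x}"
    by (rule span_is_subset[rotated]) (use assms in auto)
  then show ?thesis using assms(2) by auto
qed

lemma vec_span_orthogonal:
  assumes S: "S \<subseteq> carrier_vec d" and p: "p \<in> carrier_vec d" and "\<And>s. s \<in> S \<Longrightarrow> p \<bullet> s = 0"
    and x: "x \<in> vec_span d S"
  shows "p \<bullet> x = 0"
  using S x by (induction rule: vec_span_induct) (use assms in \<open>auto simp: scalar_prod_add_distrib[of _ d]\<close>)

text \<open>One Gram-Schmidt step per vector: the residual p' of the new vector \<open>s\<close> is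
  orthogonal to \<open>S\<close>, and it remains to subtract from p its component along p'. If p' =
  0, then \<open>s\<close> already lies in the span of \<open>S\<close>.\<close>

lemma orthogonal_projection_exists:
  assumes "finite S" "S \<subseteq> carrier_vec d" "y \<in> carrier_vec d"
  shows "\<exists>p\<in>carrier_vec d. (\<forall>s\<in>S. p \<bullet> s = 0) \<and> y - p \<in> vec_span d S"
  using assms
proof (induction S arbitrary: y rule: finite_induct)
  case empty
  interpret vec_space "TYPE(real)" d .
  show ?case using empty span_zero by (intro bexI[of _ y]) auto
next
  case (insert s S)
  interpret vec_space "TYPE(real)" d .
  have S: "S \<subseteq> carrier_vec d" "s \<in> carrier_vec d" "insert s S \<subseteq> carrier_vec d" using insert by auto
  obtain p where p: "p \<in> carrier_vec d" "\<And>t. t \<in> S \<Longrightarrow> p \<bullet> t = 0" "y - p \<in> span S"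
    using insert.IH[OF S(1) insert.prems(2)] by blast
  obtain p' where p': "p' \<in> carrier_vec d" "\<And>t. t \<in> S \<Longrightarrow> p' \<bullet> t = 0" "s - p' \<in> span S"
    using insert.IH[OF S(1) S(2)] by blast
  have mono: "span S \<subseteq> span (insert s S)" by (intro span_is_monotone) auto
  have s_in: "s \<in> span (insert s S)" using in_own_span[OF S(3)] by auto
  \<comment> \<open>Whatever is orthogonal to \<open>S\<close> sees only the residual p' of
    \<open>s\<close>, since s - p' lies in the span of \<open>S\<close>.\<close>
  have s_eq: "q \<bullet> s = q \<bullet> p'" if "q \<in> carrier_vec d" "\<And>t. t \<in> S \<Longrightarrow> q \<bullet> t = 0" for q
    using vec_span_orthogonal[OF S(1) that p'(3)] that(1) p'(1) S(2)
    by (simp add: scalar_prod_minus_distrib[of _ d])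
  have "s = p' + (s - p')" using p'(1) S(2) by auto
  have p'_in: "p' \<in> span (insert s S)"
  proof -
    have "p' = s + (- 1) \<cdot>\<^sub>v (s - p')" using p'(1) S(2) by (intro eq_vecI) auto
    moreover have "s + (- 1) \<cdot>\<^sub>v (s - p') \<in> span (insert s S)"
      by (intro span_add1[OF S(3)] s_in smult_in_span[OF S(3)]) (use mono p'(3) in auto)
    ultimately show ?thesis by simp
  qed
  show ?case
  proof (cases "p' = 0\<^sub>v d")
    case True
    then show ?thesis using p s_eq[OF p(1,2)] mono by (intro bexI[of _ p]) auto
  next
    case False
    define c where "c = (p \<bullet> p') / (p' \<bullet> p')"
    have pos: "p' \<bullet> p' > 0" using scalar_prod_self_pos[OF p'(1) False] .
    have "(p - c \<cdot>\<^sub>v p') \<bullet> t = 0" if "t \<in> insert s S" for t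
    proof (cases "t = s")
      case True
      then show ?thesis using pos p(1) p'(1) S(2) s_eq[OF p(1,2)] s_eq[OF p'(1,2)]
        by (simp add: minus_scalar_prod_distrib[of _ d] c_def)
    next
      case False
      then show ?thesis using that p(1,2) p'(1,2) S(1)
        by (auto simp: minus_scalar_prod_distrib[of _ d])
    qed
    moreover have "y - (p - c \<cdot>\<^sub>v p') = (y - p) + c \<cdot>\<^sub>v p'"
      using p(1) p'(1) insert.prems(2) by (intro eq_vecI) auto
    moreover have "(y - p) + c \<cdot>\<^sub>v p' \<in> span (insert s S)"
      by (intro span_add1[OF S(3)] smult_in_span[OF S(3)] p'_in) (use mono p(3) in auto)
    ultimately show ?thesis using p(1) p'(1) by (intro bexI[of _ "p - c \<cdot>\<^sub>v p'"]) auto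
  qed
qed

text \<open>Two candidates differ by a vector that lies in the span and is orthogonal to it, hence
  orthogonal to itself. This uniqueness also gives access to the definite description in
  \<open>proj_compl\<close>.\<close>

lemma proj_compl_eqI:
  assumes S: "S \<subseteq> carrier_vec d" and y: "y \<in> carrier_vec d"
    and p: "p \<in> carrier_vec d" "\<And>s. s \<in> S \<Longrightarrow> p \<bullet> s = 0" "y - p \<in> vec_span d S"
  shows "proj_compl d S y = p"
  unfolding proj_compl_def
proof (rule the_equality)
  interpret vec_space "TYPE(real)" d .
  fix q assume q: "q \<in> carrier_vec d \<and> (\<forall>s\<in>S. q \<bullet> s = 0) \<and> y - q \<in> span S"
  have "p - q = (y - q) + (- 1) \<cdot>\<^sub>v (y - p)" using q p(1) y by (intro eq_vecI) auto
  also have "\<dots> \<in> span S" by (intro span_add1[OF S] smult_in_span[OF S]) (use q p(3) in auto)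
  finally have "p - q \<in> span S" .
  moreover have "(p - q) \<bullet> s = 0" if "s \<in> S" for s
  proof -
    have "s \<in> carrier_vec d" using that S by auto
    then show ?thesis using that q p by (simp add: minus_scalar_prod_distrib[of _ d])
  qed
  ultimately have "(p - q) \<bullet> (p - q) = 0" using vec_span_orthogonal[OF S] p(1) q by auto
  then have 0: "p - q = 0\<^sub>v d" using scalar_prod_self_eq_0_iff[of "p - q" d] p(1) q by auto
  show "q = p"
  proof (rule eq_vecI)
    fix i assume "i < dim_vec p"
    then show "q $ i = p $ i"
      using arg_cong[OF 0, of "\<lambda>v. v $ i"] p(1) q by auto
  qed (use p q in auto)
qed (use p in auto)

lemma proj_compl_props:
  assumes "finite S" and S: "S \<subseteq> carrier_vec d" and y: "y \<in> carrier_vec d"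
  shows "proj_compl d S y \<in> carrier_vec d" "\<And>s. s \<in> S \<Longrightarrow> proj_compl d S y \<bullet> s = 0"
    "y - proj_compl d S y \<in> vec_span d S"
proof -
  obtain p where p: "p \<in> carrier_vec d" "\<And>s. s \<in> S \<Longrightarrow> p \<bullet> s = 0" "y - p \<in> vec_span d S"
    using orthogonal_projection_exists[OF assms] by blast
  then have "proj_compl d S y = p" using proj_compl_eqI[OF S y] by blast
  then show "proj_compl d S y \<in> carrier_vec d" "\<And>s. s \<in> S \<Longrightarrow> proj_compl d S y \<bullet> s = 0"
    "y - proj_compl d S y \<in> vec_span d S" using p by auto
qed

lemma proj_compl_norm_le:
  assumes "finite S" and S: "S \<subseteq> carrier_vec d" and y: "y \<in> carrier_vec d"
  shows "proj_compl d S y \<bullet> proj_compl d S y \<le> y \<bullet> y"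
proof -
  define p where "p = proj_compl d S y"
  note p = proj_compl_props[OF assms, folded p_def]
  have "p \<bullet> (y - p) = 0" using vec_span_orthogonal[OF S p(1,2,3)] by simp
  then have py: "p \<bullet> y = p \<bullet> p" using p(1) y by (simp add: scalar_prod_minus_distrib[of _ d])
  have "0 \<le> (y - p) \<bullet> (y - p)" by (rule scalar_prod_self_nonneg)
  also have "\<dots> = y \<bullet> y - p \<bullet> p"
    using p(1) y py by (simp add: minus_scalar_prod_distrib[of _ d] scalar_prod_minus_distrib[of _ d]
        comm_scalar_prod[of y d p])
  finally show ?thesis by (simp add: p_def)
qed

text \<open>After projection the interference \<open>s\<close> is gone, and the cost of b is |(x -
  b) q + m|^2 with m the projected noise. If a wrong value costs no more than the true one, then |z
  q + m| \<le> |m| for an integer z \<noteq> 0, so |q| \<le> 2 |m|. Integrality of the alphabet is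
  what keeps |z| away from 0.\<close>

lemma projection_decoding_error:
  assumes S: "finite S" "S \<subseteq> carrier_vec d"
    and g: "g \<in> carrier_vec d" and s: "s \<in> vec_span d S" and n: "n \<in> carrier_vec d"
    and y: "y = x \<cdot>\<^sub>v g + s + n"
    and min: "is_arg_min (\<lambda>b. let e = proj_compl d S y - b \<cdot>\<^sub>v proj_compl d S g in e \<bullet> e) (\<lambda>b. b \<in> A) xhat"
    and A: "A \<subseteq> \<int>" "x \<in> A" and ne: "xhat \<noteq> x"
  shows "proj_compl d S g \<bullet> proj_compl d S g \<le> 4 * (n \<bullet> n)"
proof -
  interpret vec_space "TYPE(real)" d .
  define q where "q = proj_compl d S g"
  define m where "m = proj_compl d S n"
  note q = proj_compl_props[OF S g, folded q_def]
  note m = proj_compl_props[OF S n, folded m_def]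
  have sc: "s \<in> carrier_vec d" using s span_is_subset2[OF S(2)] by auto
  have yc: "y \<in> carrier_vec d" using g sc n by (simp add: y)
  have "y - (x \<cdot>\<^sub>v q + m) = x \<cdot>\<^sub>v (g - q) + s + (n - m)"
    unfolding y using g sc n q(1) m(1) by (intro eq_vecI) (auto simp: algebra_simps)
  also have "\<dots> \<in> span S"
    by (intro span_add1[OF S(2)] smult_in_span[OF S(2)] q m s)
  finally have "y - (x \<cdot>\<^sub>v q + m) \<in> span S" .
  moreover have "(x \<cdot>\<^sub>v q + m) \<bullet> t = 0" if "t \<in> S" for t
  proof -
    have "t \<in> carrier_vec d" using that S by auto
    then show ?thesis using that q m by (simp add: add_scalar_prod_distrib[of _ d])
  qed
  ultimately have py: "proj_compl d S y = x \<cdot>\<^sub>v q + m"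
    using q m by (intro proj_compl_eqI S(2) yc) auto
  define e where "e b = (x \<cdot>\<^sub>v q + m - b \<cdot>\<^sub>v q) \<bullet> (x \<cdot>\<^sub>v q + m - b \<cdot>\<^sub>v q)" for b
  have e: "e b = (x - b)\<^sup>2 * (q \<bullet> q) + 2 * (x - b) * (q \<bullet> m) + m \<bullet> m" for b
  proof -
    have "x \<cdot>\<^sub>v q + m - b \<cdot>\<^sub>v q = (x - b) \<cdot>\<^sub>v q + m"
      using q(1) m(1) by (intro eq_vecI) (auto simp: algebra_simps)
    then show ?thesis using q(1) m(1)
      by (simp add: e_def add_scalar_prod_distrib[of _ d] scalar_prod_add_distrib[of _ d]
          comm_scalar_prod[of m d q] power2_eq_square algebra_simps)
  qed
  have mem: "xhat \<in> A" and "\<not> e x < e xhat"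
    using min A(2) unfolding is_arg_min_def py q_def[symmetric] e_def Let_def by auto
  then have "e xhat \<le> e x" by simp
  define z where "z = x - xhat"
  have ez: "z\<^sup>2 * (q \<bullet> q) + 2 * z * (q \<bullet> m) \<le> 0"
    using \<open>e xhat \<le> e x\<close> unfolding e z_def by simp
  have z1: "z\<^sup>2 \<ge> 1"
  proof -
    have "x \<in> \<int>" "xhat \<in> \<int>" using A mem by auto
    then have "z \<in> \<int>" "z \<noteq> 0" using ne by (auto simp: z_def)
    then have "\<bar>z\<bar> \<ge> 1" by (rule Ints_nonzero_abs_ge1)
    then show ?thesis by (metis abs_ge_zero one_le_power power2_abs)
  qed
  \<comment> \<open>This square replaces the triangle inequality: its mixed term is twice that of
    \<open>ez\<close>, so adding the two bounds cancels it.\<close>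
  have "0 \<le> (z \<cdot>\<^sub>v q + 2 \<cdot>\<^sub>v m) \<bullet> (z \<cdot>\<^sub>v q + 2 \<cdot>\<^sub>v m)" by (rule scalar_prod_self_nonneg)
  also have "\<dots> = z\<^sup>2 * (q \<bullet> q) + 4 * z * (q \<bullet> m) + 4 * (m \<bullet> m)"
    using q(1) m(1) by (simp add: add_scalar_prod_distrib[of _ d] scalar_prod_add_distrib[of _ d]
          comm_scalar_prod[of m d q] power2_eq_square algebra_simps)
  finally have "z\<^sup>2 * (q \<bullet> q) \<le> 4 * (m \<bullet> m)" using ez by linarith
  moreover have "q \<bullet> q \<le> z\<^sup>2 * (q \<bullet> q)"
    using z1 scalar_prod_self_nonneg[of q] by (metis mult.commute mult_right_mono mult_1)
  ultimately show ?thesis using proj_compl_norm_le[OF S n] by (simp add: q_def m_def)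
qed

section \<open>Spans of matrix columns in terms of coefficient vectors\<close>

lemma mult_mat_vec_unit:
  assumes "G \<in> carrier_mat d K" "i < K"
  shows "G *\<^sub>v unit_vec K i = (col G i :: real vec)"
  using assms by (intro eq_vecI) (auto simp: scalar_prod_right_unit)

text \<open>The coefficients are padded with zeros to a vector of full length \<open>K\<close>.
  Projecting a column outside \<open>I\<close> along the columns in \<open>I\<close> then becomes
  multiplication of \<open>G\<close> by a vector whose own coordinate stays 1.\<close>

lemma vec_span_cols:
  assumes G: "G \<in> carrier_mat d K" and I: "I \<subseteq> {..<K}" and x: "x \<in> vec_span d (col G ` I)"
  shows "\<exists>a\<in>carrier_vec K. x = G *\<^sub>v a \<and> (\<forall>i<K. i \<notin> I \<longrightarrow> a $ i = 0)"
proof -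
  have "col G ` I \<subseteq> carrier_vec d" using G by auto
  then show ?thesis using x
  proof (induction rule: vec_span_induct)
    case zero
    show ?case using G by (intro bexI[of _ "0\<^sub>v K"]) (auto intro!: eq_vecI)
  next
    case (base s)
    then obtain i where "i \<in> I" "s = col G i" by auto
    then show ?case using mult_mat_vec_unit[OF G, of i] I by (intro bexI[of _ "unit_vec K i"]) auto
  next
    case (add u v)
    then obtain a b where "a \<in> carrier_vec K" "b \<in> carrier_vec K" "u = G *\<^sub>v a" "v = G *\<^sub>v b"
      "\<forall>i<K. i \<notin> I \<longrightarrow> a $ i = 0" "\<forall>i<K. i \<notin> I \<longrightarrow> b $ i = 0" by blast
    then show ?case using G by (intro bexI[of _ "a + b"]) (auto simp: mult_add_distrib_mat_vec[of _ d K])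
  next
    case (smult c u)
    then obtain a where "a \<in> carrier_vec K" "u = G *\<^sub>v a"
      "\<forall>i<K. i \<notin> I \<longrightarrow> a $ i = 0" by blast
    then show ?case using G by (intro bexI[of _ "c \<cdot>\<^sub>v a"]) (auto simp: mult_mat_vec[of _ d K])
  qed
qed

lemma vec_span_colsI:
  assumes G: "G \<in> carrier_mat d K" and I: "I \<subseteq> {..<K}"
    and a: "a \<in> carrier_vec K" "\<And>i. i < K \<Longrightarrow> i \<notin> I \<Longrightarrow> a $ i = 0"
  shows "G *\<^sub>v a \<in> vec_span d (col G ` I)"
proof -
  interpret vec_space "TYPE(real)" d .
  have S: "col G ` I \<subseteq> carrier_vec d" using G by auto
  have "vec d (\<lambda>r. \<Sum>i\<in>J. a $ i * G $$ (r, i)) \<in> span (col G ` I)" if "finite J" "J \<subseteq> I" for J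
    using that
  proof (induction J rule: finite_induct)
    case empty
    have "vec d (\<lambda>r. \<Sum>i\<in>{}. a $ i * G $$ (r, i)) = 0\<^sub>v d" by auto
    then show ?case using span_zero by auto
  next
    case (insert i J)
    have "vec d (\<lambda>r. \<Sum>i\<in>insert i J. a $ i * G $$ (r, i)) =
        a $ i \<cdot>\<^sub>v col G i + vec d (\<lambda>r. \<Sum>i\<in>J. a $ i * G $$ (r, i))"
      using insert G I by (intro eq_vecI) auto
    moreover have "col G i \<in> span (col G ` I)" using in_own_span[OF S] insert by auto
    ultimately show ?case using insert by (auto intro!: span_add1[OF S] smult_in_span[OF S])
  qed
  moreover have "G *\<^sub>v a = vec d (\<lambda>r. \<Sum>i\<in>I. a $ i * G $$ (r, i))"
  proof (rule eq_vecI)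
    fix r assume "r < dim_vec (vec d (\<lambda>r. \<Sum>i\<in>I. a $ i * G $$ (r, i)))"
    then have r: "r < d" by simp
    have "(\<Sum>i\<in>I. a $ i * G $$ (r, i)) = (\<Sum>i\<in>{0..<K}. a $ i * G $$ (r, i))"
      using I a(2) by (intro sum.mono_neutral_left) auto
    then show "(G *\<^sub>v a) $ r = (vec d (\<lambda>r. \<Sum>i\<in>I. a $ i * G $$ (r, i))) $ r"
      using r G a(1) by (auto simp: scalar_prod_def mult.commute intro!: sum.cong)
  qed (use G in auto)
  ultimately show ?thesis using I finite_subset[OF I] by auto
qed

section \<open>Injectivity of the design\<close>

text \<open>Tychonoff, transferred to the topology of the function type. Coefficient vectors are
  functions on all of \<open>nat\<close>, so even a finite-dimensional sphere has to be compact in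
  an infinite product.\<close>

lemma compact_PiE_UNIV:
  fixes f :: "'i \<Rightarrow> 'b::topological_space set"
  assumes "\<And>i. compact (f i)"
  shows "compact (PiE UNIV f)"
proof -
  have "compactin (product_topology (\<lambda>_. euclidean) UNIV) (PiE UNIV f)"
    using assms by (simp add: compactin_PiE)
  then show ?thesis by (simp add: euclidean_product_topology)
qed

text \<open>The right-hand side is homogeneous of degree 2 in \<open>a\<close> and in
  \<open>h\<close> separately, so it suffices to bound it on pairs of unit vectors. There it is
  continuous and, by injectivity, positive, so by compactness its minimum is the constant.\<close>

lemma bilinear_lower_bound:
  fixes C :: "'r \<Rightarrow> nat \<Rightarrow> nat \<Rightarrow> complex"
  assumes R: "finite R"
    and inj: "\<And>a h. (\<And>r. r \<in> R \<Longrightarrow> (\<Sum>i<K. \<Sum>j<N. complex_of_real (a i) * h j * C r i j) = 0) \<Longrightarrow>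
      (\<forall>i<K. a i = 0) \<or> (\<forall>j<N. h j = 0)"
  obtains c where "c > 0" "\<And>a h. c * (\<Sum>i<K. (a i)\<^sup>2) * (\<Sum>j<N. (cmod (h j))\<^sup>2) \<le>
      (\<Sum>r\<in>R. (cmod (\<Sum>i<K. \<Sum>j<N. complex_of_real (a i) * h j * C r i j))\<^sup>2)"
proof -
  define B :: "(nat \<Rightarrow> real) \<Rightarrow> (nat \<Rightarrow> complex) \<Rightarrow> real" where
    "B a h = (\<Sum>r\<in>R. (cmod (\<Sum>i<K. \<Sum>j<N. complex_of_real (a i) * h j * C r i j))\<^sup>2)" for a h
  define qa :: "(nat \<Rightarrow> real) \<Rightarrow> real" where "qa a = (\<Sum>i<K. (a i)\<^sup>2)" for a
  define qh :: "(nat \<Rightarrow> complex) \<Rightarrow> real" where "qh h = (\<Sum>j<N. (cmod (h j))\<^sup>2)" for h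
  \<comment> \<open>The coordinates beyond \<open>K\<close> and \<open>N\<close> are pinned to 0,
    and the others lie in unit balls as every unit vector does; this makes the set of pairs of unit
    vectors compact.\<close>
  define S where "S = (PiE UNIV (\<lambda>i. if i < K then cball (0::real) 1 else {0})
      \<times> PiE UNIV (\<lambda>j. if j < N then cball (0::complex) 1 else {0}))
      \<inter> {x. qa (fst x) = 1} \<inter> {x. qh (snd x) = 1}"
  have cont: "continuous_on UNIV (\<lambda>x. qa (fst x))" "continuous_on UNIV (\<lambda>x. qh (snd x))"
    "continuous_on UNIV (\<lambda>x. B (fst x) (snd x))"
    unfolding qa_def qh_def B_def
    by (intro continuous_intros continuous_on_compose2[OF continuous_on_product_coordinates]; simp)+
  have "compact S"
    unfolding S_def
    by (intro compact_Int_closed compact_Times closed_Collect_eq cont continuous_intros compact_PiE_UNIV)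
       auto
  have S_I: "((\<lambda>i. if i < K then a i else 0), (\<lambda>j. if j < N then h j else 0)) \<in> S"
    if "qa a = 1" "qh h = 1" for a h
  proof -
    have "\<bar>a i\<bar> \<le> 1" if "i < K" for i
    proof -
      have "(a i)\<^sup>2 \<le> qa a" unfolding qa_def using that by (intro member_le_sum) auto
      then show ?thesis using \<open>qa a = 1\<close> by (simp add: abs_square_le_1)
    qed
    moreover have "cmod (h j) \<le> 1" if "j < N" for j
    proof -
      have "(cmod (h j))\<^sup>2 \<le> qh h" unfolding qh_def using that by (intro member_le_sum) auto
      then show ?thesis using \<open>qh h = 1\<close> by (simp add: power_le_one_iff)
    qed
    ultimately show ?thesis using that by (auto simp: S_def qa_def qh_def)
  qed
  have B_S: "B (\<lambda>i. if i < K then a i else 0) (\<lambda>j. if j < N then h j else 0) = B a h" for a h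
    by (simp add: B_def)
  have B_pos: "B (fst x) (snd x) > 0" if "x \<in> S" for x
  proof (rule ccontr)
    assume "\<not> ?thesis"
    moreover have "B (fst x) (snd x) \<ge> 0" by (auto simp: B_def intro!: sum_nonneg)
    ultimately have "B (fst x) (snd x) = 0" by simp
    then have "\<And>r. r \<in> R \<Longrightarrow> (\<Sum>i<K. \<Sum>j<N. complex_of_real (fst x i) * snd x j * C r i j) = 0"
      using R by (simp add: B_def sum_nonneg_eq_0_iff)
    then have "(\<forall>i<K. fst x i = 0) \<or> (\<forall>j<N. snd x j = 0)" by (rule inj)
    then have "qa (fst x) = 0 \<or> qh (snd x) = 0" by (auto simp: qa_def qh_def)
    then show False using that by (auto simp: S_def)
  qed
  \<comment> \<open>\<open>S\<close> is empty if \<open>K\<close> or \<open>N\<close> is 0, and then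
    any positive constant serves.\<close>
  obtain c where c: "c > 0" "\<And>x. x \<in> S \<Longrightarrow> c \<le> B (fst x) (snd x)"
  proof (cases "S = {}")
    case True
    then show thesis using that[of 1] by auto
  next
    case False
    obtain x0 where "x0 \<in> S" "\<And>x. x \<in> S \<Longrightarrow> B (fst x0) (snd x0) \<le> B (fst x) (snd x)"
      using continuous_attains_inf[OF \<open>compact S\<close> False continuous_on_subset[OF cont(3)]] by auto
    then show thesis using that B_pos by blast
  qed
  have "c * qa a * qh h \<le> B a h" for a h
  proof (cases "qa a = 0 \<or> qh h = 0")
    case True
    then show ?thesis by (auto simp: B_def intro!: sum_nonneg)
  next
    case False
    moreover have "qa a \<ge> 0" "qh h \<ge> 0" by (auto simp: qa_def qh_def intro!: sum_nonneg)
    ultimately have pos: "qa a > 0" "qh h > 0" by auto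
    define a' where "a' i = a i / sqrt (qa a)" for i
    define h' where "h' j = h j / complex_of_real (sqrt (qh h))" for j
    have "qa a' = 1"
      using pos by (simp add: qa_def a'_def power_divide flip: sum_divide_distrib)
    moreover have "qh h' = 1"
      using pos by (simp add: qh_def h'_def norm_divide power_divide flip: sum_divide_distrib)
    ultimately have "c \<le> B a' h'" using c(2)[OF S_I] B_S by simp
    also have "B a' h' = B a h / (qa a * qh h)"
    proof -
      have "(\<Sum>i<K. \<Sum>j<N. complex_of_real (a' i) * h' j * C r i j) =
          (\<Sum>i<K. \<Sum>j<N. complex_of_real (a i) * h j * C r i j) / complex_of_real (sqrt (qa a) * sqrt (qh h))" for r
        unfolding sum_divide_distrib by (intro sum.cong) (auto simp: a'_def h'_def field_simps)
      then show ?thesis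
        using pos by (simp add: B_def norm_divide norm_mult power_divide power_mult_distrib flip: sum_divide_distrib)
    qed
    finally show ?thesis using pos by (simp add: field_simps)
  qed
  then show thesis using that c(1) by (auto simp: qa_def qh_def B_def)
qed

text \<open>The orthogonality relations amount to |W(a) h|^2 = |a|^2 |h|^2, and a product of reals
  vanishes only with one of its factors.\<close>

lemma cod_injective:
  assumes W: "complex_orthogonal_design T' N' K' W"
    and zero: "\<And>t. t < T' \<Longrightarrow> (\<Sum>k<K'. \<Sum>b<N'. complex_of_real (a k) * h b * W k $$ (t, b)) = 0"
  shows "(\<forall>k<K'. a k = 0) \<or> (\<forall>b<N'. h b = 0)"
proof -
  have Wc: "W i \<in> carrier_mat T' N'" if "i < K'" for i
    using W that by (auto simp: complex_orthogonal_design_def)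
  have W_orth: "(\<Sum>t<T'. cnj (W i $$ (t, p)) * W j $$ (t, q) + cnj (W j $$ (t, p)) * W i $$ (t, q)) =
      (if i = j \<and> p = q then 2 else 0)" if "i < K'" "j < K'" "p < N'" "q < N'" for i j p q
  proof -
    have "mat_adjoint (W i) * W j + mat_adjoint (W j) * W i = (if i = j then 2 else 0) \<cdot>\<^sub>m 1\<^sub>m N'"
      using W that by (auto simp: complex_orthogonal_design_def)
    from arg_cong[OF this, of "\<lambda>A. A $$ (p, q)"] show ?thesis
      using that Wc[OF that(1)] Wc[OF that(2)]
      by (simp add: mat_adjoint_def mat_of_rows_def scalar_prod_def sum.distrib atLeast0LessThan)
  qed
  define y where "y t = (\<Sum>k<K'. \<Sum>b<N'. complex_of_real (a k) * h b * W k $$ (t, b))" for t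
  define F where "F i p j q t = complex_of_real (a i) * complex_of_real (a j) * cnj (h p) * h q * (cnj (W i $$ (t, p)) * W j $$ (t, q))"
    for i p j q t
  have yy: "cnj (y t) * y t = (\<Sum>i<K'. \<Sum>j<K'. \<Sum>p<N'. \<Sum>q<N'. F i p j q t)" for t
    unfolding y_def F_def cnj_sum sum_product
    by (intro sum.cong refl) (simp add: mult_ac)
  \<comment> \<open>A single expansion of |y|^2 contains only W_i^H W_j. As the a_i are real, the
    indices i and j may be exchanged; adding both expansions produces the symmetric expression that
    the design condition evaluates.\<close>
  have yy': "cnj (y t) * y t = (\<Sum>i<K'. \<Sum>j<K'. \<Sum>p<N'. \<Sum>q<N'. F j p i q t)" for t
    unfolding yy by (rule sum.swap)
  have hh: "cnj (h p) * h p = complex_of_real ((cmod (h p))\<^sup>2)" for p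
    by (simp only: complex_norm_square mult.commute)
  have "0 = (\<Sum>t<T'. cnj (y t) * y t + cnj (y t) * y t)"
    using zero by (simp add: y_def)
  also have "\<dots> = (\<Sum>t<T'. \<Sum>i<K'. \<Sum>j<K'. \<Sum>p<N'. \<Sum>q<N'. F i p j q t + F j p i q t)"
    by (subst (2) yy') (simp add: yy sum.distrib)
  also have "\<dots> = (\<Sum>i<K'. \<Sum>j<K'. \<Sum>p<N'. \<Sum>q<N'. \<Sum>t<T'. F i p j q t + F j p i q t)"
    by (simp add: sum.swap[of _ _ "{..<T'}"])
  also have "\<dots> = (\<Sum>i<K'. \<Sum>j<K'. \<Sum>p<N'. \<Sum>q<N'. complex_of_real (a i) * complex_of_real (a j) * cnj (h p) * h q *
      (\<Sum>t<T'. cnj (W i $$ (t, p)) * W j $$ (t, q) + cnj (W j $$ (t, p)) * W i $$ (t, q)))"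
    unfolding F_def by (intro sum.cong refl) (simp add: sum_distrib_left algebra_simps)
  also have "\<dots> = (\<Sum>i<K'. \<Sum>j<K'. \<Sum>p<N'. \<Sum>q<N'. if q = p then if j = i then
      2 * (complex_of_real (a i) * complex_of_real (a i) * (cnj (h p) * h p)) else 0 else 0)"
    by (intro sum.cong refl, subst W_orth) auto
  also have "\<dots> = (\<Sum>i<K'. \<Sum>p<N'. 2 * (complex_of_real (a i) * complex_of_real (a i) * (cnj (h p) * h p)))"
  proof (rule sum.cong[OF refl])
    fix i assume i: "i \<in> {..<K'}"
    have "(\<Sum>j<K'. \<Sum>p<N'. \<Sum>q<N'. if q = p then if j = i then
      2 * (complex_of_real (a i) * complex_of_real (a i) * (cnj (h p) * h p)) else 0 else 0) =
      (\<Sum>j<K'. if j = i then \<Sum>p<N'. 2 * (complex_of_real (a i) * complex_of_real (a i) * (cnj (h p) * h p)) else 0)"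
      by (intro sum.cong refl) auto
    then show "(\<Sum>j<K'. \<Sum>p<N'. \<Sum>q<N'. if q = p then if j = i then
      2 * (complex_of_real (a i) * complex_of_real (a i) * (cnj (h p) * h p)) else 0 else 0) =
      (\<Sum>p<N'. 2 * (complex_of_real (a i) * complex_of_real (a i) * (cnj (h p) * h p)))"
      using i by simp
  qed
  also have "\<dots> = complex_of_real (2 * ((\<Sum>i<K'. (a i)\<^sup>2) * (\<Sum>p<N'. (cmod (h p))\<^sup>2)))"
    unfolding sum_product unfolding sum_distrib_left of_real_sum
    by (intro sum.cong refl) (simp add: hh power2_eq_square[of "a _"])
  finally have "(\<Sum>i<K'. (a i)\<^sup>2) * (\<Sum>p<N'. (cmod (h p))\<^sup>2) = 0"
    by (metis mult_eq_0_iff of_real_eq_0_iff zero_neq_numeral)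
  then show ?thesis by (auto simp: sum_nonneg_eq_0_iff)
qed

lemma sum_blocks:
  fixes f :: "nat \<Rightarrow> 'a::comm_monoid_add"
  shows "(\<Sum>b<L * k. f b) = (\<Sum>l<L. \<Sum>b<k. f (l * k + b))"
proof -
  have "sum f {l * k..<l * k + k} = (\<Sum>b<k. f (l * k + b))" for l
    using sum.shift_bounds_nat_ivl[of f 0 "l * k" k] by (simp add: atLeast0LessThan add.commute)
  then show ?thesis using sum.nat_group[of f k L] by simp
qed

text \<open>If \<open>m\<close> and \<open>l\<close> are the first nonzero blocks of \<open>x\<close> and \<open>h\<close>, block row \<open>m + l\<close> of
  the product is the single term \<open>\<^bold>W(m) h\<^sub>l\<close>.\<close>

lemma X_design_injective:
  assumes W: "complex_orthogonal_design T' N' K' W"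
    and zero: "\<And>r. r < (n + L - 1) * T' \<Longrightarrow> (\<Sum>b<L * N'. X_design T' N' K' W L 1 n x $$ (r, b) * h b) = 0"
  shows "(\<forall>i<n * K'. x i = 0) \<or> (\<forall>j<L * N'. h j = 0)"
proof (rule ccontr)
  assume "\<not> ?thesis"
  then obtain i j where i: "i < n * K'" "x i \<noteq> 0" and j: "j < L * N'" "h j \<noteq> 0" by auto
  let ?P = "\<lambda>m. \<exists>k<K'. x (K' * m + k) \<noteq> 0" and ?Q = "\<lambda>l. \<exists>b<N'. h (l * N' + b) \<noteq> 0"
  have K'pos: "K' > 0" and N'pos: "N' > 0" using i j by (cases K'; cases N'; simp)+
  have P: "?P (i div K')" using i K'pos by (intro exI[of _ "i mod K'"]) auto
  have Q: "?Q (j div N')" using j N'pos by (intro exI[of _ "j mod N'"]) auto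
  define m where "m = (LEAST m. ?P m)"
  define l where "l = (LEAST l. ?Q l)"
  have m: "?P m" "m \<le> i div K'" "\<And>m'. m' < m \<Longrightarrow> \<not> ?P m'"
    unfolding m_def using LeastI[of ?P, OF P] Least_le[of ?P, OF P] not_less_Least[of _ ?P] by auto
  have l: "?Q l" "l \<le> j div N'" "\<And>l'. l' < l \<Longrightarrow> \<not> ?Q l'"
    unfolding l_def using LeastI[of ?Q, OF Q] Least_le[of ?Q, OF Q] not_less_Least[of _ ?Q] by auto
  have mn: "m < n" using m(2) i(1) by (meson le_less_trans less_mult_imp_div_less)
  have lL: "l < L" using l(2) j(1) by (meson le_less_trans less_mult_imp_div_less)
  have "(\<Sum>k<K'. \<Sum>b<N'. complex_of_real (x (K' * m + k)) * h (l * N' + b) * W k $$ (t, b)) = 0"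
    if t: "t < T'" for t
  proof -
    define r where "r = (m + l) * T' + t"
    have rlt: "r < (n + L - 1) * T'"
    proof -
      have "r < (m + l + 1) * T'" using t by (simp add: r_def algebra_simps)
      also have "\<dots> \<le> (n + L - 1) * T'" using mn lL by (intro mult_le_mono1) auto
      finally show ?thesis .
    qed
    have rdiv: "r div T' = m + l" "r mod T' = t" using t by (auto simp: r_def)
    have "0 = (\<Sum>l'<L. \<Sum>b<N'. X_design T' N' K' W L 1 n x $$ (r, l' * N' + b) * h (l' * N' + b))"
      using zero[OF rlt] by (simp add: sum_blocks)
    also have "\<dots> = (\<Sum>l'<L. if l' = l then \<Sum>b<N'. (\<Sum>k<K'. complex_of_real (x (K' * m + k)) * W k $$ (t, b)) * h (l * N' + b) else 0)"
    proof (rule sum.cong[OF refl])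
      fix l' assume "l' \<in> {..<L}"
      then have l': "l' < L" by simp
      have lt: "l' * N' + b < L * N'" if "b < N'" for b
      proof -
        have "l' * N' + b < (l' + 1) * N'" using that by (simp add: algebra_simps)
        also have "\<dots> \<le> L * N'" using l' by (intro mult_le_mono1) auto
        finally show ?thesis .
      qed
      have entry: "X_design T' N' K' W L 1 n x $$ (r, l' * N' + b) =
          (if l' \<le> m + l \<and> m + l - l' < n
           then \<Sum>k<K'. complex_of_real (x (K' * (m + l - l') + k)) * W k $$ (t, b) else 0)" if "b < N'" for b
        using that rlt lt[OF that] rdiv t by (simp add: X_design_def W_block_def linear_design_def Let_def)
      \<comment> \<open>Block columns before \<open>l\<close> meet a zero block of \<open>h\<close>.
        For those after \<open>l\<close>, the symbol block m + l - l' precedes \<open>m\<close> and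
        so vanishes, or the entry is 0 because l' > m + l; that case has to be kept apart, since the
        subtraction is truncated.\<close>
      consider "l' < l" | "l' = l" | "l' > l" by linarith
      then show "(\<Sum>b<N'. X_design T' N' K' W L 1 n x $$ (r, l' * N' + b) * h (l' * N' + b)) =
          (if l' = l then \<Sum>b<N'. (\<Sum>k<K'. complex_of_real (x (K' * m + k)) * W k $$ (t, b)) * h (l * N' + b) else 0)"
      proof cases
        case 1
        then show ?thesis using l(3) by auto
      next
        case 2
        then show ?thesis using entry mn by simp
      next
        case 3
        have "X_design T' N' K' W L 1 n x $$ (r, l' * N' + b) = 0" if "b < N'" for b
        proof (cases "l' \<le> m + l")
          case True
          then have "m + l - l' < m" using 3 by auto
          then have "x (K' * (m + l - l') + k) = 0" if "k < K'" for k using m(3) that by blast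
          then show ?thesis using entry[OF that] by simp
        next
          case False
          then show ?thesis using entry[OF that] by simp
        qed
        then show ?thesis using 3 by simp
      qed
    qed
    also have "\<dots> = (\<Sum>b<N'. \<Sum>k<K'. complex_of_real (x (K' * m + k)) * h (l * N' + b) * W k $$ (t, b))"
      using lL by (simp add: sum_distrib_left sum_distrib_right mult_ac)
    also have "\<dots> = (\<Sum>k<K'. \<Sum>b<N'. complex_of_real (x (K' * m + k)) * h (l * N' + b) * W k $$ (t, b))"
      by (rule sum.swap)
    finally show ?thesis by simp
  qed
  then have "(\<forall>k<K'. x (K' * m + k) = 0) \<or> (\<forall>b<N'. h (l * N' + b) = 0)"
    by (rule cod_injective[OF W])
  then show False using m(1) l(1) by auto
qed

section \<open>Second moments of complex Gaussian variables\<close>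

definition re_im :: "bool \<Rightarrow> complex \<Rightarrow> real" where
  "re_im b z = (if b then Im z else Re z)"

definition re_im_unit :: "'s \<Rightarrow> bool \<Rightarrow> 's \<Rightarrow> complex" where
  "re_im_unit s b = (\<lambda>s'. if s' = s then if b then \<i> else 1 else 0)"

text \<open>Relays that conjugate make the noise only real-linear in its entries. The expansion
  therefore runs over the real basis with 1 or i in one coordinate.\<close>

lemma real_linear_re_im_expansion:
  fixes \<phi> :: "('s \<Rightarrow> complex) \<Rightarrow> real"
  assumes J: "finite J"
    and add: "\<And>x y. \<phi> (\<lambda>s. x s + y s) = \<phi> x + \<phi> y"
    and scale: "\<And>r x. \<phi> (\<lambda>s. complex_of_real r * x s) = r * \<phi> x"
    and local: "\<And>x y. (\<And>s. s \<in> J \<Longrightarrow> x s = y s) \<Longrightarrow> \<phi> x = \<phi> y"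
  shows "\<phi> x = (\<Sum>(s, b)\<in>J \<times> UNIV. re_im b (x s) * \<phi> (re_im_unit s b))"
proof -
  have "\<phi> (\<lambda>s. if s \<in> I then x s else 0) = (\<Sum>(s, b)\<in>I \<times> UNIV. re_im b (x s) * \<phi> (re_im_unit s b))"
    if "finite I" for I
    using that
  proof (induction I rule: finite_induct)
    case empty
    then show ?case using scale[of 0 "\<lambda>_. 0"] by simp
  next
    case (insert t I)
    have "(\<lambda>s. if s \<in> insert t I then x s else 0) = (\<lambda>s. (if s \<in> I then x s else 0) +
        (complex_of_real (re_im False (x t)) * re_im_unit t False s +
         complex_of_real (re_im True (x t)) * re_im_unit t True s))"
      using insert by (auto simp: fun_eq_iff re_im_def re_im_unit_def complex_eq_iff)
    then have "\<phi> (\<lambda>s. if s \<in> insert t I then x s else 0) = \<phi> (\<lambda>s. if s \<in> I then x s else 0) +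
        (re_im False (x t) * \<phi> (re_im_unit t False) + re_im True (x t) * \<phi> (re_im_unit t True))"
      by (simp only: add scale)
    also have "\<dots> = (\<Sum>(s, b)\<in>insert t I \<times> UNIV. re_im b (x s) * \<phi> (re_im_unit s b))"
      using insert by (simp add: sum.cartesian_product[symmetric] UNIV_bool)
    finally show ?case .
  qed
  from this[OF J] show ?thesis using local[of x "\<lambda>s. if s \<in> J then x s else 0"] by simp
qed

lemma (in prob_space) covariance_linear_combination:
  fixes \<xi> :: "'i \<Rightarrow> 'a \<Rightarrow> real"
  assumes I: "finite I"
    and int: "\<And>i. i \<in> I \<Longrightarrow> integrable M (\<xi> i)"
    and mean: "\<And>i. i \<in> I \<Longrightarrow> expectation (\<xi> i) = 0"
    and int2: "\<And>i j. i \<in> I \<Longrightarrow> j \<in> I \<Longrightarrow> integrable M (\<lambda>\<omega>. \<xi> i \<omega> * \<xi> j \<omega>)"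
    and cov: "\<And>i j. i \<in> I \<Longrightarrow> j \<in> I \<Longrightarrow> expectation (\<lambda>\<omega>. \<xi> i \<omega> * \<xi> j \<omega>) = (if i = j then 1 / 2 else 0)"
  shows "covariance M (\<lambda>\<omega>. \<Sum>i\<in>I. \<xi> i \<omega> * a i) (\<lambda>\<omega>. \<Sum>i\<in>I. \<xi> i \<omega> * b i) = (\<Sum>i\<in>I. a i * b i) / 2"
proof -
  have zero: "expectation (\<lambda>\<omega>. \<Sum>i\<in>I. \<xi> i \<omega> * a i) = 0" for a :: "'i \<Rightarrow> real"
    using int mean by (subst Bochner_Integration.integral_sum) auto
  have "covariance M (\<lambda>\<omega>. \<Sum>i\<in>I. \<xi> i \<omega> * a i) (\<lambda>\<omega>. \<Sum>i\<in>I. \<xi> i \<omega> * b i) =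
      expectation (\<lambda>\<omega>. \<Sum>i\<in>I. \<Sum>j\<in>I. (\<xi> i \<omega> * \<xi> j \<omega>) * (a i * b j))"
    unfolding covariance_def zero by (simp add: sum_product mult_ac)
  also have "\<dots> = (\<Sum>i\<in>I. \<Sum>j\<in>I. expectation (\<lambda>\<omega>. \<xi> i \<omega> * \<xi> j \<omega>) * (a i * b j))"
    using int2 by (subst Bochner_Integration.integral_sum; simp)
  also have "\<dots> = (\<Sum>i\<in>I. \<Sum>j\<in>I. if i = j then 1 / 2 * (a i * b j) else 0)"
    by (intro sum.cong refl) (auto simp: cov)
  also have "\<dots> = (\<Sum>i\<in>I. a i * b i) / 2"
    using I by (simp add: sum_divide_distrib)
  finally show ?thesis .
qed

lemma std_complex_normal_re_im:
  assumes "std_complex_normal M X"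
  shows "distributed M lborel (\<lambda>\<omega>. re_im b (X \<omega>)) (normal_density 0 (sqrt (1 / 2)))"
  using assms by (cases b) (auto simp: std_complex_normal_def re_im_def)

lemma (in prob_space) normal_half_moments:
  assumes D: "distributed M lborel X (normal_density 0 (sqrt (1 / 2)))"
  shows "integrable M X" "expectation X = 0"
    "integrable M (\<lambda>\<omega>. X \<omega> * X \<omega>)" "expectation (\<lambda>\<omega>. X \<omega> * X \<omega>) = 1 / 2"
proof -
  have pos: "0 < sqrt (1 / 2 :: real)" by simp
  show "integrable M X"
    using distributed_integrable[OF D, of "\<lambda>x. x"] integrable_normal_moment[OF pos, of 0 1] by simp
  show E: "expectation X = 0" by (rule normal_distributed_expectation[OF pos D])
  show "integrable M (\<lambda>\<omega>. X \<omega> * X \<omega>)"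
    using distributed_integrable[OF D, of "\<lambda>x. x * x"] integrable_normal_moment[OF pos, of 0 2]
    by (simp add: power2_eq_square)
  show "expectation (\<lambda>\<omega>. X \<omega> * X \<omega>) = 1 / 2"
    using normal_distributed_variance[OF pos D] E by (simp add: power2_eq_square)
qed

lemma (in prob_space) indep_vars_imp_indep_var:
  assumes "indep_vars M' X I" "i \<in> I" "j \<in> I" "i \<noteq> j"
  shows "indep_var (M' i) (X i) (M' j) (X j)"
proof -
  have "indep_var (PiM {i} M') (\<lambda>\<omega>. restrict (\<lambda>k. X k \<omega>) {i}) (PiM {j} M') (\<lambda>\<omega>. restrict (\<lambda>k. X k \<omega>) {j})"
    using assms by (intro indep_var_restrict) auto
  then have "indep_var (M' i) ((\<lambda>x. x i) \<circ> (\<lambda>\<omega>. restrict (\<lambda>k. X k \<omega>) {i})) (M' j) ((\<lambda>x. x j) \<circ> (\<lambda>\<omega>. restrict (\<lambda>k. X k \<omega>) {j}))"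
    by (rule indep_var_compose) auto
  then show ?thesis by (simp add: comp_def)
qed

text \<open>Vanishing of the mixed moments has two sources: independence of real and imaginary part
  within one variable, and independence of different variables.\<close>

lemma (in prob_space) re_im_second_moments:
  assumes indep: "indep_vars (\<lambda>_. borel) Z I" and normal: "\<And>s. s \<in> I \<Longrightarrow> std_complex_normal M (Z s)"
    and st: "s \<in> I" "t \<in> I"
  shows "integrable M (\<lambda>\<omega>. re_im b (Z s \<omega>) * re_im b' (Z t \<omega>))" (is ?int)
    "expectation (\<lambda>\<omega>. re_im b (Z s \<omega>) * re_im b' (Z t \<omega>)) = (if (s, b) = (t, b') then 1 / 2 else 0)" (is ?eq)
proof -
  note mom = normal_half_moments[OF std_complex_normal_re_im[OF normal]]
  have "?int \<and> ?eq"
  proof (cases "(s, b) = (t, b')")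
    case True
    then show ?thesis using mom(3,4)[OF st(1), of b] by simp
  next
    case False
    show ?thesis
    proof (cases "s = t")
      case True
      have RI: "indep_var borel (\<lambda>\<omega>. re_im False (Z s \<omega>)) borel (\<lambda>\<omega>. re_im True (Z s \<omega>))"
        using normal[OF st(1)] by (simp add: std_complex_normal_def re_im_def)
      from indep_var_lebesgue_integral[OF this mom(1,1)] indep_var_integrable[OF this mom(1,1)]
      show ?thesis using st False True mom(2) by (cases b; cases b') (auto simp: mult.commute)
    next
      case st': False
      have "indep_var borel (re_im b \<circ> Z s) borel (re_im b' \<circ> Z t)"
        by (rule indep_var_compose[OF indep_vars_imp_indep_var[OF indep st st']])
           (auto simp: re_im_def[abs_def])
      then have "indep_var borel (\<lambda>\<omega>. re_im b (Z s \<omega>)) borel (\<lambda>\<omega>. re_im b' (Z t \<omega>))"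
        by (simp add: comp_def)
      from indep_var_lebesgue_integral[OF this mom(1,1)] indep_var_integrable[OF this mom(1,1)]
      show ?thesis using st False mom(2) by auto
    qed
  qed
  then show ?int ?eq by auto
qed

section \<open>The noise vector and its covariance\<close>

lemma dim_vec_tilde [simp]: "dim_vec (vec_tilde A) = 2 * (dim_row A * dim_col A)"
  by (simp add: vec_tilde_def vec_cols_def)

lemma vec_tilde_carrier:
  "A \<in> carrier_mat T D \<Longrightarrow> vec_tilde A \<in> carrier_vec (2 * (T * D))"
  by (rule carrier_vecI) simp

lemma mod_div_bounds: "q < T * D \<Longrightarrow> q mod T < T \<and> q div T < (D :: nat)"
  by (metis div_less_iff_less_mult mod_less_divisor mult.commute mult_0 neq0_conv not_less0)

lemma vec_tilde_index:
  assumes "A \<in> carrier_mat T D" "p < 2 * (T * D)"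
  shows "(vec_tilde A) $ p = (if p < T * D then Re (A $$ (p mod T, p div T))
    else Im (A $$ ((p - T * D) mod T, (p - T * D) div T)))"
proof -
  have "p - T * D < T * D" using assms by simp
  then show ?thesis using assms mod_div_bounds[of p T D] mod_div_bounds[of "p - T * D" T D]
    by (auto simp: vec_tilde_def vec_cols_def)
qed

lemma sum_mod_div:
  fixes f :: "nat \<Rightarrow> nat \<Rightarrow> 'a::comm_monoid_add"
  shows "(\<Sum>p<T * D. f (p mod T) (p div T)) = (\<Sum>l<D. \<Sum>t<T. f t l)"
proof -
  have "(\<Sum>p<D * T. f (p mod T) (p div T)) = (\<Sum>l<D. \<Sum>t<T. f ((l * T + t) mod T) ((l * T + t) div T))"
    by (rule sum_blocks)
  also have "\<dots> = (\<Sum>l<D. \<Sum>t<T. f t l)" by (intro sum.cong refl) auto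
  finally show ?thesis by (simp add: mult.commute)
qed

lemma sum_two_blocks:
  fixes f :: "nat \<Rightarrow> 'a::comm_monoid_add"
  shows "(\<Sum>p<2 * m. f p) = (\<Sum>p<m. f p) + (\<Sum>p<m. f (m + p))"
  using sum_blocks[of f 2 m] by (simp add: numeral_2_eq_2)

lemma vec_tilde_norm:
  assumes A: "A \<in> carrier_mat T D"
  shows "vec_tilde A \<bullet> vec_tilde A = (\<Sum>l<D. \<Sum>t<T. (cmod (A $$ (t, l)))\<^sup>2)"
proof -
  have "vec_tilde A \<bullet> vec_tilde A = (\<Sum>p<2 * (T * D). ((vec_tilde A) $ p)\<^sup>2)"
    using A by (simp add: scalar_prod_def power2_eq_square atLeast0LessThan)
  also have "\<dots> = (\<Sum>p<T * D. (Re (A $$ (p mod T, p div T)))\<^sup>2) + (\<Sum>p<T * D. (Im (A $$ (p mod T, p div T)))\<^sup>2)"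
  proof -
    have "(vec_tilde A) $ p = Re (A $$ (p mod T, p div T))" if "p < T * D" for p
    proof -
      have "p < 2 * (T * D)" using that by linarith
      from vec_tilde_index[OF A this] that show ?thesis by simp
    qed
    moreover have "(vec_tilde A) $ (T * D + p) = Im (A $$ (p mod T, p div T))" if "p < T * D" for p
    proof -
      have "T * D + p < 2 * (T * D)" using that by linarith
      from vec_tilde_index[OF A this] that show ?thesis by simp
    qed
    ultimately show ?thesis unfolding sum_two_blocks by simp
  qed
  also have "\<dots> = (\<Sum>p<T * D. (cmod (A $$ (p mod T, p div T)))\<^sup>2)"
    by (simp add: cmod_power2 sum.distrib)
  finally show ?thesis using sum_mod_div[of "\<lambda>t l. (cmod (A $$ (t, l)))\<^sup>2" T D] by simp
qed

lemma vec_tilde_add: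
  assumes "A \<in> carrier_mat T D" "B \<in> carrier_mat T D"
  shows "vec_tilde (A + B) = vec_tilde A + vec_tilde B"
proof (rule eq_vecI)
  have AB: "A + B \<in> carrier_mat T D" using assms by simp
  have d: "dim_vec (vec_tilde A) = 2 * (T * D)" "dim_vec (vec_tilde B) = 2 * (T * D)"
    using assms by auto
  fix p assume "p < dim_vec (vec_tilde A + vec_tilde B)"
  then have p: "p < 2 * (T * D)" using d by simp
  then have pd: "p - T * D < T * D \<or> p < T * D" by auto
  have e: "(vec_tilde A + vec_tilde B) $ p = (vec_tilde A) $ p + (vec_tilde B) $ p"
    using p d by (intro index_add_vec) simp
  show "(vec_tilde (A + B)) $ p = (vec_tilde A + vec_tilde B) $ p"
    unfolding e vec_tilde_index[OF AB p] vec_tilde_index[OF assms(1) p] vec_tilde_index[OF assms(2) p]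
    using pd assms mod_div_bounds[of p T D] mod_div_bounds[of "p - T * D" T D] by auto
qed (use assms in simp)

lemma vec_tilde_smult:
  assumes "A \<in> carrier_mat T D"
  shows "vec_tilde (complex_of_real r \<cdot>\<^sub>m A) = r \<cdot>\<^sub>v vec_tilde A"
proof (rule eq_vecI)
  have AB: "complex_of_real r \<cdot>\<^sub>m A \<in> carrier_mat T D" using assms by simp
  have d: "dim_vec (vec_tilde A) = 2 * (T * D)"
    using assms by auto
  fix p assume "p < dim_vec (r \<cdot>\<^sub>v vec_tilde A)"
  then have p: "p < 2 * (T * D)" using d by simp
  then have pd: "p - T * D < T * D \<or> p < T * D" by auto
  have e: "(r \<cdot>\<^sub>v vec_tilde A) $ p = r * (vec_tilde A) $ p"
    using p d by (intro index_smult_vec) simp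
  show "(vec_tilde (complex_of_real r \<cdot>\<^sub>m A)) $ p = (r \<cdot>\<^sub>v vec_tilde A) $ p"
    unfolding e vec_tilde_index[OF AB p] vec_tilde_index[OF assms(1) p]
    using pd assms mod_div_bounds[of p T D] mod_div_bounds[of "p - T * D" T D] by auto
qed (use assms in simp)

section \<open>The noise as a real-linear map of its entries\<close>

definition noise_index :: "dstbc \<Rightarrow> rv_index set" where
  "noise_index c = (\<lambda>(j, t). Noise_v j t) ` ({..<relays c} \<times> {..<len1 c}) \<union>
     (\<lambda>(l, t). Noise_w l t) ` ({..<ants c} \<times> {..<len2 c})"

text \<open>Takes an arbitrary realization \<open>\<zeta>\<close> in place of the random variables,
  so that the covariance can be studied through a deterministic linear map.\<close>

definition noise_vec :: "dstbc \<Rightarrow> real \<Rightarrow> (nat \<Rightarrow> nat \<Rightarrow> complex) \<Rightarrow> (rv_index \<Rightarrow> complex) \<Rightarrow> real vec" where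
  "noise_vec c P g \<zeta> = vec_tilde (noise_mat c P g (\<lambda>j t. \<zeta> (Noise_v j t)) (\<lambda>l t. \<zeta> (Noise_w l t)))"

definition gain_energy :: "dstbc \<Rightarrow> (nat \<Rightarrow> nat \<Rightarrow> complex) \<Rightarrow> real" where
  "gain_energy c g = (\<Sum>j<relays c. \<Sum>l<ants c. (cmod (g j l))\<^sup>2)"

definition noise_energy :: "dstbc \<Rightarrow> (rv_index \<Rightarrow> complex) \<Rightarrow> real" where
  "noise_energy c \<zeta> = (\<Sum>s\<in>noise_index c. (cmod (\<zeta> s))\<^sup>2)"

lemma finite_noise_index [simp]: "finite (noise_index c)"
  by (simp add: noise_index_def)

lemma gain_energy_nonneg: "0 \<le> gain_energy c g"
  by (auto simp: gain_energy_def intro!: sum_nonneg)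

lemma noise_energy_nonneg: "0 \<le> noise_energy c \<zeta>"
  by (auto simp: noise_energy_def intro!: sum_nonneg)

lemma noise_energy_eq:
  "noise_energy c \<zeta> = (\<Sum>j<relays c. \<Sum>t<len1 c. (cmod (\<zeta> (Noise_v j t)))\<^sup>2) +
    (\<Sum>l<ants c. \<Sum>t<len2 c. (cmod (\<zeta> (Noise_w l t)))\<^sup>2)"
proof -
  let ?h = "\<lambda>s. (cmod (\<zeta> s))\<^sup>2"
  let ?V = "(\<lambda>(j, t). Noise_v j t) ` ({..<relays c} \<times> {..<len1 c})"
  let ?W = "(\<lambda>(l, t). Noise_w l t) ` ({..<ants c} \<times> {..<len2 c})"
  have "sum ?h ?V = (\<Sum>j<relays c. \<Sum>t<len1 c. ?h (Noise_v j t))"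
    by (subst sum.reindex) (auto simp: inj_on_def sum.cartesian_product comp_def intro!: sum.cong)
  moreover have "sum ?h ?W = (\<Sum>l<ants c. \<Sum>t<len2 c. ?h (Noise_w l t))"
    by (subst sum.reindex) (auto simp: inj_on_def sum.cartesian_product comp_def intro!: sum.cong)
  moreover have "sum ?h (?V \<union> ?W) = sum ?h ?V + sum ?h ?W"
    by (rule sum.union_disjoint) auto
  ultimately show ?thesis unfolding noise_energy_def noise_index_def by (simp only:)
qed

lemma noise_mat_carrier [simp]: "noise_mat c P g v w \<in> carrier_mat (len2 c) (ants c)"
  by (simp add: noise_mat_def)

lemma dim_noise_mat [simp]:
  "dim_row (noise_mat c P g v w) = len2 c" "dim_col (noise_mat c P g v w) = ants c"
  by (simp_all add: noise_mat_def)

lemma noise_vec_carrier [simp]: "noise_vec c P g \<zeta> \<in> carrier_vec (2 * (len2 c * ants c))"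
  unfolding noise_vec_def by (rule vec_tilde_carrier) simp

lemma conj_op_linear:
  "conj_op c j (x + y) = conj_op c j x + conj_op c j y"
  "conj_op c j (x * y) = conj_op c j x * conj_op c j y"
  "conj_op c j (complex_of_real r) = complex_of_real r"
  "conj_op c j (\<Sum>i\<in>I. h i) = (\<Sum>i\<in>I. conj_op c j (h i))"
  "cmod (conj_op c j x) = cmod x"
  by (auto simp: conj_op_def)

lemma conj_op_0 [simp]: "conj_op c j 0 = 0"
  by (auto simp: conj_op_def)

lemma noise_mat_index:
  assumes c: "valid_dstbc c" and tl: "t < len2 c" "l < ants c"
  shows "noise_mat c P g v w $$ (t, l) =
    (\<Sum>j<relays c. complex_of_real (relay_gain c P) * g j l *
       conj_op c j (\<Sum>s<len1 c. relay_mat c j $$ (t, s) * v j s)) + w l t"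
proof -
  have B: "relay_mat c j \<in> carrier_mat (len2 c) (len1 c)" if "j < relays c" for j
    using c that by (auto simp: valid_dstbc_def)
  have "(map_vec (conj_op c j) (relay_mat c j *\<^sub>v vec (len1 c) (v j))) $ t =
      conj_op c j (\<Sum>s<len1 c. relay_mat c j $$ (t, s) * v j s)" if "j < relays c" for j
    using B[OF that] tl by (simp add: scalar_prod_def atLeast0LessThan)
  then show ?thesis using tl by (simp add: noise_mat_def)
qed

lemma noise_vec_add:
  assumes c: "valid_dstbc c"
  shows "noise_vec c P g (\<lambda>s. x s + y s) = noise_vec c P g x + noise_vec c P g y"
proof -
  have "noise_mat c P g (\<lambda>j t. x (Noise_v j t) + y (Noise_v j t)) (\<lambda>l t. x (Noise_w l t) + y (Noise_w l t)) =
      noise_mat c P g (\<lambda>j t. x (Noise_v j t)) (\<lambda>l t. x (Noise_w l t)) +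
      noise_mat c P g (\<lambda>j t. y (Noise_v j t)) (\<lambda>l t. y (Noise_w l t))" (is "?A = ?B + ?C")
  proof (rule eq_matI)
    fix t l assume "t < dim_row (?B + ?C)" "l < dim_col (?B + ?C)"
    then have tl: "t < len2 c" "l < ants c" by (auto simp: noise_mat_def)
    have d: "dim_row ?C = len2 c" "dim_col ?C = ants c" by (auto simp: noise_mat_def)
    have "(?B + ?C) $$ (t, l) = ?B $$ (t, l) + ?C $$ (t, l)" using tl d by simp
    then show "?A $$ (t, l) = (?B + ?C) $$ (t, l)"
      using tl by (simp add: noise_mat_index[OF c] conj_op_linear sum.distrib algebra_simps)
  qed (auto simp: noise_mat_def)
  then show ?thesis unfolding noise_vec_def
    using vec_tilde_add[OF noise_mat_carrier noise_mat_carrier] by metis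
qed

lemma noise_vec_smult:
  assumes c: "valid_dstbc c"
  shows "noise_vec c P g (\<lambda>s. complex_of_real r * x s) = r \<cdot>\<^sub>v noise_vec c P g x"
proof -
  have "noise_mat c P g (\<lambda>j t. complex_of_real r * x (Noise_v j t)) (\<lambda>l t. complex_of_real r * x (Noise_w l t)) =
      complex_of_real r \<cdot>\<^sub>m noise_mat c P g (\<lambda>j t. x (Noise_v j t)) (\<lambda>l t. x (Noise_w l t))" (is "?A = _ \<cdot>\<^sub>m ?B")
  proof (rule eq_matI)
    fix t l assume "t < dim_row (complex_of_real r \<cdot>\<^sub>m ?B)" "l < dim_col (complex_of_real r \<cdot>\<^sub>m ?B)"
    then have tl: "t < len2 c" "l < ants c" by (auto simp: noise_mat_def)
    have d: "dim_row ?B = len2 c" "dim_col ?B = ants c" by (auto simp: noise_mat_def)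
    have "(complex_of_real r \<cdot>\<^sub>m ?B) $$ (t, l) = complex_of_real r * ?B $$ (t, l)" using tl d by simp
    then show "?A $$ (t, l) = (complex_of_real r \<cdot>\<^sub>m ?B) $$ (t, l)"
      using tl by (simp add: noise_mat_index[OF c] conj_op_linear sum_distrib_left algebra_simps)
  qed (auto simp: noise_mat_def)
  then show ?thesis unfolding noise_vec_def
    using vec_tilde_smult[OF noise_mat_carrier] by metis
qed

lemma noise_vec_local:
  assumes c: "valid_dstbc c" and eq: "\<And>s. s \<in> noise_index c \<Longrightarrow> x s = y s"
  shows "noise_vec c P g x = noise_vec c P g y"
proof -
  have v: "x (Noise_v j t) = y (Noise_v j t)" if "j < relays c" "t < len1 c" for j t
    by (rule eq) (use that in \<open>auto simp: noise_index_def\<close>)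
  have w: "x (Noise_w l t) = y (Noise_w l t)" if "l < ants c" "t < len2 c" for l t
    by (rule eq) (use that in \<open>auto simp: noise_index_def\<close>)
  have "noise_mat c P g (\<lambda>j t. x (Noise_v j t)) (\<lambda>l t. x (Noise_w l t)) =
      noise_mat c P g (\<lambda>j t. y (Noise_v j t)) (\<lambda>l t. y (Noise_w l t))"
    by (rule eq_matI) (simp_all add: noise_mat_index[OF c] v w)
  then show ?thesis by (simp add: noise_vec_def)
qed

text \<open>With the relay noise set to 0, only the destination noise is left, and it is stacked
  isometrically.\<close>

lemma noise_vec_surjective:
  assumes c: "valid_dstbc c" and a: "a \<in> carrier_vec (2 * (len2 c * ants c))"
  obtains \<zeta> where "noise_vec c P g \<zeta> = a" "noise_energy c \<zeta> = a \<bullet> a"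
proof -
  let ?m = "len2 c * ants c"
  define A where "A = mat (len2 c) (ants c) (\<lambda>(t, l). Complex (a $ (l * len2 c + t)) (a $ (?m + (l * len2 c + t))))"
  have A: "A \<in> carrier_mat (len2 c) (ants c)" by (simp add: A_def)
  define \<zeta> where "\<zeta> s = (case s of Noise_w l t \<Rightarrow> A $$ (t, l) | _ \<Rightarrow> 0)" for s
  have tA: "vec_tilde A = a"
  proof (rule eq_vecI)
    fix p assume "p < dim_vec a"
    then have p: "p < 2 * ?m" using a by simp
    then have "p - ?m < ?m \<or> p < ?m" by auto
    then show "(vec_tilde A) $ p = a $ p"
      unfolding vec_tilde_index[OF A p] using mod_div_bounds[of p "len2 c" "ants c"] mod_div_bounds[of "p - ?m" "len2 c" "ants c"] by (auto simp: A_def)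
  qed (use A a in simp)
  have "noise_mat c P g (\<lambda>j t. \<zeta> (Noise_v j t)) (\<lambda>l t. \<zeta> (Noise_w l t)) = A"
    by (rule eq_matI) (use A in \<open>simp_all add: noise_mat_index[OF c] \<zeta>_def\<close>)
  then have "noise_vec c P g \<zeta> = a" using tA by (simp add: noise_vec_def)
  moreover have "noise_energy c \<zeta> = a \<bullet> a"
    using vec_tilde_norm[OF A] unfolding tA noise_energy_eq by (simp add: \<zeta>_def)
  ultimately show thesis using that by blast
qed

lemma divide_affine_le:
  fixes a b P :: real
  assumes "a > 0" "b > 0" "P \<ge> 0"
  shows "b * P / (a * P + 1) \<le> b / a"
proof -
  have "a * P + 1 > 0" using assms by (simp add: add_nonneg_pos)
  moreover have "b * P * a \<le> b * (a * P + 1)" using assms by (simp add: algebra_simps)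
  ultimately show ?thesis using assms(1) by (simp add: frac_le_eq pos_divide_le_eq pos_le_divide_eq)
qed

text \<open>The amplification at the relays saturates as the power grows. This is why the noise
  constants below can be chosen uniformly in \<open>P\<close>.\<close>

lemma relay_gain_sq:
  assumes "valid_dstbc c" "P \<ge> 0"
  shows "(relay_gain c P)\<^sup>2 \<le> pow2 c / pow1 c"
proof -
  have pos: "pow1 c > 0" "pow2 c > 0" using assms by (auto simp: valid_dstbc_def)
  then have "0 \<le> pow2 c * P / (pow1 c * P + 1)" using assms(2) by simp
  then have "(relay_gain c P)\<^sup>2 = pow2 c * P / (pow1 c * P + 1)"
    unfolding relay_gain_def by (rule real_sqrt_pow2)
  then show ?thesis using divide_affine_le[OF pos assms(2)] by (rule ord_eq_le_trans)
qed

text \<open>Cauchy-Schwarz over relays and time slots bounds each entry of the forwarded noise. The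
  constant has to be independent of power, gains and noise, so the gains appear explicitly.\<close>

lemma noise_vec_norm_bound:
  assumes c: "valid_dstbc c"
  obtains C where "C > 0"
    "\<And>P g \<zeta>. P \<ge> 0 \<Longrightarrow> noise_vec c P g \<zeta> \<bullet> noise_vec c P g \<zeta> \<le> C * (1 + gain_energy c g) * noise_energy c \<zeta>"
proof -
  \<comment> \<open>The sum of the squared Frobenius norms of all relay matrices; it dominates every
    row norm that occurs below.\<close>
  define b where "b = (\<Sum>j<relays c. \<Sum>t<len2 c. \<Sum>s<len1 c. (cmod (relay_mat c j $$ (t, s)))\<^sup>2)"
  define r where "r = pow2 c / pow1 c"
  have r: "r \<ge> 0" using c by (simp add: r_def valid_dstbc_def)
  have b: "b \<ge> 0" by (auto simp: b_def intro!: sum_nonneg)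
  \<comment> \<open>The summands r b and 1 account for relay and destination noise; the 2 comes from
    |z + w|^2 \<le> 2 |z|^2 + 2 |w|^2.\<close>
  define C where "C = 2 * (r * b + 1)"
  have "(cmod (noise_mat c P g (\<lambda>j t. \<zeta> (Noise_v j t)) (\<lambda>l t. \<zeta> (Noise_w l t)) $$ (t, l)))\<^sup>2
      \<le> C * (1 + gain_energy c g) * noise_energy c \<zeta>"
    if P: "P \<ge> 0" and tl: "t < len2 c" "l < ants c" for P g \<zeta> t l
  proof -
    let ?\<rho> = "relay_gain c P" and ?S = "gain_energy c g" and ?V = "noise_energy c \<zeta>"
    let ?I = "{..<relays c} \<times> {..<len1 c}"
    define z where "z = (\<Sum>j<relays c. complex_of_real ?\<rho> * g j l *
       conj_op c j (\<Sum>s<len1 c. relay_mat c j $$ (t, s) * \<zeta> (Noise_v j s)))"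
    define x where "x = (\<lambda>(j, s). \<bar>?\<rho>\<bar> * cmod (g j l) * cmod (relay_mat c j $$ (t, s)))"
    define y where "y = (\<lambda>(j, s). cmod (\<zeta> (Noise_v j s)))"
    have "z = (\<Sum>j<relays c. \<Sum>s<len1 c. complex_of_real ?\<rho> * g j l * conj_op c j (relay_mat c j $$ (t, s) * \<zeta> (Noise_v j s)))"
      by (simp add: z_def conj_op_linear sum_distrib_left)
    then have "cmod z \<le> (\<Sum>j<relays c. \<Sum>s<len1 c. x (j, s) * y (j, s))"
      by (auto simp: x_def y_def norm_mult conj_op_linear mult_ac intro!: sum_norm_le)
    also have "\<dots> = (\<Sum>i\<in>?I. x i * y i)" by (simp add: sum.cartesian_product split_def)
    finally have "(cmod z)\<^sup>2 \<le> (\<Sum>i\<in>?I. x i * y i)\<^sup>2" by (intro power_mono) auto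
    also have "\<dots> \<le> (\<Sum>i\<in>?I. (x i)\<^sup>2) * (\<Sum>i\<in>?I. (y i)\<^sup>2)" by (rule Cauchy_Schwarz_ineq_sum)
    also have "\<dots> \<le> (r * b * ?S) * (\<Sum>i\<in>?I. (y i)\<^sup>2)"
    proof (rule mult_right_mono)
      have "(\<Sum>i\<in>?I. (x i)\<^sup>2) = ?\<rho>\<^sup>2 * (\<Sum>j<relays c. (cmod (g j l))\<^sup>2 * (\<Sum>s<len1 c. (cmod (relay_mat c j $$ (t, s)))\<^sup>2))"
      proof -
        have "(\<Sum>i\<in>?I. (x i)\<^sup>2) = (\<Sum>j<relays c. \<Sum>s<len1 c. (x (j, s))\<^sup>2)"
          by (simp add: sum.cartesian_product split_def)
        then show ?thesis by (simp add: x_def sum_distrib_left power_mult_distrib mult_ac)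
      qed
      also have "\<dots> \<le> r * (\<Sum>j<relays c. (cmod (g j l))\<^sup>2 * b)"
      proof (rule mult_mono[OF _ _ r])
        show "?\<rho>\<^sup>2 \<le> r" unfolding r_def by (rule relay_gain_sq[OF c P])
        have "(\<Sum>s<len1 c. (cmod (relay_mat c j $$ (t, s)))\<^sup>2) \<le> b" if "j < relays c" for j
        proof -
          have "(\<Sum>s<len1 c. (cmod (relay_mat c j $$ (t, s)))\<^sup>2) \<le> (\<Sum>t<len2 c. \<Sum>s<len1 c. (cmod (relay_mat c j $$ (t, s)))\<^sup>2)"
            using tl by (intro member_le_sum[of t "{..<len2 c}" "\<lambda>t. \<Sum>s<len1 c. (cmod (relay_mat c j $$ (t, s)))\<^sup>2"]) (auto intro!: sum_nonneg)
          also have "\<dots> \<le> b"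
            unfolding b_def using that
            by (intro member_le_sum[of j "{..<relays c}" "\<lambda>j. \<Sum>t<len2 c. \<Sum>s<len1 c. (cmod (relay_mat c j $$ (t, s)))\<^sup>2"]) (auto intro!: sum_nonneg)
          finally show ?thesis .
        qed
        then show "(\<Sum>j<relays c. (cmod (g j l))\<^sup>2 * (\<Sum>s<len1 c. (cmod (relay_mat c j $$ (t, s)))\<^sup>2)) \<le> (\<Sum>j<relays c. (cmod (g j l))\<^sup>2 * b)"
          by (intro sum_mono mult_left_mono) auto
        show "0 \<le> (\<Sum>j<relays c. (cmod (g j l))\<^sup>2 * (\<Sum>s<len1 c. (cmod (relay_mat c j $$ (t, s)))\<^sup>2))"
          by (intro sum_nonneg mult_nonneg_nonneg) auto
      qed
      also have "\<dots> \<le> r * (?S * b)"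
      proof -
        have "(cmod (g j l))\<^sup>2 \<le> (\<Sum>l<ants c. (cmod (g j l))\<^sup>2)" for j
          using tl by (intro member_le_sum[of l "{..<ants c}" "\<lambda>l. (cmod (g j l))\<^sup>2"]) auto
        then show ?thesis
          unfolding gain_energy_def sum_distrib_right[symmetric] using b
          by (intro mult_left_mono[OF _ r] mult_right_mono sum_mono) auto
      qed
      finally show "(\<Sum>i\<in>?I. (x i)\<^sup>2) \<le> r * b * ?S" by (simp add: mult_ac)
    qed (auto intro!: sum_nonneg)
    also have "\<dots> \<le> (r * b * (1 + ?S)) * ?V"
    proof (rule mult_mono)
      show "(\<Sum>i\<in>?I. (y i)\<^sup>2) \<le> ?V"
        by (auto simp: noise_energy_eq y_def sum.cartesian_product split_def intro!: sum_nonneg)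
      show "r * b * ?S \<le> r * b * (1 + ?S)"
        using r b by (intro mult_left_mono) auto
      show "0 \<le> r * b * (1 + ?S)" "0 \<le> (\<Sum>i\<in>?I. (y i)\<^sup>2)"
        using r b gain_energy_nonneg[of c g] by (auto intro: sum_nonneg)
    qed
    finally have z: "(cmod z)\<^sup>2 \<le> (r * b * (1 + ?S)) * ?V" .
    have "(cmod (\<zeta> (Noise_w l t)))\<^sup>2 \<le> ?V"
      unfolding noise_energy_def using tl
      by (intro member_le_sum[of "Noise_w l t" "noise_index c" "\<lambda>s. (cmod (\<zeta> s))\<^sup>2"]) (auto simp: noise_index_def)
    also have "?V \<le> (1 + ?S) * ?V" using gain_energy_nonneg[of c g] noise_energy_nonneg[of c \<zeta>]
      by (simp add: algebra_simps)
    finally have w: "(cmod (\<zeta> (Noise_w l t)))\<^sup>2 \<le> (1 + ?S) * ?V" .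
    have "(cmod (z + \<zeta> (Noise_w l t)))\<^sup>2 \<le> (cmod z + cmod (\<zeta> (Noise_w l t)))\<^sup>2"
      by (intro power_mono norm_triangle_ineq) auto
    also have "\<dots> \<le> 2 * (cmod z)\<^sup>2 + 2 * (cmod (\<zeta> (Noise_w l t)))\<^sup>2"
      using sum_squares_bound[of "cmod z" "cmod (\<zeta> (Noise_w l t))"] by (simp add: power2_sum)
    also have "\<dots> \<le> C * (1 + ?S) * ?V" using z w by (simp add: C_def algebra_simps)
    finally show ?thesis by (simp add: noise_mat_index[OF c tl] z_def)
  qed
  note entry = this
  define m where "m = real (len2 c * ants c)"
  have "noise_vec c P g \<zeta> \<bullet> noise_vec c P g \<zeta> \<le> ((m + 1) * C) * (1 + gain_energy c g) * noise_energy c \<zeta>"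
    if P: "P \<ge> 0" for P g \<zeta>
  proof -
    have "noise_vec c P g \<zeta> \<bullet> noise_vec c P g \<zeta> \<le> (\<Sum>l<ants c. \<Sum>t<len2 c. C * (1 + gain_energy c g) * noise_energy c \<zeta>)"
      unfolding noise_vec_def vec_tilde_norm[OF noise_mat_carrier]
      by (intro sum_mono entry P) auto
    also have "\<dots> = m * (C * (1 + gain_energy c g) * noise_energy c \<zeta>)" by (simp add: m_def)
    also have "\<dots> \<le> (m + 1) * (C * (1 + gain_energy c g) * noise_energy c \<zeta>)"
      using r b gain_energy_nonneg[of c g] noise_energy_nonneg[of c \<zeta>]
      by (intro mult_right_mono mult_nonneg_nonneg) (auto simp: C_def)
    finally show ?thesis by (simp add: mult_ac)
  qed
  moreover have "(m + 1) * C > 0" using r b by (auto simp: C_def m_def intro!: mult_pos_pos add_nonneg_pos)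
  ultimately show thesis using that by blast
qed

lemma noise_vec_functional_expansion:
  assumes c: "valid_dstbc c" and a: "a \<in> carrier_vec (2 * (len2 c * ants c))"
  shows "a \<bullet> noise_vec c P g \<zeta> =
    (\<Sum>(s, b)\<in>noise_index c \<times> UNIV. re_im b (\<zeta> s) * (a \<bullet> noise_vec c P g (re_im_unit s b)))"
proof (rule real_linear_re_im_expansion)
  fix x y :: "rv_index \<Rightarrow> complex" and r :: real
  show "a \<bullet> noise_vec c P g (\<lambda>s. x s + y s) = a \<bullet> noise_vec c P g x + a \<bullet> noise_vec c P g y"
    unfolding noise_vec_add[OF c] using a by (intro scalar_prod_add_distrib) auto
  show "a \<bullet> noise_vec c P g (\<lambda>s. complex_of_real r * x s) = r * (a \<bullet> noise_vec c P g x)"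
    unfolding noise_vec_smult[OF c] using a by (intro scalar_prod_smult_distrib) auto
  assume "\<And>s. s \<in> noise_index c \<Longrightarrow> x s = y s"
  from noise_vec_local[OF c this] show "a \<bullet> noise_vec c P g x = a \<bullet> noise_vec c P g y" by simp
qed simp

lemma noise_energy_re_im:
  "noise_energy c \<zeta> = (\<Sum>(s, b)\<in>noise_index c \<times> UNIV. (re_im b (\<zeta> s))\<^sup>2)"
  unfolding noise_energy_def
  by (simp add: sum.cartesian_product[symmetric] UNIV_bool re_im_def cmod_power2 add.commute)

lemma noise_index_subset: "noise_index c \<subseteq> rv_indices c"
  by (auto simp: noise_index_def rv_indices_def)

section \<open>The noise covariance and bounds on its quadratic form\<close>

lemma noise_cov_carrier [simp]:
  "noise_cov M c Z P g \<in> carrier_mat (2 * (len2 c * ants c)) (2 * (len2 c * ants c))"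
  by (simp add: noise_cov_def Let_def)

text \<open>If T has the images of the real basis vectors as columns, the covariance is T T^T / 2:
  the underlying real coordinates are uncorrelated with variance 1/2. Consequently its quadratic
  form at \<open>a\<close> is |T^T a|^2 / 2.\<close>

lemma noise_cov_entry:
  assumes c: "valid_dstbc c" and net: "network_model M c Z info"
    and pq: "p < 2 * (len2 c * ants c)" "q < 2 * (len2 c * ants c)"
  shows "noise_cov M c Z P g $$ (p, q) = (\<Sum>(s, b)\<in>noise_index c \<times> UNIV.
     (noise_vec c P g (re_im_unit s b)) $ p * (noise_vec c P g (re_im_unit s b)) $ q) / 2"
proof -
  interpret prob_space M using net by (simp add: network_model_def)
  let ?d = "2 * (len2 c * ants c)" and ?I = "noise_index c \<times> (UNIV :: bool set)"
  define m where "m p = (\<lambda>(s, b). (noise_vec c P g (re_im_unit s b)) $ p)" for p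
  define \<xi> where "\<xi> = (\<lambda>(s, b) \<omega>. re_im b (Z s \<omega>))"
  have lin: "(noise_vec c P g (\<lambda>s. Z s \<omega>)) $ p = (\<Sum>i\<in>?I. \<xi> i \<omega> * m p i)" if "p < ?d" for p \<omega>
    using noise_vec_functional_expansion[OF c unit_vec_carrier, of p P g "\<lambda>s. Z s \<omega>"] that
    by (simp add: scalar_prod_left_unit[OF noise_vec_carrier] m_def \<xi>_def split_def)
  have indep: "indep_vars (\<lambda>_. borel) Z (noise_index c)"
    using net noise_index_subset by (auto simp: network_model_def intro: indep_vars_subset)
  have normal: "std_complex_normal M (Z s)" if "s \<in> noise_index c" for s
    using net noise_index_subset that by (auto simp: network_model_def)
  note mom1 = normal_half_moments[OF std_complex_normal_re_im[OF normal]]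
  note mom2 = re_im_second_moments[OF indep normal]
  have "noise_cov M c Z P g $$ (p, q) = covariance M (\<lambda>\<omega>. (noise_vec c P g (\<lambda>s. Z s \<omega>)) $ p)
      (\<lambda>\<omega>. (noise_vec c P g (\<lambda>s. Z s \<omega>)) $ q)"
    using pq by (simp add: noise_cov_def Let_def noise_vec_def)
  also have "\<dots> = covariance M (\<lambda>\<omega>. \<Sum>i\<in>?I. \<xi> i \<omega> * m p i) (\<lambda>\<omega>. \<Sum>i\<in>?I. \<xi> i \<omega> * m q i)"
    by (simp add: lin pq)
  also have "\<dots> = (\<Sum>i\<in>?I. m p i * m q i) / 2"
    using mom1 mom2
    by (intro covariance_linear_combination) (auto simp: \<xi>_def split: if_splits)
  finally show ?thesis by (simp add: m_def split_def)
qed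

lemma noise_cov_symmetric:
  assumes "valid_dstbc c" "network_model M c Z info"
  shows "transpose_mat (noise_cov M c Z P g) = noise_cov M c Z P g"
proof (rule eq_matI)
  let ?G = "noise_cov M c Z P g"
  have d: "dim_row ?G = 2 * (len2 c * ants c)" "dim_col ?G = 2 * (len2 c * ants c)"
    using noise_cov_carrier by blast+
  fix p q assume "p < dim_row ?G" "q < dim_col ?G"
  then show "transpose_mat ?G $$ (p, q) = ?G $$ (p, q)"
    using d by (simp add: noise_cov_entry[OF assms] mult.commute)
qed (simp_all add: noise_cov_def Let_def)

lemma noise_cov_form:
  assumes c: "valid_dstbc c" and net: "network_model M c Z info"
    and a: "a \<in> carrier_vec (2 * (len2 c * ants c))"
  shows "a \<bullet> (noise_cov M c Z P g *\<^sub>v a) =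
    (\<Sum>(s, b)\<in>noise_index c \<times> UNIV. (a \<bullet> noise_vec c P g (re_im_unit s b))\<^sup>2) / 2"
proof -
  let ?d = "2 * (len2 c * ants c)" and ?I = "noise_index c \<times> (UNIV :: bool set)"
  let ?G = "noise_cov M c Z P g"
  define m where "m = (\<lambda>p (s, b). (noise_vec c P g (re_im_unit s b)) $ p)"
  have entry: "?G $$ (p, q) = (\<Sum>i\<in>?I. m p i * m q i) / 2" if "p < ?d" "q < ?d" for p q
    using noise_cov_entry[OF c net that, of P g] by (simp add: m_def split_def)
  have d: "dim_vec a = ?d" "dim_row ?G = ?d" "dim_col ?G = ?d"
    using carrier_vecD[OF a] carrier_matD[OF noise_cov_carrier] by simp_all
  have "a \<bullet> (?G *\<^sub>v a) = (\<Sum>p<?d. \<Sum>q<?d. a $ p * (?G $$ (p, q) * a $ q))"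
    using d by (simp add: scalar_prod_def sum_distrib_left atLeast0LessThan)
  also have "\<dots> = (\<Sum>p<?d. \<Sum>q<?d. \<Sum>i\<in>?I. (a $ p * m p i) * (a $ q * m q i) / 2)"
    by (intro sum.cong refl) (simp add: entry sum_distrib_left sum_distrib_right sum_divide_distrib mult_ac)
  also have "\<dots> = (\<Sum>i\<in>?I. \<Sum>p<?d. \<Sum>q<?d. (a $ p * m p i) * (a $ q * m q i) / 2)"
    by (simp only: sum.swap[of _ ?I])
  also have "\<dots> = (\<Sum>i\<in>?I. (\<Sum>p<?d. a $ p * m p i)\<^sup>2) / 2"
    by (simp add: power2_eq_square sum_product sum_divide_distrib)
  also have "(\<Sum>i\<in>?I. (\<Sum>p<?d. a $ p * m p i)\<^sup>2) =
      (\<Sum>(s, b)\<in>?I. (a \<bullet> noise_vec c P g (re_im_unit s b))\<^sup>2)"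
    by (simp add: m_def split_def scalar_prod_def atLeast0LessThan carrier_vecD[OF noise_vec_carrier])
  finally show ?thesis .
qed

text \<open>Both bounds are duality: \<open>a \<bullet> u\<close> is paired with the noise realization whose
  \<open>u\<close> is \<open>a\<close>, respectively with the one whose components are the coefficients of \<open>a \<bullet> u\<close>.\<close>

lemma noise_cov_lower:
  assumes c: "valid_dstbc c" and net: "network_model M c Z info"
    and a: "a \<in> carrier_vec (2 * (len2 c * ants c))"
  shows "a \<bullet> a / 2 \<le> a \<bullet> (noise_cov M c Z P g *\<^sub>v a)"
proof -
  let ?I = "noise_index c \<times> (UNIV :: bool set)"
  obtain \<zeta> where \<zeta>: "noise_vec c P g \<zeta> = a" "noise_energy c \<zeta> = a \<bullet> a"
    using noise_vec_surjective[OF c a] by blast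
  define k where "k = (\<lambda>(s, b). a \<bullet> noise_vec c P g (re_im_unit s b))"
  define x where "x = (\<lambda>(s, b). re_im b (\<zeta> s))"
  have form: "a \<bullet> (noise_cov M c Z P g *\<^sub>v a) = (\<Sum>i\<in>?I. (k i)\<^sup>2) / 2"
    unfolding noise_cov_form[OF c net a] by (simp add: k_def split_def)
  have "(a \<bullet> a)\<^sup>2 = (\<Sum>i\<in>?I. x i * k i)\<^sup>2"
    using noise_vec_functional_expansion[OF c a, of P g \<zeta>] by (simp add: \<zeta> x_def k_def split_def)
  also have "\<dots> \<le> (\<Sum>i\<in>?I. (x i)\<^sup>2) * (\<Sum>i\<in>?I. (k i)\<^sup>2)" by (rule Cauchy_Schwarz_ineq_sum)
  also have "(\<Sum>i\<in>?I. (x i)\<^sup>2) = a \<bullet> a"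
    using \<zeta>(2) unfolding noise_energy_re_im by (simp add: x_def split_def)
  finally have "(a \<bullet> a) * (a \<bullet> a) \<le> (a \<bullet> a) * (\<Sum>i\<in>?I. (k i)\<^sup>2)" by (simp add: power2_eq_square)
  then have "a \<bullet> a \<le> (\<Sum>i\<in>?I. (k i)\<^sup>2)"
    using scalar_prod_self_nonneg[of a] sum_nonneg[of ?I "\<lambda>i. (k i)\<^sup>2"]
    by (cases "a \<bullet> a = 0") (auto simp: mult_le_cancel_left)
  then show ?thesis by (simp add: form)
qed

lemma noise_cov_upper:
  assumes c: "valid_dstbc c" and net: "network_model M c Z info"
    and a: "a \<in> carrier_vec (2 * (len2 c * ants c))"
    and C: "\<And>\<zeta>. noise_vec c P g \<zeta> \<bullet> noise_vec c P g \<zeta> \<le> C * noise_energy c \<zeta>"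
  shows "a \<bullet> (noise_cov M c Z P g *\<^sub>v a) \<le> C * (a \<bullet> a)"
proof -
  let ?I = "noise_index c \<times> (UNIV :: bool set)"
  define k where "k = (\<lambda>(s, b). a \<bullet> noise_vec c P g (re_im_unit s b))"
  define \<zeta> where "\<zeta> s = Complex (k (s, False)) (k (s, True))" for s
  define S where "S = (\<Sum>i\<in>?I. (k i)\<^sup>2)"
  have k: "re_im b (\<zeta> s) = k (s, b)" for s b by (cases b) (auto simp: re_im_def \<zeta>_def)
  have form: "a \<bullet> (noise_cov M c Z P g *\<^sub>v a) = S / 2"
    unfolding noise_cov_form[OF c net a] by (simp add: k_def S_def split_def)
  let ?u = "noise_vec c P g \<zeta>"
  have E: "noise_energy c \<zeta> = S" unfolding noise_energy_re_im by (simp add: k S_def split_def)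
  have au: "a \<bullet> ?u = S"
    unfolding noise_vec_functional_expansion[OF c a, of P g \<zeta>] k
    by (simp add: S_def split_def power2_eq_square k_def)
  have S0: "S \<ge> 0" by (auto simp: S_def intro!: sum_nonneg)
  have "S\<^sup>2 \<le> (a \<bullet> a) * (?u \<bullet> ?u)"
  proof -
    have "dim_vec ?u = dim_vec a" using a noise_vec_carrier[of c P g \<zeta>] by auto
    then show ?thesis unfolding au[symmetric] scalar_prod_def
      using Cauchy_Schwarz_ineq_sum[of "vec_index a" "vec_index ?u" "{0..<dim_vec a}"]
      by (simp add: power2_eq_square)
  qed
  also have "\<dots> \<le> (a \<bullet> a) * (C * S)"
    using C[of \<zeta>] scalar_prod_self_nonneg[of a] by (intro mult_left_mono) (auto simp: E)
  finally have le: "S * S \<le> C * (a \<bullet> a) * S" by (simp add: power2_eq_square mult_ac)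
  show ?thesis
  proof (cases "S = 0")
    case True
    \<comment> \<open>\<open>C\<close> comes without a sign. Applying its bound to a realization
      that produces \<open>a\<close> shows that the product is nonnegative.\<close>
    have "0 \<le> C * (a \<bullet> a)"
    proof -
      obtain \<zeta>' where z: "noise_vec c P g \<zeta>' = a" "noise_energy c \<zeta>' = a \<bullet> a"
        using noise_vec_surjective[OF c a] by blast
      show ?thesis using C[of \<zeta>'] scalar_prod_self_nonneg[of a] unfolding z by linarith
    qed
    then show ?thesis using True form by simp
  next
    case False
    then have "S \<le> C * (a \<bullet> a)" using le S0 by (simp add: mult_le_cancel_right)
    then show ?thesis using S0 form by simp
  qed
qed

lemma noise_cov_pos_def:
  assumes c: "valid_dstbc c" and net: "network_model M c Z info"
  shows "pos_def_mat (noise_cov M c Z P g)"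
proof -
  let ?G = "noise_cov M c Z P g" and ?d = "2 * (len2 c * ants c)"
  have d: "dim_row ?G = ?d" "dim_col ?G = ?d" using noise_cov_carrier by blast+
  have "a \<bullet> (?G *\<^sub>v a) > 0" if "a \<in> carrier_vec ?d" "a \<noteq> 0\<^sub>v ?d" for a
    using noise_cov_lower[OF c net that(1), of P g] scalar_prod_self_pos[OF that] by linarith
  then show ?thesis using d noise_cov_symmetric[OF c net] by (auto simp: pos_def_mat_def)
qed

section \<open>The equivalent channel\<close>

abbreviation gains_f :: "(rv_index \<Rightarrow> 'w \<Rightarrow> complex) \<Rightarrow> 'w \<Rightarrow> nat \<Rightarrow> complex" where
  "gains_f Z \<omega> \<equiv> (\<lambda>j. Z (Gain_f j) \<omega>)"

abbreviation gains_g :: "(rv_index \<Rightarrow> 'w \<Rightarrow> complex) \<Rightarrow> 'w \<Rightarrow> nat \<Rightarrow> nat \<Rightarrow> complex" where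
  "gains_g Z \<omega> \<equiv> (\<lambda>j l. Z (Gain_g j l) \<omega>)"

definition codeword :: "dstbc \<Rightarrow> (nat \<Rightarrow> real) \<Rightarrow> complex mat" where
  "codeword c a = linear_design (len2 c) (relays c) (syms c) (weight_mat c) a"

definition snr_gain :: "dstbc \<Rightarrow> real \<Rightarrow> real" where
  "snr_gain c P = sqrt (pow1 c * pow2 c * P\<^sup>2 / (pow1 c * P + 1))"

text \<open>The squared Frobenius norm of \<open>channel_mat c f g\<close>, since conjugating some
  of the f_j does not change their moduli.\<close>

definition channel_energy :: "dstbc \<Rightarrow> (nat \<Rightarrow> complex) \<Rightarrow> (nat \<Rightarrow> nat \<Rightarrow> complex) \<Rightarrow> real" where
  "channel_energy c f g = (\<Sum>j<relays c. (cmod (f j))\<^sup>2 * (\<Sum>l<ants c. (cmod (g j l))\<^sup>2))"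

lemma mat_of_cols_map_carrier: "mat_of_cols d (map h [0..<k]) \<in> carrier_mat d k"
  using mat_of_cols_carrier(1)[of d "map h [0..<k]"] by simp

lemma weight_mat_carrier [simp]: "weight_mat c i \<in> carrier_mat (len2 c) (relays c)"
  unfolding weight_mat_def by (rule mat_of_cols_map_carrier)

lemma codeword_carrier [simp]: "codeword c a \<in> carrier_mat (len2 c) (relays c)"
  by (simp add: codeword_def linear_design_def)

lemma channel_mat_carrier [simp]: "channel_mat c f g \<in> carrier_mat (relays c) (ants c)"
  by (simp add: channel_mat_def)

lemma weight_mat_index:
  assumes c: "valid_dstbc c" and "i < syms c" "t < len2 c" "j < relays c"
  shows "weight_mat c i $$ (t, j) =
    conj_op c j (\<Sum>s<len1 c. relay_mat c j $$ (t, s) * (src_vec c i) $ s)"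
proof -
  have "relay_mat c j \<in> carrier_mat (len2 c) (len1 c)" "src_vec c i \<in> carrier_vec (len1 c)"
    using assms by (auto simp: valid_dstbc_def)
  then show ?thesis using assms
    by (simp add: weight_mat_def mat_of_cols_index scalar_prod_def atLeast0LessThan)
qed

lemma codeword_index:
  assumes "t < len2 c" "j < relays c"
  shows "codeword c a $$ (t, j) = (\<Sum>i<syms c. complex_of_real (a i) * weight_mat c i $$ (t, j))"
  using assms by (simp add: codeword_def linear_design_def)

lemma codeword_mult_index:
  assumes H: "H \<in> carrier_mat (relays c) D" and "t < len2 c" "l < D"
  shows "(codeword c a * H) $$ (t, l) = (\<Sum>i<syms c. complex_of_real (a i) * (weight_mat c i * H) $$ (t, l))"
proof -
  have "(codeword c a * H) $$ (t, l) = (\<Sum>j<relays c. (\<Sum>i<syms c. complex_of_real (a i) * weight_mat c i $$ (t, j)) * H $$ (j, l))"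
    using assms carrier_matD[OF codeword_carrier[of c a]]
    by (simp add: scalar_prod_def atLeast0LessThan codeword_index)
  also have "\<dots> = (\<Sum>i<syms c. \<Sum>j<relays c. complex_of_real (a i) * weight_mat c i $$ (t, j) * H $$ (j, l))"
    by (simp add: sum_distrib_right) (rule sum.swap)
  also have "\<dots> = (\<Sum>i<syms c. complex_of_real (a i) * (weight_mat c i * H) $$ (t, l))"
    using assms carrier_matD[OF weight_mat_carrier[of c]]
    by (simp add: scalar_prod_def atLeast0LessThan sum_distrib_left mult_ac)
  finally show ?thesis .
qed

text \<open>Stacking is real-linear, so real combinations of the columns are stacked codewords.
  Projected columns of the equivalent channel thereby come from code matrices with arbitrary real
  coefficients, not only from transmitted symbols.\<close>

lemma vec_tilde_codeword_mult:
  assumes H: "H \<in> carrier_mat (relays c) D" and a: "a \<in> carrier_vec (syms c)"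
  shows "mat_of_cols (2 * (len2 c * D)) (map (\<lambda>i. vec_tilde (weight_mat c i * H)) [0..<syms c]) *\<^sub>v a
    = vec_tilde (codeword c (vec_index a) * H)" (is "?M *\<^sub>v a = vec_tilde ?XH")
proof (rule eq_vecI)
  have XH: "?XH \<in> carrier_mat (len2 c) D" by (rule mult_carrier_mat[OF _ H]) simp
  have WH: "weight_mat c i * H \<in> carrier_mat (len2 c) D" for i by (rule mult_carrier_mat[OF _ H]) simp
  show "dim_vec (?M *\<^sub>v a) = dim_vec (vec_tilde ?XH)" using carrier_matD[OF XH] by simp
  fix p assume "p < dim_vec (vec_tilde ?XH)"
  then have p: "p < 2 * (len2 c * D)" using carrier_matD[OF XH] by simp
  have pd: "p < len2 c * D \<or> p - len2 c * D < len2 c * D" using p by linarith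
  have Re_eq: "Re (?XH $$ (t, l)) = (\<Sum>i<syms c. Re ((weight_mat c i * H) $$ (t, l)) * a $ i)"
    and Im_eq: "Im (?XH $$ (t, l)) = (\<Sum>i<syms c. Im ((weight_mat c i * H) $$ (t, l)) * a $ i)"
    if "t < len2 c" "l < D" for t l
    unfolding codeword_mult_index[OF H that] by (simp_all add: mult.commute)
  have "(?M *\<^sub>v a) $ p = (\<Sum>i<syms c. (vec_tilde (weight_mat c i * H)) $ p * a $ i)"
    using p a by (simp add: scalar_prod_def atLeast0LessThan mat_of_cols_index)
  also have "\<dots> = (vec_tilde ?XH) $ p"
  proof (cases "p < len2 c * D")
    case True
    show ?thesis
      unfolding vec_tilde_index[OF XH p] vec_tilde_index[OF WH p] if_P[OF True]
      by (rule Re_eq[symmetric]) (use mod_div_bounds[OF True] in blast)+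
  next
    case False
    then have q: "p - len2 c * D < len2 c * D" using pd by blast
    show ?thesis
      unfolding vec_tilde_index[OF XH p] vec_tilde_index[OF WH p] if_not_P[OF False]
      by (rule Im_eq[symmetric]) (use mod_div_bounds[OF q] in blast)+
  qed
  finally show "(?M *\<^sub>v a) $ p = (vec_tilde ?XH) $ p" .
qed

lemma snr_gain_eq:
  assumes "valid_dstbc c" "P \<ge> 0"
  shows "relay_gain c P * sqrt (pow1 c * P) = snr_gain c P"
  unfolding relay_gain_def snr_gain_def
  by (simp add: real_sqrt_mult[symmetric] power2_eq_square mult_ac)

text \<open>For P \<ge> 1 the denominator pow1 P + 1 is at most (pow1 + 1) P, so the effective
  signal power grows linearly.\<close>

lemma snr_gain_sq:
  assumes c: "valid_dstbc c" and P: "P \<ge> 1"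
  shows "(snr_gain c P)\<^sup>2 \<ge> pow1 c * pow2 c / (pow1 c + 1) * P"
proof -
  define a b where "a = pow1 c" and "b = pow2 c"
  have ab: "a > 0" "b > 0" using c by (auto simp: valid_dstbc_def a_def b_def)
  have "(snr_gain c P)\<^sup>2 = a * b * P\<^sup>2 / (a * P + 1)"
    unfolding snr_gain_def a_def[symmetric] b_def[symmetric] using ab P by (intro real_sqrt_pow2) auto
  moreover have "a * b / (a + 1) * P = a * b * P\<^sup>2 / ((a + 1) * P)"
    using P by (simp add: power2_eq_square)
  moreover have "a * b * P\<^sup>2 / ((a + 1) * P) \<le> a * b * P\<^sup>2 / (a * P + 1)"
    using ab P by (intro divide_left_mono mult_pos_pos add_nonneg_pos) (auto simp: algebra_simps)
  ultimately show ?thesis by (simp add: a_def b_def)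
qed

text \<open>The conjugation at relay j acts on B_j r_j as a whole. On the signal part it yields the
  column of the weight matrices and the conjugated gain f_j in the channel matrix, while the real
  symbols and power factors pass through.\<close>

lemma received_mat_eq:
  assumes c: "valid_dstbc c" and P: "P \<ge> 0"
  shows "received_mat c P x f g v w =
    complex_of_real (snr_gain c P) \<cdot>\<^sub>m (codeword c x * channel_mat c f g) + noise_mat c P g v w"
    (is "?Y = _ \<cdot>\<^sub>m ?XH + ?U")
proof (rule eq_matI)
  have XH: "?XH \<in> carrier_mat (len2 c) (ants c)" by (rule mult_carrier_mat[OF codeword_carrier channel_mat_carrier])
  note d = carrier_matD[OF XH]
  fix t l assume "t < dim_row (complex_of_real (snr_gain c P) \<cdot>\<^sub>m ?XH + ?U)"
    "l < dim_col (complex_of_real (snr_gain c P) \<cdot>\<^sub>m ?XH + ?U)"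
  then have tl: "t < len2 c" "l < ants c" by auto
  have B: "relay_mat c j \<in> carrier_mat (len2 c) (len1 c)" if "j < relays c" for j
    using c that by (auto simp: valid_dstbc_def)
  let ?\<rho> = "complex_of_real (relay_gain c P)" and ?\<tau> = "complex_of_real (snr_gain c P)"
  have sent: "(relay_sent c P x f v j) $ t = ?\<tau> * conj_op c j (f j) * codeword c x $$ (t, j)
      + ?\<rho> * conj_op c j (\<Sum>s<len1 c. relay_mat c j $$ (t, s) * v j s)" if j: "j < relays c" for j
  proof -
    have "(relay_mat c j *\<^sub>v relay_received c P x f v j) $ t =
        (\<Sum>s<len1 c. relay_mat c j $$ (t, s) * (f j * complex_of_real (sqrt (pow1 c * P)) *
          (\<Sum>i<syms c. complex_of_real (x i) * (src_vec c i) $ s) + v j s))"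
      using B[OF j] tl by (simp add: scalar_prod_def relay_received_def source_signal_def atLeast0LessThan)
    also have "\<dots> = f j * complex_of_real (sqrt (pow1 c * P)) *
        (\<Sum>i<syms c. complex_of_real (x i) * (\<Sum>s<len1 c. relay_mat c j $$ (t, s) * (src_vec c i) $ s))
        + (\<Sum>s<len1 c. relay_mat c j $$ (t, s) * v j s)"
    proof -
      have "(\<Sum>s<len1 c. relay_mat c j $$ (t, s) * (f j * complex_of_real (sqrt (pow1 c * P)) *
          (\<Sum>i<syms c. complex_of_real (x i) * (src_vec c i) $ s))) =
        f j * complex_of_real (sqrt (pow1 c * P)) *
        (\<Sum>i<syms c. complex_of_real (x i) * (\<Sum>s<len1 c. relay_mat c j $$ (t, s) * (src_vec c i) $ s))"
        by (simp only: sum_distrib_left) (subst sum.swap, intro sum.cong refl, simp add: mult_ac)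
      then show ?thesis by (simp add: distrib_left sum.distrib)
    qed
    finally have Br: "(relay_mat c j *\<^sub>v relay_received c P x f v j) $ t = \<dots>" .
    have "(relay_sent c P x f v j) $ t = ?\<rho> * conj_op c j ((relay_mat c j *\<^sub>v relay_received c P x f v j) $ t)"
      using B[OF j] tl by (simp add: relay_sent_def)
    also have "\<dots> = ?\<rho> * complex_of_real (sqrt (pow1 c * P)) * conj_op c j (f j) * codeword c x $$ (t, j)
      + ?\<rho> * conj_op c j (\<Sum>s<len1 c. relay_mat c j $$ (t, s) * v j s)"
      unfolding Br codeword_index[OF tl(1) j]
      by (simp add: conj_op_linear weight_mat_index[OF c _ tl(1) j] algebra_simps)
    also have "?\<rho> * complex_of_real (sqrt (pow1 c * P)) = ?\<tau>"
      using snr_gain_eq[OF c P] by (metis of_real_mult)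
    finally show ?thesis .
  qed
  have "?Y $$ (t, l) = (\<Sum>j<relays c. g j l * (?\<tau> * conj_op c j (f j) * codeword c x $$ (t, j)
      + ?\<rho> * conj_op c j (\<Sum>s<len1 c. relay_mat c j $$ (t, s) * v j s))) + w l t"
    using tl by (simp add: received_mat_def sent)
  also have "\<dots> = ?\<tau> * (\<Sum>j<relays c. codeword c x $$ (t, j) * (conj_op c j (f j) * g j l)) + ?U $$ (t, l)"
    unfolding noise_mat_index[OF c tl] by (simp add: distrib_left sum.distrib sum_distrib_left mult_ac)
  also have "(\<Sum>j<relays c. codeword c x $$ (t, j) * (conj_op c j (f j) * g j l)) = ?XH $$ (t, l)"
    using tl carrier_matD[OF codeword_carrier[of c x]]
    by (simp add: scalar_prod_def atLeast0LessThan channel_mat_def)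
  finally show "?Y $$ (t, l) = (?\<tau> \<cdot>\<^sub>m ?XH + ?U) $$ (t, l)" using tl d by simp
qed (simp_all add: received_mat_def)

text \<open>The bilinear bound applies to each column of the channel matrix, that is, to each
  destination antenna; summing over the antennas gives the full channel energy.\<close>

lemma codeword_lower_bound:
  assumes W: "complex_orthogonal_design T' N' K' W"
    and dims: "relays c = L * N'" "syms c = n * K'" "len2 c = (n + L - 1) * T'"
    and design: "has_design c (X_design T' N' K' W L 1 n)"
  obtains k where "k > 0"
    "\<And>a f g. k * (\<Sum>i<syms c. (a i)\<^sup>2) * channel_energy c f g \<le>
       vec_tilde (codeword c a * channel_mat c f g) \<bullet> vec_tilde (codeword c a * channel_mat c f g)"
proof -
  have cw: "codeword c a = X_design T' N' K' W L 1 n a" for a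
    using design by (simp add: codeword_def has_design_def)
  have bil: "(\<Sum>i<syms c. \<Sum>j<relays c. complex_of_real (a i) * h j * weight_mat c i $$ (t, j)) =
      (\<Sum>j<relays c. codeword c a $$ (t, j) * h j)" if "t < len2 c" for a h t
    using that by (subst sum.swap) (simp add: codeword_index sum_distrib_left sum_distrib_right mult_ac)
  have inj: "(\<forall>i<syms c. a i = 0) \<or> (\<forall>j<relays c. h j = 0)"
    if "\<And>t. t \<in> {..<len2 c} \<Longrightarrow> (\<Sum>i<syms c. \<Sum>j<relays c. complex_of_real (a i) * h j * weight_mat c i $$ (t, j)) = 0"
    for a h
    using X_design_injective[OF W, of n L a h] that unfolding dims[symmetric] by (simp add: bil cw)
  obtain k where k: "k > 0" "\<And>a h. k * (\<Sum>i<syms c. (a i)\<^sup>2) * (\<Sum>j<relays c. (cmod (h j))\<^sup>2) \<le>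
      (\<Sum>t<len2 c. (cmod (\<Sum>i<syms c. \<Sum>j<relays c. complex_of_real (a i) * h j * weight_mat c i $$ (t, j)))\<^sup>2)"
  proof (rule bilinear_lower_bound[where R="{..<len2 c}" and K="syms c" and N="relays c"
          and C="\<lambda>t i j. weight_mat c i $$ (t, j)", OF finite_lessThan inj], goal_cases)
    case (2 k)
    show ?case by (rule 2(1)[OF 2(2,3)])
  qed
  have "k * (\<Sum>i<syms c. (a i)\<^sup>2) * channel_energy c f g \<le>
       vec_tilde (codeword c a * channel_mat c f g) \<bullet> vec_tilde (codeword c a * channel_mat c f g)" for a f g
  proof -
    let ?h = "\<lambda>l j. conj_op c j (f j) * g j l"
    have XH: "codeword c a * channel_mat c f g \<in> carrier_mat (len2 c) (ants c)"
      by (rule mult_carrier_mat[OF codeword_carrier channel_mat_carrier])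
    have "k * (\<Sum>i<syms c. (a i)\<^sup>2) * channel_energy c f g =
        (\<Sum>l<ants c. k * (\<Sum>i<syms c. (a i)\<^sup>2) * (\<Sum>j<relays c. (cmod (?h l j))\<^sup>2))"
      unfolding channel_energy_def sum_distrib_left[symmetric]
      by (subst sum.swap) (simp add: norm_mult conj_op_linear power_mult_distrib sum_distrib_left)
    also have "\<dots> \<le> (\<Sum>l<ants c. \<Sum>t<len2 c. (cmod ((codeword c a * channel_mat c f g) $$ (t, l)))\<^sup>2)"
    proof (rule sum_mono)
      fix l assume l: "l \<in> {..<ants c}"
      have "(codeword c a * channel_mat c f g) $$ (t, l) =
          (\<Sum>i<syms c. \<Sum>j<relays c. complex_of_real (a i) * ?h l j * weight_mat c i $$ (t, j))" if "t < len2 c" for t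
        using l that carrier_matD[OF codeword_carrier[of c a]]
        by (simp add: bil scalar_prod_def atLeast0LessThan channel_mat_def)
      then show "k * (\<Sum>i<syms c. (a i)\<^sup>2) * (\<Sum>j<relays c. (cmod (?h l j))\<^sup>2) \<le>
          (\<Sum>t<len2 c. (cmod ((codeword c a * channel_mat c f g) $$ (t, l)))\<^sup>2)"
        using k(2)[of a "?h l"] by simp
    qed
    also have "\<dots> = vec_tilde (codeword c a * channel_mat c f g) \<bullet> vec_tilde (codeword c a * channel_mat c f g)"
      by (rule vec_tilde_norm[OF XH, symmetric])
    finally show ?thesis .
  qed
  then show thesis using that k(1) by blast
qed

lemma equiv_channel_carrier:
  assumes c: "valid_dstbc c" and net: "network_model M c Z info"
  shows "equiv_channel M c Z P \<omega> \<in> carrier_mat (2 * (len2 c * ants c)) (syms c)"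
  unfolding equiv_channel_def Let_def
  by (rule mult_carrier_mat[OF inv_sqrt_mat_props(1)[OF noise_cov_carrier noise_cov_pos_def[OF c net]] smult_carrier_mat[OF mat_of_cols_map_carrier]])

lemma equiv_channel_mult:
  assumes c: "valid_dstbc c" and net: "network_model M c Z info" and a: "a \<in> carrier_vec (syms c)"
  shows "equiv_channel M c Z P \<omega> *\<^sub>v a = inv_sqrt_mat (noise_cov M c Z P (gains_g Z \<omega>)) *\<^sub>v
    (snr_gain c P \<cdot>\<^sub>v vec_tilde (codeword c (vec_index a) *
       channel_mat c (gains_f Z \<omega>) (gains_g Z \<omega>)))"
proof -
  let ?d = "2 * (len2 c * ants c)"
  let ?g = "gains_g Z \<omega>" let ?H = "channel_mat c (gains_f Z \<omega>) ?g"
  let ?B = "inv_sqrt_mat (noise_cov M c Z P ?g)"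
  let ?M = "mat_of_cols ?d (map (\<lambda>i. vec_tilde (weight_mat c i * ?H)) [0..<syms c])"
  have B: "?B \<in> carrier_mat ?d ?d"
    by (rule inv_sqrt_mat_props(1)[OF noise_cov_carrier noise_cov_pos_def[OF c net]])
  have M: "?M \<in> carrier_mat ?d (syms c)" by (rule mat_of_cols_map_carrier)
  have "equiv_channel M c Z P \<omega> *\<^sub>v a = ?B *\<^sub>v ((snr_gain c P \<cdot>\<^sub>m ?M) *\<^sub>v a)"
    unfolding equiv_channel_def Let_def snr_gain_def[symmetric]
    by (rule assoc_mult_mat_vec[OF B smult_carrier_mat[OF M] a])
  also have "(snr_gain c P \<cdot>\<^sub>m ?M) *\<^sub>v a = snr_gain c P \<cdot>\<^sub>v (?M *\<^sub>v a)"
    using M a by (intro eq_vecI) auto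
  also have "?M *\<^sub>v a = vec_tilde (codeword c (vec_index a) * ?H)"
    by (rule vec_tilde_codeword_mult[OF channel_mat_carrier a])
  finally show ?thesis .
qed

lemma equiv_received_eq:
  assumes c: "valid_dstbc c" and net: "network_model M c Z info" and P: "P \<ge> 0"
  shows "equiv_received M c Z P x \<omega> = equiv_channel M c Z P \<omega> *\<^sub>v vec (syms c) x +
    inv_sqrt_mat (noise_cov M c Z P (gains_g Z \<omega>)) *\<^sub>v
      noise_vec c P (gains_g Z \<omega>) (\<lambda>s. Z s \<omega>)"
proof -
  let ?d = "2 * (len2 c * ants c)"
  let ?g = "gains_g Z \<omega>" let ?H = "channel_mat c (gains_f Z \<omega>) ?g"
  let ?B = "inv_sqrt_mat (noise_cov M c Z P ?g)" let ?X = "codeword c x * ?H"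
  have B: "?B \<in> carrier_mat ?d ?d"
    by (rule inv_sqrt_mat_props(1)[OF noise_cov_carrier noise_cov_pos_def[OF c net]])
  have X: "?X \<in> carrier_mat (len2 c) (ants c)"
    by (rule mult_carrier_mat[OF codeword_carrier channel_mat_carrier])
  have cw: "codeword c (vec_index (vec (syms c) x)) = codeword c x"
    by (rule eq_matI) (simp_all add: codeword_def linear_design_def)
  have "vec_tilde (received_mat c P x (gains_f Z \<omega>) ?g (\<lambda>j t. Z (Noise_v j t) \<omega>) (\<lambda>l t. Z (Noise_w l t) \<omega>)) =
      snr_gain c P \<cdot>\<^sub>v vec_tilde ?X + noise_vec c P ?g (\<lambda>s. Z s \<omega>)"
    unfolding received_mat_eq[OF c P] noise_vec_def
    by (simp only: vec_tilde_add[OF smult_carrier_mat[OF X] noise_mat_carrier] vec_tilde_smult[OF X])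
  moreover have "equiv_channel M c Z P \<omega> *\<^sub>v vec (syms c) x = ?B *\<^sub>v (snr_gain c P \<cdot>\<^sub>v vec_tilde ?X)"
    by (rule equiv_channel_mult[OF c net, of "vec (syms c) x" P \<omega>, OF vec_carrier, unfolded cw])
  moreover have "snr_gain c P \<cdot>\<^sub>v vec_tilde ?X \<in> carrier_vec ?d"
    using vec_tilde_carrier[OF X] by simp
  ultimately have "?B *\<^sub>v vec_tilde (received_mat c P x (gains_f Z \<omega>) ?g (\<lambda>j t. Z (Noise_v j t) \<omega>) (\<lambda>l t. Z (Noise_w l t) \<omega>)) =
      equiv_channel M c Z P \<omega> *\<^sub>v vec (syms c) x + ?B *\<^sub>v noise_vec c P ?g (\<lambda>s. Z s \<omega>)"
    by (simp only: mult_add_distrib_mat_vec[OF B _ noise_vec_carrier])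
  then show ?thesis
    by (simp only: equiv_received_def Let_def)
qed

section \<open>Decoding errors\<close>

lemma col_carrier_vec': "G \<in> carrier_mat d K \<Longrightarrow> col G i \<in> carrier_vec d"
  by (rule carrier_vecI) simp

lemma col_image_carrier_vec: "G \<in> carrier_mat d K \<Longrightarrow> col G ` I \<subseteq> carrier_vec d"
  using col_carrier_vec' by (rule image_subsetI)

text \<open>Unwhitening the signal costs one factor \<open>r\<close>, through the upper bound on the
  covariance; the norm bound on the noise costs the other. The 8 is 4 from the decision rule times 2
  from the lower bound 1/2 on the covariance.\<close>

lemma projected_column_bound:
  assumes c: "valid_dstbc c" and net: "network_model M c Z info"
    and k: "k > 0" "\<And>a f g. k * (\<Sum>i<syms c. (a i)\<^sup>2) * channel_energy c f g \<le>
       vec_tilde (codeword c a * channel_mat c f g) \<bullet> vec_tilde (codeword c a * channel_mat c f g)"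
    and r: "\<And>\<zeta>. noise_vec c P (gains_g Z \<omega>) \<zeta> \<bullet> noise_vec c P (gains_g Z \<omega>) \<zeta> \<le> r * noise_energy c \<zeta>"
    and r0: "r \<ge> 0"
    and iI: "i < syms c" "i \<notin> I" "I \<subseteq> {..<syms c}"
    and G: "G = equiv_channel M c Z P \<omega>"
    and B: "B = inv_sqrt_mat (noise_cov M c Z P (gains_g Z \<omega>))"
    and n: "n = B *\<^sub>v noise_vec c P (gains_g Z \<omega>) (\<lambda>s. Z s \<omega>)"
    and q: "q = proj_compl (2 * (len2 c * ants c)) (col G ` I) (col G i)"
    and le: "q \<bullet> q \<le> 4 * (n \<bullet> n)"
  shows "(snr_gain c P)\<^sup>2 * (k * channel_energy c (gains_f Z \<omega>) (gains_g Z \<omega>)) \<le>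
     8 * r\<^sup>2 * noise_energy c (\<lambda>s. Z s \<omega>)"
proof -
  let ?d = "2 * (len2 c * ants c)"
  let ?f = "gains_f Z \<omega>" and ?g = "gains_g Z \<omega>" and ?u = "noise_vec c P (gains_g Z \<omega>) (\<lambda>s. Z s \<omega>)"
  let ?\<Gamma> = "noise_cov M c Z P ?g" and ?H = "channel_mat c (gains_f Z \<omega>) (gains_g Z \<omega>)"
  have Gc: "G \<in> carrier_mat ?d (syms c)" unfolding G by (rule equiv_channel_carrier[OF c net])
  have S: "finite (col G ` I)" "col G ` I \<subseteq> carrier_vec ?d" by (rule finite_imageI[OF finite_subset[OF iI(3) finite_lessThan]], rule col_image_carrier_vec[OF Gc])
  have gi: "col G i \<in> carrier_vec ?d" by (rule col_carrier_vec'[OF Gc])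
  note qp = proj_compl_props[OF S gi, folded q]
  obtain a' where a': "a' \<in> carrier_vec (syms c)" "col G i - q = G *\<^sub>v a'" "\<And>j. j < syms c \<Longrightarrow> j \<notin> I \<Longrightarrow> a' $ j = 0"
    using vec_span_cols[OF Gc iI(3) qp(3)] by blast
  define a where "a = unit_vec (syms c) i - a'"
  have a: "a \<in> carrier_vec (syms c)" using a' by (simp add: a_def)
  have "G *\<^sub>v a = col G i - G *\<^sub>v a'"
    unfolding a_def using Gc a'(1) mult_mat_vec_unit[OF Gc iI(1)] by (simp add: mult_minus_distrib_mat_vec[of _ ?d "syms c"])
  also have "\<dots> = q" unfolding a'(2)[symmetric] using gi qp(1) by (intro eq_vecI) auto
  finally have qGa: "q = G *\<^sub>v a" by simp
  \<comment> \<open>As i is outside \<open>I\<close>, the projection cannot change coordinate i. So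
    the squared norm of \<open>a\<close> is at least 1 however large the other coefficients, which
    depend on the channel, may be.\<close>
  have "a $ i = 1" using a'(1) a'(3)[OF iI(1,2)] iI(1) by (simp add: a_def)
  then have "1 \<le> (a $ i)\<^sup>2" by simp
  also have "\<dots> \<le> (\<Sum>j<syms c. (a $ j)\<^sup>2)" using iI(1) by (intro member_le_sum) auto
  finally have a1: "1 \<le> (\<Sum>j<syms c. (a $ j)\<^sup>2)" .
  define E where "E = channel_energy c ?f ?g"
  have E: "E \<ge> 0" by (auto simp: E_def channel_energy_def intro!: sum_nonneg mult_nonneg_nonneg)
  let ?x = "vec_tilde (codeword c (vec_index a) * ?H)"
  have XH: "codeword c (vec_index a) * ?H \<in> carrier_mat (len2 c) (ants c)"
    by (rule mult_carrier_mat[OF codeword_carrier channel_mat_carrier])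
  have xc: "?x \<in> carrier_vec ?d" by (rule vec_tilde_carrier[OF XH])
  have "k * 1 * E \<le> k * (\<Sum>j<syms c. (a $ j)\<^sup>2) * E"
    using a1 k(1) E by (intro mult_right_mono mult_left_mono) auto
  also have "\<dots> \<le> ?x \<bullet> ?x" unfolding E_def by (rule k(2))
  finally have xE: "k * E \<le> ?x \<bullet> ?x" by simp
  have u: "snr_gain c P \<cdot>\<^sub>v ?x \<in> carrier_vec ?d" using xc by simp
  have qB: "q = B *\<^sub>v (snr_gain c P \<cdot>\<^sub>v ?x)" unfolding qGa G B by (rule equiv_channel_mult[OF c net a])
  have "(snr_gain c P)\<^sup>2 * (k * E) \<le> (snr_gain c P)\<^sup>2 * (?x \<bullet> ?x)"
    by (intro mult_left_mono xE) auto
  also have "\<dots> = (snr_gain c P \<cdot>\<^sub>v ?x) \<bullet> (snr_gain c P \<cdot>\<^sub>v ?x)"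
    using xc by (simp add: power2_eq_square)
  also have "\<dots> \<le> r * (q \<bullet> q)"
    unfolding qB B
    by (rule inv_sqrt_mat_lower[OF noise_cov_carrier noise_cov_pos_def[OF c net] u])
       (rule noise_cov_upper[OF c net _ r])
  also have "\<dots> \<le> r * (4 * (n \<bullet> n))" using le r0 by (intro mult_left_mono)
  also have "\<dots> \<le> r * (4 * (2 * (?u \<bullet> ?u)))"
    unfolding n B using r0
    by (intro mult_left_mono inv_sqrt_mat_upper[OF noise_cov_carrier noise_cov_pos_def[OF c net] noise_vec_carrier]
        noise_cov_lower[OF c net]) auto
  also have "\<dots> \<le> r * (4 * (2 * (r * noise_energy c (\<lambda>s. Z s \<omega>))))"
    using r0 by (intro mult_left_mono r) auto
  finally show ?thesis by (simp add: E_def power2_eq_square mult_ac)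
qed

text \<open>Up to the first wrong decision there is no error propagation: cancellation merely sets
  the symbols decided so far to zero and leaves the noise as it was.\<close>

lemma sic_residual_eq:
  assumes G: "G \<in> carrier_mat d K" and n: "n \<in> carrier_vec d" and \<sigma>: "\<sigma> permutes {..<K}"
    and "k \<le> K" "\<And>k'. k' < k \<Longrightarrow> xhat (\<sigma> k') = x (\<sigma> k')"
  shows "sic_residual G \<sigma> xhat (G *\<^sub>v vec K x + n) k =
    G *\<^sub>v vec K (\<lambda>i. if i \<in> \<sigma> ` {..<k} then 0 else x i) + n"
  using assms(4,5)
proof (induction k)
  case 0
  then show ?case by simp
next
  case (Suc k)
  have \<sigma>k: "\<sigma> k < K" using permutes_in_image[OF \<sigma>, of k] Suc.prems(1) by auto
  have inj: "\<sigma> k \<notin> \<sigma> ` {..<k}" by (simp add: inj_image_mem_iff[OF permutes_inj[OF \<sigma>]])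
  let ?z = "\<lambda>k. vec K (\<lambda>i. if i \<in> \<sigma> ` {..<k} then 0 else x i)"
  have "?z (Suc k) = ?z k - x (\<sigma> k) \<cdot>\<^sub>v unit_vec K (\<sigma> k)"
    using \<sigma>k inj by (intro eq_vecI) (auto simp: lessThan_Suc)
  then have "G *\<^sub>v ?z (Suc k) = G *\<^sub>v ?z k - x (\<sigma> k) \<cdot>\<^sub>v col G (\<sigma> k)"
    using G mult_mat_vec_unit[OF G \<sigma>k] by (simp add: mult_minus_distrib_mat_vec[of _ d K] mult_mat_vec[of _ d K])
  moreover have "sic_residual G \<sigma> xhat (G *\<^sub>v vec K x + n) (Suc k) = G *\<^sub>v ?z k + n - x (\<sigma> k) \<cdot>\<^sub>v col G (\<sigma> k)"
    using Suc by simp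
  moreover have "u + n - w = u - w + n" if "u \<in> carrier_vec d" "w \<in> carrier_vec d" for u w
    using that n by (intro eq_vecI) auto
  moreover have "x (\<sigma> k) \<cdot>\<^sub>v col G (\<sigma> k) \<in> carrier_vec d" "G *\<^sub>v ?z k \<in> carrier_vec d"
    by (rule smult_carrier_vec[THEN iffD2, OF col_carrier_vec'[OF G]], rule mult_mat_vec_carrier[OF G vec_carrier])
  ultimately show ?case by simp
qed

text \<open>Common core of both decoders. Symbols with index in \<open>I\<close> are removed by the
  projection; all others except \<open>i\<close> are absent from the signal, by hypothesis on
  \<open>z\<close>.\<close>

lemma linear_decision_error_projection:
  assumes G: "G \<in> carrier_mat d K" and n: "n \<in> carrier_vec d" and iI: "i < K" "i \<notin> I" "I \<subseteq> {..<K}"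
    and z: "\<And>j. j < K \<Longrightarrow> j \<noteq> i \<Longrightarrow> j \<notin> I \<Longrightarrow> z j = 0" "z i = b"
    and y: "y = G *\<^sub>v vec K z + n"
    and min: "is_arg_min (\<lambda>b. let e = proj_compl d (col G ` I) y - b \<cdot>\<^sub>v proj_compl d (col G ` I) (col G i) in e \<bullet> e)
      (\<lambda>b. b \<in> A) bhat"
    and A: "A \<subseteq> \<int>" "b \<in> A" "bhat \<noteq> b"
  shows "proj_compl d (col G ` I) (col G i) \<bullet> proj_compl d (col G ` I) (col G i) \<le> 4 * (n \<bullet> n)"
proof (rule projection_decoding_error[OF _ _ _ _ n _ min A])
  let ?z = "vec K (\<lambda>j. if j = i then 0 else z j)"
  show "finite (col G ` I)" "col G ` I \<subseteq> carrier_vec d" "col G i \<in> carrier_vec d"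
    by (rule finite_imageI[OF finite_subset[OF iI(3) finite_lessThan]], rule col_image_carrier_vec[OF G],
        rule col_carrier_vec'[OF G])
  show "G *\<^sub>v ?z \<in> vec_span d (col G ` I)"
    by (rule vec_span_colsI[OF G iI(3)]) (use z in auto)
  have "vec K z = b \<cdot>\<^sub>v unit_vec K i + ?z" using z(2) iI(1) by (intro eq_vecI) auto
  then have "G *\<^sub>v vec K z = b \<cdot>\<^sub>v col G i + G *\<^sub>v ?z"
    using G mult_mat_vec_unit[OF G iI(1)] by (simp add: mult_add_distrib_mat_vec[of _ d K] mult_mat_vec[of _ d K])
  then show "y = b \<cdot>\<^sub>v col G i + G *\<^sub>v ?z + n" using y by simp
qed

abbreviation linear_decoder :: "dstbc \<Rightarrow> decoder \<Rightarrow> bool" where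
  "linear_decoder c D \<equiv> zf_decoder c D \<or> (\<exists>\<sigma>. \<sigma> permutes {..<syms c} \<and> zf_sic_decoder c \<sigma> D)"

definition error_event :: "dstbc \<Rightarrow> (rv_index \<Rightarrow> 'w \<Rightarrow> complex) \<Rightarrow> real \<Rightarrow> real \<Rightarrow> 'w \<Rightarrow> bool" where
  "error_event c Z C P \<omega> \<longleftrightarrow> P * channel_energy c (gains_f Z \<omega>) (gains_g Z \<omega>) \<le>
    C * (1 + gain_energy c (gains_g Z \<omega>))\<^sup>2 * noise_energy c (\<lambda>s. Z s \<omega>)"

lemma decoding_error_event:
  assumes W: "complex_orthogonal_design T' N' K' W"
    and dims: "relays c = L * N'" "syms c = n * K'" "len2 c = (n + L - 1) * T'"
    and c: "valid_dstbc c" and net: "network_model M c Z info"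
    and design: "has_design c (X_design T' N' K' W L 1 n)"
    and alph: "\<And>i. i < syms c \<Longrightarrow> alph c i \<subseteq> \<int>"
  obtains C where "C > 0"
    "\<And>D P x \<omega> i. linear_decoder c D \<Longrightarrow>
      P \<ge> 1 \<Longrightarrow> x \<in> signal_set c \<Longrightarrow> i < syms c \<Longrightarrow>
      D (equiv_channel M c Z P \<omega>) (equiv_received M c Z P x \<omega>) i \<noteq> x i \<Longrightarrow>
      error_event c Z C P \<omega>"
proof -
  obtain k where k: "k > 0" "\<And>a f g. k * (\<Sum>i<syms c. (a i)\<^sup>2) * channel_energy c f g \<le>
       vec_tilde (codeword c a * channel_mat c f g) \<bullet> vec_tilde (codeword c a * channel_mat c f g)"
    using codeword_lower_bound[OF W dims design] by blast
  obtain C1 where C1: "C1 > 0" "\<And>P g \<zeta>. P \<ge> 0 \<Longrightarrow> noise_vec c P g \<zeta> \<bullet> noise_vec c P g \<zeta> \<le> C1 * (1 + gain_energy c g) * noise_energy c \<zeta>"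
    using noise_vec_norm_bound[OF c] by blast
  define \<kappa> where "\<kappa> = pow1 c * pow2 c / (pow1 c + 1)"
  have "pow1 c > 0" "pow2 c > 0" using c by (simp_all add: valid_dstbc_def)
  then have \<kappa>: "\<kappa> > 0" by (simp add: \<kappa>_def)
  \<comment> \<open>Chosen to solve \<kappa> P k E \<le> 8 C1^2 (1 + |g|^2)^2 V for P E, with E the
    channel energy and V the noise energy.\<close>
  define C where "C = 8 * C1\<^sup>2 / (\<kappa> * k)"
  have C: "C > 0" using C1(1) \<kappa> k(1) by (simp add: C_def)
  have *: "error_event c Z C P \<omega>"
    if dec: "linear_decoder c D"
      and P: "P \<ge> 1" and x: "x \<in> signal_set c" and i: "i < syms c"
      and err: "D (equiv_channel M c Z P \<omega>) (equiv_received M c Z P x \<omega>) i \<noteq> x i" for D P x \<omega> i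
  proof -
    let ?d = "2 * (len2 c * ants c)"
    define g where "g = (gains_g Z \<omega>)"
    define G where "G = equiv_channel M c Z P \<omega>"
    define y where "y = equiv_received M c Z P x \<omega>"
    define B where "B = inv_sqrt_mat (noise_cov M c Z P (gains_g Z \<omega>))"
    define m where "m = B *\<^sub>v noise_vec c P (gains_g Z \<omega>) (\<lambda>s. Z s \<omega>)"
    have err': "D G y i \<noteq> x i" unfolding G_def y_def by (rule err)
    have Gc: "G \<in> carrier_mat ?d (syms c)" unfolding G_def by (rule equiv_channel_carrier[OF c net])
    have Bc: "B \<in> carrier_mat ?d ?d"
      unfolding B_def by (rule inv_sqrt_mat_props(1)[OF noise_cov_carrier noise_cov_pos_def[OF c net]])
    have mc: "m \<in> carrier_vec ?d" unfolding m_def by (rule mult_mat_vec_carrier[OF Bc noise_vec_carrier])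
    have y: "y = G *\<^sub>v vec (syms c) x + m"
      unfolding y_def G_def m_def B_def using P by (intro equiv_received_eq[OF c net]) simp
    have yc: "y \<in> carrier_vec ?d" unfolding y by (rule add_carrier_vec[OF mult_mat_vec_carrier[OF Gc vec_carrier] mc])
    have dG: "dim_row G = ?d" by (rule carrier_matD(1)[OF Gc])
    have xA: "x j \<in> alph c j" if "j < syms c" for j using x that by (auto simp: signal_set_def)
    have "\<exists>j I. j < syms c \<and> j \<notin> I \<and> I \<subseteq> {..<syms c} \<and>
      proj_compl ?d (col G ` I) (col G j) \<bullet> proj_compl ?d (col G ` I) (col G j) \<le> 4 * (m \<bullet> m)"
      using dec
    proof
      assume "zf_decoder c D"
      from this[unfolded zf_decoder_def, rule_format, OF Gc yc]
      have "zf_output c G y (D G y)" .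
      note zf = this[unfolded zf_output_def Let_def dG, rule_format, OF i]
      have min: "is_arg_min (\<lambda>b. let e = proj_compl ?d (col G ` ({..<syms c} - {i})) y -
          b \<cdot>\<^sub>v proj_compl ?d (col G ` ({..<syms c} - {i})) (col G i) in e \<bullet> e) (\<lambda>b. b \<in> alph c i) (D G y i)"
        unfolding Let_def by (rule zf)
      have "proj_compl ?d (col G ` ({..<syms c} - {i})) (col G i) \<bullet> proj_compl ?d (col G ` ({..<syms c} - {i})) (col G i) \<le> 4 * (m \<bullet> m)"
        by (rule linear_decision_error_projection[where z=x, OF Gc mc i _ _ _ refl y min alph[OF i] xA[OF i] err']) auto
      then show ?thesis using i by (intro exI[of _ i] exI[of _ "{..<syms c} - {i}"] conjI) auto
    next
      assume "\<exists>\<sigma>. \<sigma> permutes {..<syms c} \<and> zf_sic_decoder c \<sigma> D"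
      then obtain \<sigma> where \<sigma>: "\<sigma> permutes {..<syms c}" and D: "zf_sic_decoder c \<sigma> D" by blast
      define xhat where "xhat = D G y"
      have "i \<in> \<sigma> ` {..<syms c}" using i unfolding permutes_image[OF \<sigma>] by simp
      then obtain k0 where "k0 < syms c" "\<sigma> k0 = i" by auto
      then have ex: "\<exists>k. k < syms c \<and> xhat (\<sigma> k) \<noteq> x (\<sigma> k)"
        using err' by (intro exI[of _ k0]) (simp add: xhat_def)
      \<comment> \<open>The first wrong decision in the order of cancellation, which need not be the
        decision on the given symbol \<open>i\<close>.\<close>
      define k where "k = (LEAST k. k < syms c \<and> xhat (\<sigma> k) \<noteq> x (\<sigma> k))"
      have k: "k < syms c" "xhat (\<sigma> k) \<noteq> x (\<sigma> k)" using LeastI_ex[OF ex] unfolding k_def by blast+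
      have before: "xhat (\<sigma> k') = x (\<sigma> k')" if "k' < k" for k'
        using not_less_Least[OF that[unfolded k_def]] less_trans[OF that k(1)] by blast
      let ?I = "\<sigma> ` {k<..<syms c}"
      have \<sigma>k: "\<sigma> k < syms c" using permutes_in_image[OF \<sigma>, of k] k(1) by simp
      have notin: "\<sigma> k \<notin> ?I" by (simp add: inj_image_mem_iff[OF permutes_inj[OF \<sigma>]])
      have sub: "?I \<subseteq> {..<syms c}"
      proof -
        have "?I \<subseteq> \<sigma> ` {..<syms c}" by (intro image_mono) auto
        then show ?thesis unfolding permutes_image[OF \<sigma>] .
      qed
      have "zf_sic_output c \<sigma> G y xhat"
        unfolding xhat_def by (rule D[unfolded zf_sic_decoder_def, rule_format, OF Gc yc])
      note sic = this[unfolded zf_sic_output_def Let_def dG, rule_format, OF k(1)]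
      have min: "is_arg_min (\<lambda>b. let e = proj_compl ?d (col G ` ?I) (sic_residual G \<sigma> xhat y k) -
          b \<cdot>\<^sub>v proj_compl ?d (col G ` ?I) (col G (\<sigma> k)) in e \<bullet> e) (\<lambda>b. b \<in> alph c (\<sigma> k)) (xhat (\<sigma> k))"
        unfolding Let_def by (rule sic)
      let ?z = "\<lambda>j. if j \<in> \<sigma> ` {..<k} then 0 else x j"
      have res: "sic_residual G \<sigma> xhat y k = G *\<^sub>v vec (syms c) ?z + m"
        unfolding y by (rule sic_residual_eq[OF Gc mc \<sigma> less_imp_le[OF k(1)]]) (rule before)
      \<comment> \<open>Every symbol has a position in the order: earlier than \<open>k\<close> it
        has been cancelled, later than \<open>k\<close> it belongs to \<open>?I\<close>.\<close>
      have z0: "?z j = 0" if "j < syms c" "j \<noteq> \<sigma> k" "j \<notin> ?I" for j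
      proof -
        have "j \<in> \<sigma> ` {..<syms c}" using that(1) unfolding permutes_image[OF \<sigma>] by simp
        then obtain k' where k': "k' < syms c" "j = \<sigma> k'" by auto
        have "k' \<noteq> k" using that(2) k'(2) by blast
        moreover have "\<not> k < k'"
        proof
          assume "k < k'"
          then have "k' \<in> {k<..<syms c}" using k'(1) by simp
          then show False using that(3) k'(2) by blast
        qed
        ultimately have "k' \<in> {..<k}" by simp
        then have "j \<in> \<sigma> ` {..<k}" using k'(2) by blast
        then show ?thesis by simp
      qed
      have zk: "?z (\<sigma> k) = x (\<sigma> k)" by (simp add: inj_image_mem_iff[OF permutes_inj[OF \<sigma>]])
      have "proj_compl ?d (col G ` ?I) (col G (\<sigma> k)) \<bullet> proj_compl ?d (col G ` ?I) (col G (\<sigma> k)) \<le> 4 * (m \<bullet> m)"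
        by (rule linear_decision_error_projection[where z="?z", OF Gc mc \<sigma>k notin sub _ zk res min alph[OF \<sigma>k] xA[OF \<sigma>k] k(2)])
           (rule z0)
      then show ?thesis using \<sigma>k notin sub by (intro exI[of _ "\<sigma> k"] exI[of _ ?I] conjI)
    qed
    then obtain j I where j: "j < syms c" "j \<notin> I" "I \<subseteq> {..<syms c}"
      and le: "proj_compl ?d (col G ` I) (col G j) \<bullet> proj_compl ?d (col G ` I) (col G j) \<le> 4 * (m \<bullet> m)" by blast
    define r where "r = C1 * (1 + gain_energy c g)"
    define E where "E = channel_energy c (gains_f Z \<omega>) g"
    define V where "V = noise_energy c (\<lambda>s. Z s \<omega>)"
    have r0: "r \<ge> 0" using C1(1) gain_energy_nonneg[of c g] by (simp add: r_def)
    have rb: "noise_vec c P g \<zeta> \<bullet> noise_vec c P g \<zeta> \<le> r * noise_energy c \<zeta>" for \<zeta>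
      unfolding r_def using P by (intro C1(2)) simp
    have E: "E \<ge> 0" by (auto simp: E_def channel_energy_def intro!: sum_nonneg mult_nonneg_nonneg)
    have "\<kappa> * P * (k * E) \<le> (snr_gain c P)\<^sup>2 * (k * E)"
      using snr_gain_sq[OF c P] k(1) E by (intro mult_right_mono) (auto simp: \<kappa>_def)
    also have "\<dots> \<le> 8 * r\<^sup>2 * V"
      unfolding E_def V_def g_def
      by (rule projected_column_bound[where Z=Z and \<omega>=\<omega> and P=P and r=r and k=k and c=c and M=M and I=I and i=j and G=G and B=B and n=m])
         (fact c net k(1) k(2) rb[unfolded g_def] r0 j G_def B_def m_def refl le)+
    finally have *: "\<kappa> * P * (k * E) \<le> 8 * r\<^sup>2 * V" .
    have "C * (1 + gain_energy c g)\<^sup>2 * V = 8 * r\<^sup>2 * V / (\<kappa> * k)"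
      by (simp add: C_def r_def power_mult_distrib)
    moreover have "P * E = \<kappa> * P * (k * E) / (\<kappa> * k)" using \<kappa> k(1) by simp
    ultimately have "P * E \<le> C * (1 + gain_energy c g)\<^sup>2 * V"
      using divide_right_mono[OF *, of "\<kappa> * k"] \<kappa> k(1) by simp
    then show ?thesis by (simp add: error_event_def E_def V_def g_def)
  qed
  show thesis by (rule that[OF C *])
qed

section \<open>Gaussian integrals\<close>

text \<open>Tonelli in the form needed for conditioning: integrate out \<open>X\<close> with
  \<open>Y\<close> frozen, then average the resulting bound over \<open>Y\<close>.\<close>

lemma (in prob_space) indep_var_nn_integral_le:
  assumes indep: "indep_var S X T Y"
    and H: "(\<lambda>(x, y). H x y) \<in> borel_measurable (S \<Otimes>\<^sub>M T)" and k: "k \<in> borel_measurable T"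
    and le: "\<And>y. y \<in> space T \<Longrightarrow> (\<integral>\<^sup>+\<omega>. H (X \<omega>) y \<partial>M) \<le> k y"
  shows "(\<integral>\<^sup>+\<omega>. H (X \<omega>) (Y \<omega>) \<partial>M) \<le> (\<integral>\<^sup>+\<omega>. k (Y \<omega>) \<partial>M)"
proof -
  have X [measurable]: "X \<in> measurable M S" and Y [measurable]: "Y \<in> measurable M T"
    and D: "distr M S X \<Otimes>\<^sub>M distr M T Y = distr M (S \<Otimes>\<^sub>M T) (\<lambda>\<omega>. (X \<omega>, Y \<omega>))"
    using indep by (auto simp: indep_var_distribution_eq)
  interpret X: prob_space "distr M S X" by (rule prob_space_distr) fact
  interpret Y: prob_space "distr M T Y" by (rule prob_space_distr) fact
  interpret XY: pair_prob_space "distr M S X" "distr M T Y" ..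
  have H': "(\<lambda>(x, y). H x y) \<in> borel_measurable (distr M S X \<Otimes>\<^sub>M distr M T Y)"
    using H by (simp cong: measurable_cong_sets)
  have "(\<integral>\<^sup>+\<omega>. H (X \<omega>) (Y \<omega>) \<partial>M) = (\<integral>\<^sup>+p. (\<lambda>(x, y). H x y) p \<partial>(distr M S X \<Otimes>\<^sub>M distr M T Y))"
    unfolding D using H by (subst nn_integral_distr) auto
  also have "\<dots> = (\<integral>\<^sup>+y. (\<integral>\<^sup>+x. H x y \<partial>distr M S X) \<partial>distr M T Y)"
    using XY.nn_integral_snd[OF H'] by simp
  also have "\<dots> \<le> (\<integral>\<^sup>+y. k y \<partial>distr M T Y)"
  proof (rule nn_integral_mono)
    fix y assume "y \<in> space (distr M T Y)"
    then have y: "y \<in> space T" by simp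
    have "(\<lambda>x. H x y) \<in> borel_measurable S"
      using measurable_compose[OF measurable_Pair2'[OF y] H] by simp
    then show "(\<integral>\<^sup>+x. H x y \<partial>distr M S X) \<le> k y"
      using le[OF y] by (subst nn_integral_distr) auto
  qed
  also have "\<dots> = (\<integral>\<^sup>+\<omega>. k (Y \<omega>) \<partial>M)" using k by (subst nn_integral_distr) auto
  finally show ?thesis .
qed

lemma (in prob_space) indep_var_nn_integral_mult:
  fixes A B :: "'a \<Rightarrow> real" and \<phi> \<psi> :: "real \<Rightarrow> ennreal"
  assumes "indep_var borel A borel B" and [measurable]: "\<phi> \<in> borel_measurable borel" "\<psi> \<in> borel_measurable borel"
  shows "(\<integral>\<^sup>+\<omega>. \<phi> (A \<omega>) * \<psi> (B \<omega>) \<partial>M) = (\<integral>\<^sup>+\<omega>. \<phi> (A \<omega>) \<partial>M) * (\<integral>\<^sup>+\<omega>. \<psi> (B \<omega>) \<partial>M)"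
proof -
  have "indep_var borel (\<phi> \<circ> A) borel (\<psi> \<circ> B)" by (rule indep_var_compose[OF assms(1)]) measurable
  moreover have "(\<lambda>_. borel) = (case_bool borel borel :: bool \<Rightarrow> ennreal measure)" by (auto simp: fun_eq_iff split: bool.split)
  ultimately have "indep_vars (\<lambda>_. borel) (case_bool (\<phi> \<circ> A) (\<psi> \<circ> B)) UNIV" by (simp add: indep_var_def)
  from indep_vars_nn_integral[OF finite this] show ?thesis by (simp add: UNIV_bool mult.commute comp_def)
qed

lemma normal_half_density: "normal_density 0 (sqrt (1 / 2)) x = exp (- x\<^sup>2) / sqrt pi"
  by (simp add: normal_density_def)

lemma (in prob_space) normal_half_nn_integral:
  assumes "distributed M lborel X (normal_density 0 (sqrt (1 / 2)))" "\<phi> \<in> borel_measurable borel"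
  shows "(\<integral>\<^sup>+\<omega>. \<phi> (X \<omega>) \<partial>M) = (\<integral>\<^sup>+x. ennreal (exp (- x\<^sup>2) / sqrt pi) * \<phi> x \<partial>lborel)"
  using distributed_nn_integral[OF assms(1), of \<phi>] assms(2) by (simp add: normal_half_density)

text \<open>The factor tilts the density into 1 / sqrt (1 + b) times the normal density of variance
  1 / (2 (1 + b)). Negative \<open>b\<close> matters as well: b = -1/2 gives the exponential moments
  of noise and gains.\<close>

lemma (in prob_space) normal_half_exp_square:
  assumes X: "distributed M lborel X (normal_density 0 (sqrt (1 / 2)))" and b: "b > - 1"
  shows "(\<integral>\<^sup>+\<omega>. ennreal (exp (- b * (X \<omega>)\<^sup>2)) \<partial>M) = ennreal (1 / sqrt (1 + b))"
proof -
  let ?s = "sqrt (1 / (2 * (1 + b)))"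
  have s: "?s > 0" using b by simp
  have eq: "exp (- x\<^sup>2) / sqrt pi * exp (- b * x\<^sup>2) = 1 / sqrt (1 + b) * normal_density 0 ?s x" for x
  proof -
    have s2: "?s\<^sup>2 = 1 / (2 * (1 + b))" using b by simp
    have e: "2 * pi * ?s\<^sup>2 = pi / (1 + b)" "2 * ?s\<^sup>2 = 1 / (1 + b)"
      unfolding s2 using b by (simp_all add: field_simps)
    have "normal_density 0 ?s x = 1 / sqrt (pi / (1 + b)) * exp (- (x\<^sup>2 * (1 + b)))"
      unfolding normal_density_def e by simp
    also have "1 / sqrt (pi / (1 + b)) = sqrt (1 + b) / sqrt pi" using b by (simp add: real_sqrt_divide)
    also have "exp (- (x\<^sup>2 * (1 + b))) = exp (- x\<^sup>2) * exp (- b * x\<^sup>2)"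
      by (simp add: exp_add[symmetric] algebra_simps)
    finally show ?thesis using b by simp
  qed
  have "(\<integral>\<^sup>+\<omega>. ennreal (exp (- b * (X \<omega>)\<^sup>2)) \<partial>M) = (\<integral>\<^sup>+x. ennreal (1 / sqrt (1 + b) * normal_density 0 ?s x) \<partial>lborel)"
  proof (subst normal_half_nn_integral[OF X])
    show "(\<integral>\<^sup>+x. ennreal (exp (- x\<^sup>2) / sqrt pi) * ennreal (exp (- b * x\<^sup>2)) \<partial>lborel) =
        (\<integral>\<^sup>+x. ennreal (1 / sqrt (1 + b) * normal_density 0 ?s x) \<partial>lborel)"
      by (intro nn_integral_cong) (subst eq[symmetric], subst ennreal_mult, auto)
  qed measurable
  also have "\<dots> = (\<integral>\<^sup>+x. ennreal (1 / sqrt (1 + b)) * ennreal (normal_density 0 ?s x) \<partial>lborel)"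
    using b by (intro nn_integral_cong ennreal_mult) auto
  also have "\<dots> = ennreal (1 / sqrt (1 + b)) * (\<integral>\<^sup>+x. ennreal (normal_density 0 ?s x) \<partial>lborel)"
    by (rule nn_integral_cmult) measurable
  also have "(\<integral>\<^sup>+x. ennreal (normal_density 0 ?s x) \<partial>lborel) = ennreal 1"
    using s by (subst nn_integral_eq_integral) auto
  finally show ?thesis by simp
qed

lemma (in prob_space) complex_normal_exp_square:
  assumes Z: "std_complex_normal M Z" and b: "b > - 1"
  shows "(\<integral>\<^sup>+\<omega>. ennreal (exp (- b * (cmod (Z \<omega>))\<^sup>2)) \<partial>M) = ennreal (1 / (1 + b))"
proof -
  have Z': "indep_var borel (\<lambda>\<omega>. Re (Z \<omega>)) borel (\<lambda>\<omega>. Im (Z \<omega>))"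
    "distributed M lborel (\<lambda>\<omega>. Re (Z \<omega>)) (normal_density 0 (sqrt (1 / 2)))"
    "distributed M lborel (\<lambda>\<omega>. Im (Z \<omega>)) (normal_density 0 (sqrt (1 / 2)))"
    using Z by (auto simp: std_complex_normal_def)
  have "(\<integral>\<^sup>+\<omega>. ennreal (exp (- b * (cmod (Z \<omega>))\<^sup>2)) \<partial>M) =
      (\<integral>\<^sup>+\<omega>. ennreal (exp (- b * (Re (Z \<omega>))\<^sup>2)) * ennreal (exp (- b * (Im (Z \<omega>))\<^sup>2)) \<partial>M)"
    by (simp add: ennreal_mult[symmetric] exp_add[symmetric] cmod_power2 algebra_simps)
  also have "\<dots> = (\<integral>\<^sup>+\<omega>. ennreal (exp (- b * (Re (Z \<omega>))\<^sup>2)) \<partial>M) * (\<integral>\<^sup>+\<omega>. ennreal (exp (- b * (Im (Z \<omega>))\<^sup>2)) \<partial>M)"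
    by (rule indep_var_nn_integral_mult[OF Z'(1), of "\<lambda>x. ennreal (exp (- b * x\<^sup>2))" "\<lambda>x. ennreal (exp (- b * x\<^sup>2))"]) measurable
  also have "\<dots> = ennreal (1 / sqrt (1 + b) * (1 / sqrt (1 + b)))"
    unfolding normal_half_exp_square[OF Z'(2) b] normal_half_exp_square[OF Z'(3) b]
    using b by (subst ennreal_mult) auto
  also have "1 / sqrt (1 + b) * (1 / sqrt (1 + b)) = 1 / (1 + b)" using b by simp
  finally show ?thesis .
qed

text \<open>Even with the weight exp (x^2 / 2) the density stays below 1, so the integral is at most
  the length of the interval.\<close>

lemma (in prob_space) normal_half_small_ball:
  assumes X: "distributed M lborel X (normal_density 0 (sqrt (1 / 2)))" and t: "t \<ge> 0"
  shows "(\<integral>\<^sup>+\<omega>. ennreal (exp ((X \<omega>)\<^sup>2 / 2)) * indicator {- t..t} (X \<omega>) \<partial>M) \<le> ennreal (2 * t)"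
proof -
  have le: "exp (- x\<^sup>2) / sqrt pi * exp (x\<^sup>2 / 2) \<le> 1" for x
  proof -
    have "exp (- x\<^sup>2) * exp (x\<^sup>2 / 2) = exp (- (x\<^sup>2 / 2))" by (simp add: exp_add[symmetric])
    also have "\<dots> \<le> 1" by simp
    also have "1 \<le> sqrt pi" using pi_ge_two by simp
    finally show ?thesis by (simp add: divide_le_eq)
  qed
  have "(\<integral>\<^sup>+\<omega>. ennreal (exp ((X \<omega>)\<^sup>2 / 2)) * indicator {- t..t} (X \<omega>) \<partial>M) =
      (\<integral>\<^sup>+x. ennreal (exp (- x\<^sup>2) / sqrt pi) * (ennreal (exp (x\<^sup>2 / 2)) * indicator {- t..t} x) \<partial>lborel)"
    by (rule normal_half_nn_integral[OF X]) measurable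
  also have "\<dots> \<le> (\<integral>\<^sup>+x. indicator {- t..t} x \<partial>lborel)"
    using le by (intro nn_integral_mono) (auto simp: ennreal_mult[symmetric] indicator_def simp del: ennreal_1 simp flip: ennreal_1)
  also have "\<dots> = ennreal (2 * t)" using t by simp
  finally show ?thesis .
qed

text \<open>The disc of squared radius t lies in a square of area 4 t, over which the weight factors
  into real and imaginary part.\<close>

lemma (in prob_space) complex_normal_small_ball:
  assumes Z: "std_complex_normal M Z" and t: "t \<ge> 0"
  shows "(\<integral>\<^sup>+\<omega>. ennreal (exp ((cmod (Z \<omega>))\<^sup>2 / 2)) * indicator {..t} ((cmod (Z \<omega>))\<^sup>2) \<partial>M) \<le> ennreal (4 * t)"
proof -
  have Z': "indep_var borel (\<lambda>\<omega>. Re (Z \<omega>)) borel (\<lambda>\<omega>. Im (Z \<omega>))"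
    "distributed M lborel (\<lambda>\<omega>. Re (Z \<omega>)) (normal_density 0 (sqrt (1 / 2)))"
    "distributed M lborel (\<lambda>\<omega>. Im (Z \<omega>)) (normal_density 0 (sqrt (1 / 2)))"
    using Z by (auto simp: std_complex_normal_def)
  let ?\<phi> = "\<lambda>x. ennreal (exp (x\<^sup>2 / 2)) * indicator {- sqrt t..sqrt t} x"
  have "ennreal (exp ((cmod z)\<^sup>2 / 2)) * indicator {..t} ((cmod z)\<^sup>2) \<le> ?\<phi> (Re z) * ?\<phi> (Im z)" for z
  proof (cases "(cmod z)\<^sup>2 \<le> t")
    case True
    have "(Re z)\<^sup>2 \<le> t" "(Im z)\<^sup>2 \<le> t"
      using True unfolding cmod_power2 by (smt (verit) zero_le_power2)+
    then have "\<bar>Re z\<bar> \<le> sqrt t" "\<bar>Im z\<bar> \<le> sqrt t" by (simp_all add: real_le_rsqrt)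
    then show ?thesis
      by (simp add: abs_le_iff ennreal_mult[symmetric] exp_add[symmetric] cmod_power2 add_divide_distrib minus_le_iff indicator_def)
  qed simp
  then have "(\<integral>\<^sup>+\<omega>. ennreal (exp ((cmod (Z \<omega>))\<^sup>2 / 2)) * indicator {..t} ((cmod (Z \<omega>))\<^sup>2) \<partial>M) \<le>
      (\<integral>\<^sup>+\<omega>. ?\<phi> (Re (Z \<omega>)) * ?\<phi> (Im (Z \<omega>)) \<partial>M)"
    by (intro nn_integral_mono)
  also have "\<dots> = (\<integral>\<^sup>+\<omega>. ?\<phi> (Re (Z \<omega>)) \<partial>M) * (\<integral>\<^sup>+\<omega>. ?\<phi> (Im (Z \<omega>)) \<partial>M)"
    by (rule indep_var_nn_integral_mult[OF Z'(1), of ?\<phi> ?\<phi>]) measurable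
  also have "\<dots> \<le> ennreal (2 * sqrt t) * ennreal (2 * sqrt t)"
    using t by (intro mult_mono normal_half_small_ball Z') auto
  also have "\<dots> = ennreal (4 * t)" using t by (simp add: ennreal_mult[symmetric])
  finally show ?thesis .
qed

text \<open>A step-function majorant turns the integral into small-ball probabilities. The constant
  \<open>c0\<close> is multiplied by the total weight 2, each step by the weight of a disc of
  squared radius \<tau>_k / A.\<close>

lemma (in prob_space) complex_normal_layer_cake:
  assumes Z: "std_complex_normal M Z" and [measurable]: "Z \<in> borel_measurable M" and A: "A > 0"
    and nonneg: "c0 \<ge> 0" "\<And>k. c k \<ge> 0" "\<And>k. \<tau> k \<ge> 0"
    and le: "\<And>u. u \<ge> 0 \<Longrightarrow> \<theta> u \<le> c0 + (\<Sum>k\<le>K. if u \<le> \<tau> k then c k else 0)"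
  shows "(\<integral>\<^sup>+\<omega>. ennreal (exp ((cmod (Z \<omega>))\<^sup>2 / 2) * \<theta> (A * (cmod (Z \<omega>))\<^sup>2)) \<partial>M) \<le>
    ennreal (2 * c0 + (\<Sum>k\<le>K. c k * (4 * (\<tau> k / A))))"
proof -
  let ?w = "\<lambda>\<omega>. exp ((cmod (Z \<omega>))\<^sup>2 / 2)"
  have pt: "ennreal (?w \<omega> * \<theta> (A * (cmod (Z \<omega>))\<^sup>2)) \<le> ennreal c0 * ennreal (?w \<omega>) +
      (\<Sum>k\<le>K. ennreal (c k) * (ennreal (?w \<omega>) * indicator {..\<tau> k / A} ((cmod (Z \<omega>))\<^sup>2)))" for \<omega>
  proof -
    let ?u = "A * (cmod (Z \<omega>))\<^sup>2"
    have "?w \<omega> * \<theta> ?u \<le> ?w \<omega> * (c0 + (\<Sum>k\<le>K. if ?u \<le> \<tau> k then c k else 0))"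
      using A by (intro mult_left_mono le) auto
    also have "\<dots> = c0 * ?w \<omega> + (\<Sum>k\<le>K. c k * (?w \<omega> * indicator {..\<tau> k / A} ((cmod (Z \<omega>))\<^sup>2)))"
    proof -
      have "?w \<omega> * (if ?u \<le> \<tau> k then c k else 0) = c k * (?w \<omega> * indicator {..\<tau> k / A} ((cmod (Z \<omega>))\<^sup>2))" for k
        using A by (auto simp: indicator_def pos_le_divide_eq mult.commute)
      then show ?thesis by (simp only: distrib_left sum_distrib_left mult.commute[of "?w \<omega>" c0])
    qed
    finally have "ennreal (?w \<omega> * \<theta> ?u) \<le> ennreal (c0 * ?w \<omega> + (\<Sum>k\<le>K. c k * (?w \<omega> * indicator {..\<tau> k / A} ((cmod (Z \<omega>))\<^sup>2))))"
      by (rule ennreal_leI)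
    also have "\<dots> = ennreal c0 * ennreal (?w \<omega>) +
      (\<Sum>k\<le>K. ennreal (c k) * (ennreal (?w \<omega>) * indicator {..\<tau> k / A} ((cmod (Z \<omega>))\<^sup>2)))"
    proof -
      define x where "x k = c k * (?w \<omega> * indicator {..\<tau> k / A} ((cmod (Z \<omega>))\<^sup>2))" for k
      have x0: "x k \<ge> 0" for k using nonneg by (simp add: x_def)
      have "ennreal (x k) = ennreal (c k) * (ennreal (?w \<omega>) * indicator {..\<tau> k / A} ((cmod (Z \<omega>))\<^sup>2))" for k
        unfolding x_def using nonneg by (subst ennreal_mult; simp add: ennreal_mult ennreal_indicator)
      moreover have "ennreal (c0 * ?w \<omega> + (\<Sum>k\<le>K. x k)) = ennreal (c0 * ?w \<omega>) + (\<Sum>k\<le>K. ennreal (x k))"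
        using nonneg x0 by (subst ennreal_plus; simp add: sum_nonneg sum_ennreal)
      moreover have "ennreal (c0 * ?w \<omega>) = ennreal c0 * ennreal (?w \<omega>)"
        using nonneg by (intro ennreal_mult) auto
      ultimately show ?thesis by (simp only: x_def)
    qed
    finally show ?thesis .
  qed
  have w2: "(\<integral>\<^sup>+\<omega>. ennreal (?w \<omega>) \<partial>M) = ennreal 2"
    using complex_normal_exp_square[OF Z, of "- 1 / 2"] by simp
  have "(\<integral>\<^sup>+\<omega>. ennreal (?w \<omega> * \<theta> (A * (cmod (Z \<omega>))\<^sup>2)) \<partial>M) \<le>
      (\<integral>\<^sup>+\<omega>. ennreal c0 * ennreal (?w \<omega>) +
      (\<Sum>k\<le>K. ennreal (c k) * (ennreal (?w \<omega>) * indicator {..\<tau> k / A} ((cmod (Z \<omega>))\<^sup>2))) \<partial>M)"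
    by (intro nn_integral_mono pt)
  also have "\<dots> = ennreal c0 * ennreal 2 +
      (\<Sum>k\<le>K. ennreal (c k) * (\<integral>\<^sup>+\<omega>. ennreal (?w \<omega>) * indicator {..\<tau> k / A} ((cmod (Z \<omega>))\<^sup>2) \<partial>M))"
    by (subst nn_integral_add) (auto simp: nn_integral_cmult nn_integral_sum w2)
  also have "\<dots> \<le> ennreal c0 * ennreal 2 + (\<Sum>k\<le>K. ennreal (c k) * ennreal (4 * (\<tau> k / A)))"
    using A nonneg by (intro add_left_mono sum_mono mult_left_mono complex_normal_small_ball Z) auto
  also have "\<dots> = ennreal (2 * c0 + (\<Sum>k\<le>K. c k * (4 * (\<tau> k / A))))"
  proof -
    have "ennreal c0 * ennreal 2 = ennreal (2 * c0)"
      using nonneg(1) by (simp add: ennreal_mult' mult.commute)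
    moreover have "ennreal (c k) * ennreal (4 * (\<tau> k / A)) = ennreal (c k * (4 * (\<tau> k / A)))" for k
      using nonneg A by (intro ennreal_mult[symmetric]) auto
    moreover have "(\<Sum>k\<le>K. ennreal (c k * (4 * (\<tau> k / A)))) = ennreal (\<Sum>k\<le>K. c k * (4 * (\<tau> k / A)))"
      using nonneg A by (intro sum_ennreal) auto
    moreover have "ennreal (2 * c0) + ennreal (\<Sum>k\<le>K. c k * (4 * (\<tau> k / A))) = ennreal (2 * c0 + (\<Sum>k\<le>K. c k * (4 * (\<tau> k / A))))"
      using nonneg A by (intro ennreal_plus[symmetric] sum_nonneg) auto
    ultimately show ?thesis by simp
  qed
  finally show ?thesis .
qed

lemma dyadic_threshold:
  fixes u :: real
  assumes "b > 1"
  shows "u \<le> 1 \<or> u > b ^ K \<or> (\<exists>k<K. b ^ k < u \<and> u \<le> b ^ Suc k)"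
proof (induction K)
  case (Suc K)
  then show ?case by (metis less_Suc_eq not_le)
qed auto

text \<open>Between b^k and b^(k+1) the value is at most 2^(-k), which is exactly the height of step
  k + 1; the numerator 2 makes up for this shift. Below 1 step 0 of height 2 suffices, and above b^K
  the constant does. The base is 2 for 1 / (1 + u) and 4 for its square root.\<close>

lemma dyadic_layer_bound:
  fixes u v :: real
  assumes b: "b > 1" and le: "v \<le> 2" "\<And>k. b ^ k < u \<Longrightarrow> v \<le> 1 / 2 ^ k"
  shows "v \<le> 1 / 2 ^ K + (\<Sum>k\<le>K. if u \<le> b ^ k then 2 / 2 ^ k else 0)"
proof -
  let ?f = "\<lambda>k. if u \<le> b ^ k then 2 / 2 ^ k else (0::real)"
  have single: "?f k \<le> (\<Sum>k\<le>K. ?f k)" if "k \<le> K" for k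
    using that by (intro member_le_sum[of k "{..K}" ?f]) auto
  have s0: "0 \<le> (\<Sum>k\<le>K. ?f k)" by (intro sum_nonneg) auto
  consider "u \<le> 1" | "u > b ^ K" | k where "k < K" "b ^ k < u" "u \<le> b ^ Suc k"
    using dyadic_threshold[OF b, of u K] by auto
  then show ?thesis
  proof cases
    case 1
    have "v \<le> (\<Sum>k\<le>K. ?f k)" using le(1) single[of 0] 1 by simp
    then show ?thesis by (rule order_trans) simp
  next
    case 2
    then show ?thesis using le(2)[of K] s0 by linarith
  next
    case 3
    have "v \<le> 1 / 2 ^ k" by (rule le(2)[OF 3(2)])
    also have "\<dots> = ?f (Suc k)" using 3(3) by simp
    also have "\<dots> \<le> (\<Sum>k\<le>K. ?f k)" using single[of "Suc k"] 3(1) by simp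
    finally show ?thesis by (rule order_trans) simp
  qed
qed

lemma inverse_dyadic_bound:
  fixes u :: real
  assumes u: "u \<ge> 0"
  shows "1 / (1 + u) \<le> 1 / 2 ^ K + (\<Sum>k\<le>K. if u \<le> 2 ^ k then 2 / 2 ^ k else 0)"
proof (rule dyadic_layer_bound)
  show "1 / (1 + u) \<le> 2" using u by (simp add: divide_le_eq)
  show "1 / (1 + u) \<le> 1 / 2 ^ k" if "2 ^ k < u" for k
    using that u by (intro divide_left_mono mult_pos_pos) auto
qed simp

lemma inverse_sqrt_dyadic_bound:
  fixes u :: real
  assumes u: "u \<ge> 0"
  shows "1 / sqrt (1 + u) \<le> 1 / 2 ^ K + (\<Sum>k\<le>K. if u \<le> 4 ^ k then 2 / 2 ^ k else 0)"
proof (rule dyadic_layer_bound)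
  have "1 \<le> sqrt (1 + u)" using u by simp
  then have "1 / sqrt (1 + u) \<le> 1" by (simp add: divide_le_eq)
  then show "1 / sqrt (1 + u) \<le> 2" by linarith
  show "1 / sqrt (1 + u) \<le> 1 / 2 ^ k" if "4 ^ k < u" for k
  proof -
    have "(2 ^ k)\<^sup>2 = (4 ^ k :: real)" by (simp add: power2_eq_square power_mult_distrib[symmetric])
    then have "2 ^ k \<le> sqrt (1 + u)" using that by (intro real_le_rsqrt) simp
    then show ?thesis using u by (intro divide_left_mono mult_pos_pos) auto
  qed
qed simp

lemma power_of_two_above:
  fixes r :: real
  assumes "r \<ge> 1"
  obtains K where "r \<le> 2 ^ K" "2 ^ K \<le> 2 * r"
proof -
  have ex: "\<exists>K. r \<le> 2 ^ K" using real_arch_pow[of 2 r] by (auto intro: less_imp_le)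
  define K where "K = (LEAST K. r \<le> 2 ^ K)"
  have K: "r \<le> 2 ^ K" unfolding K_def using ex by (rule LeastI_ex)
  have "2 ^ K \<le> 2 * r"
  proof (cases K)
    case 0
    then show ?thesis using assms by simp
  next
    case (Suc k)
    then have "\<not> r \<le> 2 ^ k" using not_less_Least[of k "\<lambda>K. r \<le> 2 ^ K"] by (simp add: K_def)
    then show ?thesis using Suc by simp
  qed
  with K show thesis using that by blast
qed

text \<open>Heights and areas cancel, so each of the K + 1 layers contributes 8 / A. Since K is
  about log A to base 2, the logarithm arises here; K - 1 \<le> 2 ln A turns 2 + 8 (K + 1) into 18 +
  16 ln A.\<close>

lemma (in prob_space) complex_normal_inverse:
  assumes Z: "std_complex_normal M Z" "Z \<in> borel_measurable M" and A: "A \<ge> 1"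
  shows "(\<integral>\<^sup>+\<omega>. ennreal (exp ((cmod (Z \<omega>))\<^sup>2 / 2) * (1 / (1 + A * (cmod (Z \<omega>))\<^sup>2))) \<partial>M) \<le>
    ennreal ((18 + 16 * ln A) / A)"
proof -
  obtain K where K: "A \<le> 2 ^ K" "2 ^ K \<le> 2 * A" using power_of_two_above[OF A] .
  have "(\<integral>\<^sup>+\<omega>. ennreal (exp ((cmod (Z \<omega>))\<^sup>2 / 2) * (\<lambda>u. 1 / (1 + u)) (A * (cmod (Z \<omega>))\<^sup>2)) \<partial>M) \<le>
      ennreal (2 * (1 / 2 ^ K) + (\<Sum>k\<le>K. 2 / 2 ^ k * (4 * (2 ^ k / A))))"
    using A by (intro complex_normal_layer_cake Z inverse_dyadic_bound) auto
  also have "\<dots> \<le> ennreal ((18 + 16 * ln A) / A)"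
  proof (rule ennreal_leI)
    have "ln (2 ^ K) \<le> ln (2 * A)" using K(2) A by simp
    then have 1: "real K * ln 2 \<le> ln 2 + ln A" using A by (simp add: ln_realpow ln_mult)
    have 2: "ln 2 \<ge> (1 / 2 :: real)" using ln2_ge_two_thirds by linarith
    have "real K - 1 \<le> 2 * ln A"
    proof (cases "real K \<ge> 1")
      case True
      then have "(real K - 1) * (1 / 2) \<le> (real K - 1) * ln 2" using 2 by (intro mult_left_mono) auto
      also have "\<dots> = real K * ln 2 - ln 2" by (simp add: left_diff_distrib)
      also have "\<dots> \<le> ln A" using 1 by simp
      finally show ?thesis by simp
    next
      case False
      moreover have "ln A \<ge> 0" using A by simp
      ultimately show ?thesis by linarith
    qed
    moreover have "2 * (1 / 2 ^ K) \<le> 2 / A" using K(1) A by (simp add: frac_le)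
    moreover have "(\<Sum>k\<le>K. 2 / 2 ^ k * (4 * (2 ^ k / A))) = 8 * (real K + 1) / A" by simp
    moreover have "(2 + 8 * (real K + 1)) / A = 2 / A + 8 * (real K + 1) / A" by (rule add_divide_distrib)
    ultimately have "2 * (1 / 2 ^ K) + (\<Sum>k\<le>K. 2 / 2 ^ k * (4 * (2 ^ k / A))) \<le> (2 + 8 * (real K + 1)) / A"
      by linarith
    also have "\<dots> \<le> (18 + 16 * ln A) / A"
      using \<open>real K - 1 \<le> 2 * ln A\<close> A by (intro divide_right_mono) auto
    finally show "2 * (1 / 2 ^ K) + (\<Sum>k\<le>K. 2 / 2 ^ k * (4 * (2 ^ k / A))) \<le> (18 + 16 * ln A) / A" .
  qed
  finally show ?thesis by simp
qed

text \<open>Layer k contributes 8 2^k / A. The sum is geometric and dominated by its last term, of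
  order 2^K / A and hence 1 / sqrt A.\<close>

lemma (in prob_space) complex_normal_inverse_sqrt:
  assumes Z: "std_complex_normal M Z" "Z \<in> borel_measurable M" and A: "A \<ge> 1"
  shows "(\<integral>\<^sup>+\<omega>. ennreal (exp ((cmod (Z \<omega>))\<^sup>2 / 2) * (1 / sqrt (1 + A * (cmod (Z \<omega>))\<^sup>2))) \<partial>M) \<le>
    ennreal (34 / sqrt A)"
proof -
  have rA: "sqrt A \<ge> 1" using A by simp
  obtain K where K: "sqrt A \<le> 2 ^ K" "2 ^ K \<le> 2 * sqrt A" using power_of_two_above[OF rA] .
  have "(\<integral>\<^sup>+\<omega>. ennreal (exp ((cmod (Z \<omega>))\<^sup>2 / 2) * (\<lambda>u. 1 / sqrt (1 + u)) (A * (cmod (Z \<omega>))\<^sup>2)) \<partial>M) \<le>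
      ennreal (2 * (1 / 2 ^ K) + (\<Sum>k\<le>K. 2 / 2 ^ k * (4 * (4 ^ k / A))))"
    using A by (intro complex_normal_layer_cake Z inverse_sqrt_dyadic_bound) auto
  also have "\<dots> \<le> ennreal (34 / sqrt A)"
  proof (rule ennreal_leI)
    have geo: "(\<Sum>k\<le>K. (2::real) ^ k) = 2 * 2 ^ K - 1"
      by (induction K) auto
    have "(\<Sum>k\<le>K. 2 / 2 ^ k * (4 * (4 ^ k / A))) = 8 / A * (\<Sum>k\<le>K. 2 ^ k)"
      unfolding sum_distrib_left
    proof (rule sum.cong[OF refl])
      fix k
      have "(4::real) ^ k = 2 ^ k * 2 ^ k" by (simp add: power_mult_distrib[symmetric])
      then show "2 / 2 ^ k * (4 * (4 ^ k / A)) = 8 / A * 2 ^ k" by simp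
    qed
    also have "\<dots> \<le> 8 / A * (4 * sqrt A)"
      unfolding geo using K(2) A by (intro mult_left_mono) auto
    also have "\<dots> = 32 / sqrt A"
      using A by (simp add: field_simps)
    finally have "(\<Sum>k\<le>K. 2 / 2 ^ k * (4 * (4 ^ k / A))) \<le> 32 / sqrt A" .
    moreover have "2 * (1 / 2 ^ K) \<le> 2 / sqrt A" using K(1) rA by (simp add: frac_le)
    ultimately show "2 * (1 / 2 ^ K) + (\<Sum>k\<le>K. 2 / 2 ^ k * (4 * (4 ^ k / A))) \<le> 34 / sqrt A"
      by (simp add: add_divide_distrib[symmetric])
  qed
  finally show ?thesis by simp
qed

section \<open>Probability of the error event\<close>

definition src_index :: "dstbc \<Rightarrow> rv_index set" where
  "src_index c = Gain_f ` {..<relays c}"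

definition gain_index :: "dstbc \<Rightarrow> rv_index set" where
  "gain_index c = (\<lambda>(j, l). Gain_g j l) ` ({..<relays c} \<times> {..<ants c})"

definition gain_factor :: "dstbc \<Rightarrow> real \<Rightarrow> nat \<Rightarrow> real \<Rightarrow> real" where
  "gain_factor c A l u = (if ants c = 1 then 1 / (1 + A * u)
     else if l < 2 then 1 / sqrt (1 + 2 * A * u) else 1)"

text \<open>Bounds the expectation of \<open>gain_factor\<close> under the weight exp (|z|^2 / 2).
  The 2 is the total weight, for antennas that carry no decay.\<close>

definition gain_bound :: "dstbc \<Rightarrow> real \<Rightarrow> nat \<Rightarrow> real" where
  "gain_bound c A l = (if ants c = 1 then (18 + 16 * ln A) / A
     else if l < 2 then 34 / sqrt A else 2)"

lemma prod_gain_index: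
  fixes h :: "rv_index \<Rightarrow> 'b::comm_monoid_mult"
  shows "(\<Prod>s\<in>gain_index c. h s) = (\<Prod>j<relays c. \<Prod>l<ants c. h (Gain_g j l))"
proof -
  have "(\<Prod>s\<in>gain_index c. h s) = (\<Prod>(j, l)\<in>{..<relays c} \<times> {..<ants c}. h (Gain_g j l))"
    unfolding gain_index_def by (subst prod.reindex) (auto simp: inj_on_def comp_def intro!: prod.cong)
  then show ?thesis by (simp add: prod.cartesian_product)
qed

lemma gain_factor_nonneg: "A \<ge> 0 \<Longrightarrow> u \<ge> 0 \<Longrightarrow> gain_factor c A l u \<ge> 0"
  by (simp add: gain_factor_def)

text \<open>For at least two antennas the two-term AM-GM inequality distributes the decay \<open>1 / A\<close>
  evenly over two of the gains, so that each factor is integrable against the Gaussian density.\<close>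

lemma inverse_le_prod_gain_factor:
  assumes A: "A \<ge> 0" and u: "\<And>l. u l \<ge> (0::real)" and D: "ants c \<ge> 1"
  shows "1 / (1 + A * (\<Sum>l<ants c. u l)) \<le> (\<Prod>l<ants c. gain_factor c A l (u l))"
proof (cases "ants c = 1")
  case True
  then show ?thesis by (simp add: gain_factor_def)
next
  case False
  define m where "m = ants c - 2"
  have m: "ants c = Suc (Suc m)" using False D unfolding m_def by arith
  define x y where "x = 1 + 2 * A * u 0" and "y = 1 + 2 * A * u 1"
  have xy: "x \<ge> 1" "y \<ge> 1" using A u by (simp_all add: x_def y_def)
  have "(\<Prod>l<ants c. gain_factor c A l (u l)) = gain_factor c A 0 (u 0) * (gain_factor c A 1 (u 1) *
      (\<Prod>l<m. gain_factor c A (Suc (Suc l)) (u (Suc (Suc l)))))"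
    unfolding m by (simp only: prod.lessThan_Suc_shift One_nat_def)
  also have "\<dots> = 1 / sqrt x * (1 / sqrt y)"
    using False by (simp add: gain_factor_def x_def y_def)
  finally have prod_eq: "(\<Prod>l<ants c. gain_factor c A l (u l)) = 1 / sqrt (x * y)" by (simp add: real_sqrt_mult)
  have "sqrt (x * y) \<le> (x + y) / 2" using xy by (intro arith_geo_mean_sqrt) auto
  also have "\<dots> = 1 + A * (u 0 + u 1)" by (simp add: x_def y_def algebra_simps)
  also have "\<dots> \<le> 1 + A * (\<Sum>l<ants c. u l)"
  proof -
    have "(\<Sum>l<ants c. u l) = u 0 + (u 1 + (\<Sum>l<m. u (Suc (Suc l))))"
      unfolding m by (simp only: sum.lessThan_Suc_shift One_nat_def)
    moreover have "(\<Sum>l<m. u (Suc (Suc l))) \<ge> 0" using u by (intro sum_nonneg) auto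
    ultimately show ?thesis using A by (intro add_left_mono mult_left_mono) auto
  qed
  finally have le: "sqrt (x * y) \<le> 1 + A * (\<Sum>l<ants c. u l)" .
  have "0 < x * y" using xy by (intro mult_pos_pos) auto
  then have pos: "0 < sqrt (x * y)" by simp
  have "0 < 1 + A * (\<Sum>l<ants c. u l)" using le pos by linarith
  from divide_left_mono[OF le zero_le_one mult_pos_pos[OF this pos]]
  show ?thesis unfolding prod_eq .
qed

text \<open>With t = (1 + S) / (2 m), t \<le> exp t is raised to the power m, where m t = 1/2 + S/2.
  The polynomial growth in the gains is thus paid with half of the Gaussian exponent.\<close>

lemma power_le_exp_half:
  fixes S :: real
  assumes "S \<ge> 0" "m > 0"
  shows "(1 + S) ^ m \<le> (2 * real m) ^ m * exp (1 / 2) * exp (S / 2)"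
proof -
  define t where "t = (1 + S) / (2 * real m)"
  have t: "t \<ge> 0" using assms by (simp add: t_def)
  have te: "t \<le> exp t" using exp_ge_add_one_self[of t] by linarith
  have "(1 + S) ^ m = (2 * real m) ^ m * t ^ m" using assms by (simp add: t_def power_divide)
  also have "\<dots> \<le> (2 * real m) ^ m * exp t ^ m" using t te by (intro mult_left_mono power_mono) auto
  also have "exp t ^ m = exp (1 / 2) * exp (S / 2)"
  proof -
    have "real m * t = 1 / 2 + S / 2" using assms by (simp add: t_def field_simps)
    then show ?thesis by (simp only: exp_of_nat_mult[symmetric] exp_add)
  qed
  finally show ?thesis by (simp add: mult.assoc)
qed

lemma (in prob_space) expectation_gain_factor:
  assumes Z: "std_complex_normal M Z" "Z \<in> borel_measurable M" and A: "A \<ge> 1"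
  shows "(\<integral>\<^sup>+\<omega>. ennreal (exp ((cmod (Z \<omega>))\<^sup>2 / 2) * gain_factor c A l ((cmod (Z \<omega>))\<^sup>2)) \<partial>M) \<le> ennreal (gain_bound c A l)"
proof -
  have 2: "(\<integral>\<^sup>+\<omega>. ennreal (exp ((cmod (Z \<omega>))\<^sup>2 / 2)) \<partial>M) \<le> ennreal 2"
    using complex_normal_exp_square[OF Z(1), of "- 1 / 2"] by simp
  have "34 / sqrt (2 * A) \<le> 34 / sqrt A" using A by (intro divide_left_mono mult_pos_pos) auto
  then have "(\<integral>\<^sup>+\<omega>. ennreal (exp ((cmod (Z \<omega>))\<^sup>2 / 2) * (1 / sqrt (1 + 2 * A * (cmod (Z \<omega>))\<^sup>2))) \<partial>M) \<le> ennreal (34 / sqrt A)"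
    using A by (intro order_trans[OF complex_normal_inverse_sqrt[OF Z, of "2 * A"]] ennreal_leI) auto
  then show ?thesis using 2 complex_normal_inverse[OF Z A]
    by (auto simp: gain_factor_def gain_bound_def)
qed

lemma measurable_gain_factor [measurable]: "gain_factor c A l \<in> borel_measurable borel"
  unfolding gain_factor_def[abs_def] by measurable

text \<open>Conditionally on noise and relay-destination gains the f_j are independent, and each
  integrates to 1 / (1 + b_j). What is left is dominated by a product of functions of single
  variables, whose expectations multiply.\<close>

lemma chernoff_expectation:
  assumes c: "valid_dstbc c" and net: "network_model M c Z info" and A: "A \<ge> 1"
  defines "N \<equiv> relays c"
  shows "(\<integral>\<^sup>+\<omega>. ennreal (exp (noise_energy c (\<lambda>s. Z s \<omega>) / 2) *
      (\<Prod>j<N. exp (- (A * (\<Sum>l<ants c. (cmod (Z (Gain_g j l) \<omega>))\<^sup>2) / (1 + gain_energy c (gains_g Z \<omega>))\<^sup>2)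
        * (cmod (Z (Gain_f j) \<omega>))\<^sup>2))) \<partial>M) \<le>
    ennreal ((4 * real N) ^ (2 * N) * exp (1 / 2) * (2 ^ card (noise_index c) * (\<Prod>j<N. \<Prod>l<ants c. gain_bound c A l)))"
proof -
  interpret prob_space M using net by (simp add: network_model_def)
  have "relays c \<ge> 1" and D: "ants c \<ge> 1" using c unfolding valid_dstbc_def by blast+
  then have N: "N > 0" by (simp add: N_def)
  have indep: "indep_vars (\<lambda>_. borel) Z (rv_indices c)"
    and normal: "\<And>s. s \<in> rv_indices c \<Longrightarrow> std_complex_normal M (Z s)"
    using net unfolding network_model_def by blast+
  have meas: "Z s \<in> borel_measurable M" if "s \<in> rv_indices c" for s
    using indep that unfolding indep_vars_def by blast
  let ?J = "noise_index c \<union> gain_index c"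
  have sub: "src_index c \<subseteq> rv_indices c" "?J \<subseteq> rv_indices c" "src_index c \<inter> ?J = {}"
    by (auto simp: src_index_def gain_index_def noise_index_def rv_indices_def)
  have fin: "finite (gain_index c)" "finite ?J" by (simp_all add: gain_index_def)
  have disj: "noise_index c \<inter> gain_index c = {}" by (auto simp: noise_index_def gain_index_def)
  define K where "K = (4 * real N) ^ (2 * N) * exp (1 / 2)"
  have K: "K \<ge> 0" by (simp add: K_def)
  define S where "S y = gain_energy c (\<lambda>j l. y (Gain_g j l))" for y :: "rv_index \<Rightarrow> complex"
  define G where "G y j = (\<Sum>l<ants c. (cmod (y (Gain_g j l)))\<^sup>2)" for y :: "rv_index \<Rightarrow> complex" and j
  define b where "b y j = A * G y j / (1 + S y)\<^sup>2" for y :: "rv_index \<Rightarrow> complex" and j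
  define H where "H x y = ennreal (exp (noise_energy c y / 2) * (\<Prod>j<N. exp (- b y j * (cmod (x (Gain_f j)))\<^sup>2)))"
    for x y :: "rv_index \<Rightarrow> complex"
  define \<theta> where "\<theta> s = (case s of Gain_g j l \<Rightarrow> gain_factor c A l | _ \<Rightarrow> (\<lambda>_. 1))" for s
  \<comment> \<open>The exponential is the Chernoff weight if \<open>s\<close> is a noise entry, and
    the price of the polynomial factor if \<open>s\<close> is a gain.\<close>
  define \<Psi> where "\<Psi> s z = exp ((cmod z)\<^sup>2 / 2) * \<theta> s ((cmod z)\<^sup>2)" for s and z :: complex
  define k where "k y = ennreal K * (\<Prod>s\<in>?J. ennreal (\<Psi> s (y s)))" for y :: "rv_index \<Rightarrow> complex"
  have S0: "S y \<ge> 0" for y by (simp add: S_def gain_energy_nonneg)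
  have G0: "G y j \<ge> 0" for y j by (auto simp: G_def intro!: sum_nonneg)
  have b0: "b y j \<ge> 0" for y j using A G0 by (simp add: b_def)
  have \<theta>0: "\<theta> s u \<ge> 0" if "u \<ge> 0" for s u
    using A that by (cases s) (auto simp: \<theta>_def gain_factor_nonneg)
  have \<Psi>0: "\<Psi> s z \<ge> 0" for s z by (simp add: \<Psi>_def \<theta>0)
  have \<theta>_meas: "\<theta> s \<in> borel_measurable borel" for s by (cases s) (auto simp: \<theta>_def)
  have \<Psi>_meas: "\<Psi> s \<in> borel_measurable borel" for s
    unfolding \<Psi>_def[abs_def] using measurable_compose[OF _ \<theta>_meas] by measurable

  have "(\<integral>\<^sup>+\<omega>. H (restrict (\<lambda>s. Z s \<omega>) (src_index c)) (restrict (\<lambda>s. Z s \<omega>) ?J) \<partial>M) \<le>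
      (\<integral>\<^sup>+\<omega>. k (restrict (\<lambda>s. Z s \<omega>) ?J) \<partial>M)"
  proof (rule indep_var_nn_integral_le[OF indep_var_restrict[OF indep sub(3,1,2)]])
    let ?P = "PiM (src_index c) (\<lambda>_. borel) \<Otimes>\<^sub>M PiM ?J (\<lambda>_. borel) :: ((rv_index \<Rightarrow> complex) \<times> (rv_index \<Rightarrow> complex)) measure"
    have comp: "(\<lambda>p. snd p s) \<in> borel_measurable ?P" if "s \<in> ?J" for s
      by (rule measurable_compose[OF measurable_snd measurable_component_singleton[OF that]])
    have comp1: "(\<lambda>p. fst p (Gain_f j)) \<in> borel_measurable ?P" if "j < N" for j
      by (rule measurable_compose[OF measurable_fst measurable_component_singleton])
         (use that in \<open>simp add: src_index_def N_def\<close>)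
    have cs: "(\<lambda>p. (cmod (snd p s))\<^sup>2) \<in> borel_measurable ?P" if "s \<in> ?J" for s
      by (rule measurable_compose[OF comp[OF that]]) measurable
    have cs1: "(\<lambda>p. (cmod (fst p (Gain_f j)))\<^sup>2) \<in> borel_measurable ?P" if "j < N" for j
      by (rule measurable_compose[OF comp1[OF that]]) measurable
    have V_meas: "(\<lambda>p. noise_energy c (snd p)) \<in> borel_measurable ?P"
      unfolding noise_energy_def by (intro borel_measurable_sum cs) simp
    have S_meas: "(\<lambda>p. S (snd p)) \<in> borel_measurable ?P"
      unfolding S_def gain_energy_def by (intro borel_measurable_sum cs) (auto simp: gain_index_def)
    have G_meas: "(\<lambda>p. G (snd p) j) \<in> borel_measurable ?P" if "j < N" for j
      unfolding G_def by (intro borel_measurable_sum cs) (use that in \<open>auto simp: gain_index_def N_def\<close>)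
    have "(\<lambda>p. exp (noise_energy c (snd p) / 2) * (\<Prod>j<N. exp (- b (snd p) j * (cmod (fst p (Gain_f j)))\<^sup>2))) \<in> borel_measurable ?P"
      unfolding b_def
      by (intro borel_measurable_times borel_measurable_prod measurable_compose[OF _ borel_measurable_exp]
          borel_measurable_divide borel_measurable_uminus borel_measurable_power borel_measurable_add
          borel_measurable_const V_meas S_meas G_meas cs1) auto
    then show "(\<lambda>(x, y). H x y) \<in> borel_measurable ?P"
      unfolding H_def split_def by (rule measurable_compose[OF _ measurable_ennreal])
    have "(\<lambda>y. ennreal (\<Psi> s (y s))) \<in> borel_measurable (PiM ?J (\<lambda>_. borel))" if "s \<in> ?J" for s
      by (rule measurable_compose[OF measurable_component_singleton[OF that]])
         (rule measurable_compose[OF \<Psi>_meas measurable_ennreal])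
    then show "k \<in> borel_measurable (PiM ?J (\<lambda>_. borel))"
      unfolding k_def[abs_def] by (intro borel_measurable_times_ennreal borel_measurable_const borel_measurable_prod_ennreal)
  next
    fix y :: "rv_index \<Rightarrow> complex"
    \<comment> \<open>The rates are indexed by all random variables, with default 0, so that the
      independence lemmas for \<open>src_index\<close> apply.\<close>
    define bs where "bs s = (case s of Gain_f j \<Rightarrow> b y j | _ \<Rightarrow> 0)" for s
    have ind: "indep_vars (\<lambda>_. borel) (\<lambda>s \<omega>. ennreal (exp (- bs s * (cmod (Z s \<omega>))\<^sup>2))) (src_index c)"
      by (rule indep_vars_compose2[OF indep_vars_subset[OF indep sub(1)]]) measurable
    have reidx: "(\<Prod>j<N. h (Gain_f j)) = (\<Prod>s\<in>src_index c. h s)" for h :: "rv_index \<Rightarrow> ennreal"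
      unfolding src_index_def N_def by (subst prod.reindex) (auto simp: inj_on_def)
    have Hint: "(\<integral>\<^sup>+\<omega>. H (restrict (\<lambda>s. Z s \<omega>) (src_index c)) y \<partial>M) =
        (\<integral>\<^sup>+\<omega>. ennreal (exp (noise_energy c y / 2)) * (\<Prod>s\<in>src_index c. ennreal (exp (- bs s * (cmod (Z s \<omega>))\<^sup>2))) \<partial>M)"
    proof (rule nn_integral_cong)
      fix \<omega>
      have "(\<Prod>j<N. exp (- b y j * (cmod (restrict (\<lambda>s. Z s \<omega>) (src_index c) (Gain_f j)))\<^sup>2)) =
          (\<Prod>j<N. exp (- bs (Gain_f j) * (cmod (Z (Gain_f j) \<omega>))\<^sup>2))"
        by (intro prod.cong refl) (simp add: src_index_def N_def bs_def)
      then have "H (restrict (\<lambda>s. Z s \<omega>) (src_index c)) y = ennreal (exp (noise_energy c y / 2)) *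
          ennreal (\<Prod>j<N. exp (- bs (Gain_f j) * (cmod (Z (Gain_f j) \<omega>))\<^sup>2))"
        unfolding H_def by (simp only:) (intro ennreal_mult, auto intro!: prod_nonneg)
      also have "ennreal (\<Prod>j<N. exp (- bs (Gain_f j) * (cmod (Z (Gain_f j) \<omega>))\<^sup>2)) =
          (\<Prod>j<N. ennreal (exp (- bs (Gain_f j) * (cmod (Z (Gain_f j) \<omega>))\<^sup>2)))"
        by (rule prod_ennreal[symmetric]) simp
      finally show "H (restrict (\<lambda>s. Z s \<omega>) (src_index c)) y = ennreal (exp (noise_energy c y / 2)) *
          (\<Prod>s\<in>src_index c. ennreal (exp (- bs s * (cmod (Z s \<omega>))\<^sup>2)))"
        using reidx[of "\<lambda>s. ennreal (exp (- bs s * (cmod (Z s \<omega>))\<^sup>2))"] by (simp only:)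
    qed
    also have "\<dots> = ennreal (exp (noise_energy c y / 2)) *
        (\<integral>\<^sup>+\<omega>. (\<Prod>s\<in>src_index c. ennreal (exp (- bs s * (cmod (Z s \<omega>))\<^sup>2))) \<partial>M)"
      by (rule nn_integral_cmult, rule borel_measurable_prod_ennreal) (use ind in \<open>simp add: indep_vars_def\<close>)
    also have "(\<integral>\<^sup>+\<omega>. (\<Prod>s\<in>src_index c. ennreal (exp (- bs s * (cmod (Z s \<omega>))\<^sup>2))) \<partial>M) =
        (\<Prod>s\<in>src_index c. \<integral>\<^sup>+\<omega>. ennreal (exp (- bs s * (cmod (Z s \<omega>))\<^sup>2)) \<partial>M)"
      by (rule indep_vars_nn_integral[OF _ ind]) (simp_all add: src_index_def)
    also have "\<dots> = (\<Prod>s\<in>src_index c. ennreal (1 / (1 + bs s)))"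
    proof (rule prod.cong[OF refl])
      fix s assume s: "s \<in> src_index c"
      have "bs s \<ge> 0" using b0 by (cases s) (auto simp: bs_def)
      then have "bs s > - 1" by linarith
      then show "(\<integral>\<^sup>+\<omega>. ennreal (exp (- bs s * (cmod (Z s \<omega>))\<^sup>2)) \<partial>M) = ennreal (1 / (1 + bs s))"
        using normal sub(1) s by (intro complex_normal_exp_square) auto
    qed
    also have "\<dots> = (\<Prod>j<N. ennreal (1 / (1 + b y j)))"
      unfolding reidx[symmetric] by (simp add: bs_def)
    also have "\<dots> = ennreal (\<Prod>j<N. 1 / (1 + b y j))"
      using b0 by (intro prod_ennreal) auto
    also have "ennreal (exp (noise_energy c y / 2)) * \<dots> = ennreal (exp (noise_energy c y / 2) * (\<Prod>j<N. 1 / (1 + b y j)))"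
      using b0 by (intro ennreal_mult[symmetric] prod_nonneg) auto
    also have "\<dots> \<le> ennreal (K * (\<Prod>s\<in>?J. \<Psi> s (y s)))"
    proof (rule ennreal_leI)
      \<comment> \<open>The decoupling step: (1 + S)^2 \<ge> 1 allows pulling it out of the
        denominators. Over the N relays it accumulates to the power 2 N.\<close>
      have "(\<Prod>j<N. 1 / (1 + b y j)) \<le> (\<Prod>j<N. (1 + S y)\<^sup>2 * (1 / (1 + A * G y j)))"
      proof (rule prod_mono, intro conjI)
        fix j
        show "0 \<le> 1 / (1 + b y j)" using b0 by simp
        have q: "(1 + S y)\<^sup>2 \<ge> 1" using S0[of y] by (simp add: one_le_power)
        have AG: "A * G y j \<ge> 0" using A G0 by simp
        have "(1 + S y)\<^sup>2 * b y j = A * G y j" using q by (auto simp: b_def)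
        then have le: "1 + A * G y j \<le> (1 + S y)\<^sup>2 * (1 + b y j)" using q by (simp only: distrib_left)
        have pos: "0 < 1 + A * G y j" "0 < 1 + b y j" using AG b0[of y j] by linarith+
        have "1 \<le> (1 + S y)\<^sup>2 * (1 + b y j) / (1 + A * G y j)"
          using le by (simp only: pos_le_divide_eq[OF pos(1)] mult_1)
        then have "1 / (1 + b y j) \<le> (1 + S y)\<^sup>2 * (1 + b y j) / (1 + A * G y j) / (1 + b y j)"
          using pos(2) by (intro divide_right_mono) linarith+
        also have "\<dots> = (1 + S y)\<^sup>2 * (1 / (1 + A * G y j))" using pos(2) by simp
        finally show "1 / (1 + b y j) \<le> (1 + S y)\<^sup>2 * (1 / (1 + A * G y j))" .
      qed
      also have "\<dots> = (1 + S y) ^ (2 * N) * (\<Prod>j<N. 1 / (1 + A * G y j))"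
        by (simp only: prod.distrib prod_constant card_lessThan power_mult)
      also have "\<dots> \<le> (K * exp (S y / 2)) * (\<Prod>j<N. \<Prod>l<ants c. gain_factor c A l ((cmod (y (Gain_g j l)))\<^sup>2))"
      proof (rule mult_mono)
        show "(1 + S y) ^ (2 * N) \<le> K * exp (S y / 2)"
          using power_le_exp_half[OF S0, of "2 * N" y] N by (simp add: K_def)
        show "(\<Prod>j<N. 1 / (1 + A * G y j)) \<le> (\<Prod>j<N. \<Prod>l<ants c. gain_factor c A l ((cmod (y (Gain_g j l)))\<^sup>2))"
        proof (rule prod_mono, intro conjI)
          fix j
          show "0 \<le> 1 / (1 + A * G y j)" using A G0 by simp
          show "1 / (1 + A * G y j) \<le> (\<Prod>l<ants c. gain_factor c A l ((cmod (y (Gain_g j l)))\<^sup>2))"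
            unfolding G_def using A D by (intro inverse_le_prod_gain_factor) auto
        qed
        show "0 \<le> K * exp (S y / 2)" using K by simp
        show "0 \<le> (\<Prod>j<N. 1 / (1 + A * G y j))" using A G0 by (intro prod_nonneg) auto
      qed
      finally have le: "(\<Prod>j<N. 1 / (1 + b y j)) \<le> \<dots>" .
      have eS: "exp (S y / 2) = (\<Prod>j<N. \<Prod>l<ants c. exp ((cmod (y (Gain_g j l)))\<^sup>2 / 2))"
        by (simp add: S_def gain_energy_def sum_divide_distrib exp_sum N_def)
      have eV: "exp (noise_energy c y / 2) = (\<Prod>s\<in>noise_index c. \<Psi> s (y s))"
      proof -
        have "\<theta> s = (\<lambda>_. 1)" if "s \<in> noise_index c" for s
          using that by (auto simp: \<theta>_def noise_index_def)
        then show ?thesis by (simp add: noise_energy_def sum_divide_distrib exp_sum \<Psi>_def)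
      qed
      have "(\<Prod>s\<in>gain_index c. \<Psi> s (y s)) = exp (S y / 2) * (\<Prod>j<N. \<Prod>l<ants c. gain_factor c A l ((cmod (y (Gain_g j l)))\<^sup>2))"
        unfolding prod_gain_index eS by (simp add: \<Psi>_def \<theta>_def prod.distrib N_def)
      then have "(\<Prod>s\<in>?J. \<Psi> s (y s)) = exp (noise_energy c y / 2) * (exp (S y / 2) * (\<Prod>j<N. \<Prod>l<ants c. gain_factor c A l ((cmod (y (Gain_g j l)))\<^sup>2)))"
        using prod.union_disjoint[OF finite_noise_index fin(1) disj, of "\<lambda>s. \<Psi> s (y s)"] eV by simp
      then show "exp (noise_energy c y / 2) * (\<Prod>j<N. 1 / (1 + b y j)) \<le> K * (\<Prod>s\<in>?J. \<Psi> s (y s))"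
        using mult_left_mono[OF le, of "exp (noise_energy c y / 2)"] by (simp add: mult_ac)
    qed
    also have "\<dots> = k y"
      unfolding k_def using K \<Psi>0 by (simp add: ennreal_mult prod_nonneg prod_ennreal)
    finally show "(\<integral>\<^sup>+\<omega>. H (restrict (\<lambda>s. Z s \<omega>) (src_index c)) y \<partial>M) \<le> k y" .
  qed
  also have "(\<integral>\<^sup>+\<omega>. k (restrict (\<lambda>s. Z s \<omega>) ?J) \<partial>M) = ennreal K * (\<Prod>s\<in>?J. \<integral>\<^sup>+\<omega>. ennreal (\<Psi> s (Z s \<omega>)) \<partial>M)"
  proof -
    have ind: "indep_vars (\<lambda>_. borel) (\<lambda>s \<omega>. ennreal (\<Psi> s (Z s \<omega>))) ?J"
      by (rule indep_vars_compose2[OF indep_vars_subset[OF indep sub(2)]])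
         (rule measurable_compose[OF \<Psi>_meas measurable_ennreal])
    have "(\<integral>\<^sup>+\<omega>. k (restrict (\<lambda>s. Z s \<omega>) ?J) \<partial>M) = (\<integral>\<^sup>+\<omega>. ennreal K * (\<Prod>s\<in>?J. ennreal (\<Psi> s (Z s \<omega>))) \<partial>M)"
      by (simp add: k_def)
    also have "\<dots> = ennreal K * (\<integral>\<^sup>+\<omega>. (\<Prod>s\<in>?J. ennreal (\<Psi> s (Z s \<omega>))) \<partial>M)"
      by (rule nn_integral_cmult, rule borel_measurable_prod_ennreal) (use ind in \<open>simp add: indep_vars_def\<close>)
    also have "(\<integral>\<^sup>+\<omega>. (\<Prod>s\<in>?J. ennreal (\<Psi> s (Z s \<omega>))) \<partial>M) = (\<Prod>s\<in>?J. \<integral>\<^sup>+\<omega>. ennreal (\<Psi> s (Z s \<omega>)) \<partial>M)"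
      by (rule indep_vars_nn_integral[OF fin(2) ind]) simp
    finally show ?thesis .
  qed
  also have "(\<Prod>s\<in>?J. \<integral>\<^sup>+\<omega>. ennreal (\<Psi> s (Z s \<omega>)) \<partial>M) =
      (\<Prod>s\<in>noise_index c. \<integral>\<^sup>+\<omega>. ennreal (\<Psi> s (Z s \<omega>)) \<partial>M) * (\<Prod>s\<in>gain_index c. \<integral>\<^sup>+\<omega>. ennreal (\<Psi> s (Z s \<omega>)) \<partial>M)"
    by (rule prod.union_disjoint[OF finite_noise_index fin(1) disj])
  also have "ennreal K * \<dots> \<le> ennreal K * (ennreal (2 ^ card (noise_index c)) * ennreal (\<Prod>j<N. \<Prod>l<ants c. gain_bound c A l))"
  proof (intro mult_left_mono mult_mono)
    have "(\<integral>\<^sup>+\<omega>. ennreal (\<Psi> s (Z s \<omega>)) \<partial>M) = ennreal 2" if "s \<in> noise_index c" for s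
    proof -
      have "\<theta> s = (\<lambda>_. 1)" using that by (auto simp: \<theta>_def noise_index_def)
      then show ?thesis
        using complex_normal_exp_square[OF normal, of s "- 1 / 2"] that sub(2) by (auto simp: \<Psi>_def)
    qed
    then have "(\<Prod>s\<in>noise_index c. \<integral>\<^sup>+\<omega>. ennreal (\<Psi> s (Z s \<omega>)) \<partial>M) = (\<Prod>s\<in>noise_index c. ennreal 2)"
      by (intro prod.cong refl)
    also have "\<dots> = ennreal (2 ^ card (noise_index c))" by (simp only: prod_constant ennreal_power)
    finally show "(\<Prod>s\<in>noise_index c. \<integral>\<^sup>+\<omega>. ennreal (\<Psi> s (Z s \<omega>)) \<partial>M) \<le> ennreal (2 ^ card (noise_index c))" by simp
    have gb: "gain_bound c A l \<ge> 0" for l using A by (auto simp: gain_bound_def)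
    have "(\<Prod>s\<in>gain_index c. \<integral>\<^sup>+\<omega>. ennreal (\<Psi> s (Z s \<omega>)) \<partial>M) \<le> (\<Prod>j<N. \<Prod>l<ants c. ennreal (gain_bound c A l))"
      unfolding prod_gain_index N_def
    proof (intro prod_mono_ennreal)
      fix j l assume jl: "j \<in> {..<relays c}" "l \<in> {..<ants c}"
      then have "Gain_g j l \<in> rv_indices c" by (auto simp: rv_indices_def)
      then show "(\<integral>\<^sup>+\<omega>. ennreal (\<Psi> (Gain_g j l) (Z (Gain_g j l) \<omega>)) \<partial>M) \<le> ennreal (gain_bound c A l)"
        unfolding \<Psi>_def \<theta>_def using expectation_gain_factor[OF normal meas A] by simp
    qed
    also have "(\<Prod>l<ants c. ennreal (gain_bound c A l)) = ennreal (\<Prod>l<ants c. gain_bound c A l)"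
      by (rule prod_ennreal) (rule gb)
    also have "(\<Prod>j<N. ennreal (\<Prod>l<ants c. gain_bound c A l)) = ennreal (\<Prod>j<N. \<Prod>l<ants c. gain_bound c A l)"
      by (rule prod_ennreal) (intro prod_nonneg gb)
    finally show "(\<Prod>s\<in>gain_index c. \<integral>\<^sup>+\<omega>. ennreal (\<Psi> s (Z s \<omega>)) \<partial>M) \<le> ennreal (\<Prod>j<N. \<Prod>l<ants c. gain_bound c A l)" .
  qed simp_all
  also have "\<dots> = ennreal (K * (2 ^ card (noise_index c) * (\<Prod>j<N. \<Prod>l<ants c. gain_bound c A l)))"
  proof -
    have "(\<Prod>j<N. \<Prod>l<ants c. gain_bound c A l) \<ge> 0"
      using A by (intro prod_nonneg) (auto simp: gain_bound_def)
    then show ?thesis using K by (simp add: ennreal_mult)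
  qed
  finally have main: "(\<integral>\<^sup>+\<omega>. H (restrict (\<lambda>s. Z s \<omega>) (src_index c)) (restrict (\<lambda>s. Z s \<omega>) ?J) \<partial>M) \<le> \<dots>" .
  have "H (restrict (\<lambda>s. Z s \<omega>) (src_index c)) (restrict (\<lambda>s. Z s \<omega>) ?J) =
      ennreal (exp (noise_energy c (\<lambda>s. Z s \<omega>) / 2) *
      (\<Prod>j<N. exp (- (A * (\<Sum>l<ants c. (cmod (Z (Gain_g j l) \<omega>))\<^sup>2) / (1 + gain_energy c (gains_g Z \<omega>))\<^sup>2)
        * (cmod (Z (Gain_f j) \<omega>))\<^sup>2)))" for \<omega>
  proof -
    let ?y = "restrict (\<lambda>s. Z s \<omega>) ?J"
    have y: "?y (Gain_g j l) = Z (Gain_g j l) \<omega>" if "j < N" "l < ants c" for j l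
      using that by (auto simp: gain_index_def N_def)
    have "noise_energy c ?y = noise_energy c (\<lambda>s. Z s \<omega>)" by (simp add: noise_energy_def)
    moreover have "S ?y = gain_energy c (gains_g Z \<omega>)"
      unfolding S_def gain_energy_def by (intro sum.cong refl) (use y in \<open>simp add: N_def\<close>)
    moreover have "G ?y j = (\<Sum>l<ants c. (cmod (Z (Gain_g j l) \<omega>))\<^sup>2)" if "j < N" for j
      unfolding G_def using y[OF that] by (intro sum.cong refl) simp
    moreover have "restrict (\<lambda>s. Z s \<omega>) (src_index c) (Gain_f j) = Z (Gain_f j) \<omega>" if "j < N" for j
      using that by (auto simp: src_index_def N_def)
    ultimately show ?thesis unfolding H_def b_def by (intro arg_cong[where f=ennreal] arg_cong2[where f="(*)"] prod.cong refl) simp_all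
  qed
  with main show ?thesis by (simp add: K_def)
qed

text \<open>A = P / (2 C) is the value for which the exponent V / 2 - A E / (1 + |g|^2)^2 is
  nonnegative on the whole event. Its exponential therefore dominates the indicator.\<close>

lemma decoding_error_probability:
  assumes c: "valid_dstbc c" and net: "network_model M c Z info" and C: "C > 0" and P: "P / (2 * C) \<ge> 1"
  defines "Ev \<equiv> {\<omega> \<in> space M. error_event c Z C P \<omega>}"
  shows "Ev \<in> sets M"
    "emeasure M Ev \<le> ennreal ((4 * real (relays c)) ^ (2 * relays c) * exp (1 / 2) *
      (2 ^ card (noise_index c) * (\<Prod>j<relays c. \<Prod>l<ants c. gain_bound c (P / (2 * C)) l)))"
proof -
  have "prob_space M" and indep: "prob_space.indep_vars M (\<lambda>_. borel) Z (rv_indices c)"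
    using net unfolding network_model_def by blast+
  interpret prob_space M by fact
  have meas: "Z s \<in> borel_measurable M" if "s \<in> rv_indices c" for s
    using indep that unfolding indep_vars_def by blast
  have sq: "(\<lambda>\<omega>. (cmod (Z s \<omega>))\<^sup>2) \<in> borel_measurable M" if "s \<in> rv_indices c" for s
    by (rule measurable_compose[OF meas[OF that]]) measurable
  have f: "(\<lambda>\<omega>. (cmod (Z (Gain_f j) \<omega>))\<^sup>2) \<in> borel_measurable M" if "j < relays c" for j
    by (rule sq) (use that in \<open>simp add: rv_indices_def\<close>)
  have g: "(\<lambda>\<omega>. (cmod (Z (Gain_g j l) \<omega>))\<^sup>2) \<in> borel_measurable M" if "j < relays c" "l < ants c" for j l
    by (rule sq) (use that in \<open>simp add: rv_indices_def\<close>)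
  have [measurable]: "(\<lambda>\<omega>. channel_energy c (gains_f Z \<omega>) (gains_g Z \<omega>)) \<in> borel_measurable M"
    unfolding channel_energy_def by (intro borel_measurable_sum borel_measurable_times f g) simp_all
  have [measurable]: "(\<lambda>\<omega>. gain_energy c (gains_g Z \<omega>)) \<in> borel_measurable M"
    unfolding gain_energy_def by (intro borel_measurable_sum g) simp_all
  have [measurable]: "(\<lambda>\<omega>. noise_energy c (\<lambda>s. Z s \<omega>)) \<in> borel_measurable M"
    unfolding noise_energy_def by (intro borel_measurable_sum sq) (use noise_index_subset in blast)
  show Ev: "Ev \<in> sets M" unfolding Ev_def error_event_def by measurable
  let ?A = "P / (2 * C)"
  define H where "H \<omega> = exp (noise_energy c (\<lambda>s. Z s \<omega>) / 2) *
      (\<Prod>j<relays c. exp (- (?A * (\<Sum>l<ants c. (cmod (Z (Gain_g j l) \<omega>))\<^sup>2) / (1 + gain_energy c (gains_g Z \<omega>))\<^sup>2)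
        * (cmod (Z (Gain_f j) \<omega>))\<^sup>2))" for \<omega>
  have H1: "1 \<le> H \<omega>" if "\<omega> \<in> Ev" for \<omega>
  proof -
    define V where "V = noise_energy c (\<lambda>s. Z s \<omega>)"
    define q where "q = (1 + gain_energy c (gains_g Z \<omega>))\<^sup>2"
    define E where "E = channel_energy c (gains_f Z \<omega>) (gains_g Z \<omega>)"
    have q: "q > 0" using gain_energy_nonneg[of c "gains_g Z \<omega>"] by (simp add: q_def)
    have le: "P * E \<le> C * q * V" using that by (simp add: Ev_def error_event_def V_def q_def E_def)
    have "(\<Prod>j<relays c. exp (- (?A * (\<Sum>l<ants c. (cmod (Z (Gain_g j l) \<omega>))\<^sup>2) / q) * (cmod (Z (Gain_f j) \<omega>))\<^sup>2)) =
        exp (\<Sum>j<relays c. - (?A / q) * ((cmod (Z (Gain_f j) \<omega>))\<^sup>2 * (\<Sum>l<ants c. (cmod (Z (Gain_g j l) \<omega>))\<^sup>2)))"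
      by (simp add: exp_sum mult_ac)
    also have "\<dots> = exp (- (?A / q) * E)"
      unfolding E_def channel_energy_def by (simp only: sum_distrib_left)
    finally have "H \<omega> = exp (V / 2 - ?A / q * E)"
      unfolding H_def V_def[symmetric] q_def[symmetric] by (simp add: exp_add[symmetric])
    moreover have "?A / q * E = P * E / (2 * C * q)" by simp
    moreover have "P * E / (2 * C * q) \<le> C * q * V / (2 * C * q)"
      using le C q by (intro divide_right_mono) auto
    moreover have "C * q * V / (2 * C * q) = V / 2" using C q by simp
    ultimately show ?thesis by simp
  qed
  have "emeasure M Ev = (\<integral>\<^sup>+\<omega>. indicator Ev \<omega> \<partial>M)" using Ev by simp
  also have "\<dots> \<le> (\<integral>\<^sup>+\<omega>. ennreal (H \<omega>) \<partial>M)"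
  proof (rule nn_integral_mono)
    fix \<omega>
    show "indicator Ev \<omega> \<le> ennreal (H \<omega>)"
      using H1[of \<omega>] ennreal_leI[of 1 "H \<omega>"] by (cases "\<omega> \<in> Ev") auto
  qed
  also have "\<dots> \<le> ennreal ((4 * real (relays c)) ^ (2 * relays c) * exp (1 / 2) *
      (2 ^ card (noise_index c) * (\<Prod>j<relays c. \<Prod>l<ants c. gain_bound c ?A l)))"
    unfolding H_def by (rule chernoff_expectation[OF c net P])
  finally show "emeasure M Ev \<le> \<dots>" .
qed

text \<open>Since P = exp (ln P), the correction ln (ln P) / ln P in the exponent is just a factor
  ln P per relay. It absorbs the logarithm from the single-antenna integral.\<close>

lemma powr_diversity_exponent:
  fixes P :: real
  assumes "P > exp 1"
  shows "P powr (- (real N * (1 - ln (ln P) / ln P))) = (ln P / P) ^ N"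
proof -
  have P1: "P > 1" using less_trans[OF _ assms, of 1] by simp
  then have P0: "P > 0" by simp
  have lnP: "ln P > 1" using assms P0 by (metis exp_less_cancel_iff exp_ln)
  have "P powr (- (real N * (1 - ln (ln P) / ln P))) = exp (- (real N * (1 - ln (ln P) / ln P)) * ln P)"
    using P0 by (simp add: powr_def)
  also have "- (real N * (1 - ln (ln P) / ln P)) * ln P = real N * (ln (ln P) - ln P)"
  proof -
    have "(1 - ln (ln P) / ln P) * ln P = ln P - ln (ln P)" using lnP unfolding left_diff_distrib by simp
    then have e: "real N * (1 - ln (ln P) / ln P) * ln P = real N * (ln P - ln (ln P))" by (simp only: mult.assoc)
    show ?thesis unfolding mult_minus_left e by (simp add: right_diff_distrib)
  qed
  also have "exp (real N * (ln (ln P) - ln P)) = (exp (ln (ln P) - ln P)) ^ N" by (rule exp_of_nat_mult)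
  also have "exp (ln (ln P) - ln P) = ln P / P" using P1 by (simp add: exp_diff)
  finally show ?thesis .
qed

lemma prod_gain_bound_rate:
  assumes D: "ants c \<ge> 1" and a: "a > 0"
  obtains b where "b > 0" "\<forall>\<^sub>F P in at_top. (\<Prod>j<relays c. \<Prod>l<ants c. gain_bound c (a * P) l) \<le>
    b * P powr (- (if ants c = 1 then real (relays c) * (1 - ln (ln P) / ln P) else real (relays c)))"
proof (cases "ants c = 1")
  case True
  have "(\<Prod>j<relays c. \<Prod>l<ants c. gain_bound c (a * P) l) \<le>
    (50 / a) ^ relays c * P powr (- (real (relays c) * (1 - ln (ln P) / ln P)))"
    if P: "P > exp 1" "P \<ge> a" "P \<ge> 1 / a" for P
  proof -
    have P0: "P > 0" using P(1) by (meson exp_gt_zero less_trans)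
    have lnP: "ln P > 1" using P(1) P0 by (metis exp_less_cancel_iff exp_ln)
    have aP: "a * P \<ge> 1" using P(3) a by (simp add: divide_le_eq mult.commute)
    have "ln (a * P) = ln a + ln P" using a P0 by (simp add: ln_mult)
    moreover have "ln a \<le> ln P" using a P(2) by simp
    \<comment> \<open>ln (a P) \<le> 2 ln P as soon as P \<ge> a, and ln P > 1 bounds the 18; thus
      50 = 18 + 2 * 16.\<close>
    ultimately have "18 + 16 * ln (a * P) \<le> 50 * ln P" using lnP by linarith
    then have "(18 + 16 * ln (a * P)) / (a * P) \<le> 50 * ln P / (a * P)"
      using aP by (intro divide_right_mono) auto
    moreover have "0 \<le> (18 + 16 * ln (a * P)) / (a * P)" using aP by simp
    ultimately have "((18 + 16 * ln (a * P)) / (a * P)) ^ relays c \<le> (50 * ln P / (a * P)) ^ relays c"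
      by (rule power_mono)
    also have "50 * ln P / (a * P) = 50 / a * (ln P / P)" by simp
    also have "(50 / a * (ln P / P)) ^ relays c = (50 / a) ^ relays c * (ln P / P) ^ relays c"
      by (rule power_mult_distrib)
    finally show ?thesis
      using True by (simp add: gain_bound_def powr_diversity_exponent[OF P(1)])
  qed
  moreover have "\<forall>\<^sub>F P in at_top. P > exp 1 \<and> P \<ge> a \<and> P \<ge> 1 / a"
    by (intro eventually_conj eventually_gt_at_top eventually_ge_at_top)
  ultimately have "\<forall>\<^sub>F P in at_top. (\<Prod>j<relays c. \<Prod>l<ants c. gain_bound c (a * P) l) \<le>
    (50 / a) ^ relays c * P powr (- (real (relays c) * (1 - ln (ln P) / ln P)))"
    by (auto elim: eventually_mono)
  then show thesis using that[of "(50 / a) ^ relays c"] a True by simp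
next
  case False
  define m where "m = ants c - 2"
  have m: "ants c = Suc (Suc m)" using False D unfolding m_def by arith
  \<comment> \<open>Two antennas contribute 34 / sqrt (a P) each, the other \<open>m\<close>
    contribute 2 each.\<close>
  define k where "k = 34 * 34 * 2 ^ m / a"
  have k: "k > 0" using a by (simp add: k_def)
  have "(\<Prod>j<relays c. \<Prod>l<ants c. gain_bound c (a * P) l) \<le> k ^ relays c * P powr (- real (relays c))"
    if P: "P \<ge> 1" for P
  proof -
    have "(\<Prod>l<ants c. gain_bound c (a * P) l) = gain_bound c (a * P) 0 * (gain_bound c (a * P) 1 *
        (\<Prod>l<m. gain_bound c (a * P) (Suc (Suc l))))"
      unfolding m by (simp only: prod.lessThan_Suc_shift One_nat_def)
    also have "\<dots> = 34 / sqrt (a * P) * (34 / sqrt (a * P) * 2 ^ m)"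
      using False by (simp add: gain_bound_def)
    also have "\<dots> = 34 * 34 * 2 ^ m / (sqrt (a * P) * sqrt (a * P))" by simp
    also have "\<dots> = k / P" using a P by (simp add: k_def)
    finally have "(\<Prod>l<ants c. gain_bound c (a * P) l) = k / P" .
    then have "(\<Prod>j<relays c. \<Prod>l<ants c. gain_bound c (a * P) l) = (k / P) ^ relays c" by simp
    also have "\<dots> = k ^ relays c * P powr (- real (relays c))"
      using P by (simp add: power_divide powr_minus powr_realpow divide_inverse power_mult_distrib power_inverse)
    finally show ?thesis by simp
  qed
  then have "\<forall>\<^sub>F P in at_top. (\<Prod>j<relays c. \<Prod>l<ants c. gain_bound c (a * P) l) \<le>
    k ^ relays c * P powr (- real (relays c))"
    by (rule eventually_mono[OF eventually_ge_at_top[of 1]])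
  then show thesis using that[of "k ^ relays c"] k False by simp
qed

text \<open>A 1 x 1 matrix equals its determinant, so the only rotation is the identity and the
  alphabets consist of integers.\<close>

lemma rotation_matrix_1:
  fixes Q :: "real ^ 1 ^ 1"
  assumes "rotation_matrix Q"
  shows "vec_nth (Q *v z) 1 = vec_nth z 1"
proof -
  have "vec_nth (vec_nth Q 1) 1 = 1" using assms by (simp add: rotation_matrix_def det_1)
  then show ?thesis by (simp add: matrix_vector_mult_def)
qed

theorem proposition1:
  fixes M :: "'w measure"
    and c :: dstbc
    and Z :: "rv_index \<Rightarrow> 'w \<Rightarrow> complex"
    and info :: "'w \<Rightarrow> nat \<Rightarrow> real"
    and W :: "nat \<Rightarrow> complex mat"
    and T' N' K' L n :: nat
    and Q :: "real ^ 1 ^ 1"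
  assumes "complex_orthogonal_design T' N' K' W"
    and "relays c \<ge> 1" and "relays c = L * N'" and "L \<ge> 1" and "n \<ge> 1"
    and "syms c = n * K'" and "len2 c = (n + L - 1) * T'"
    and "valid_dstbc c" and "network_model M c Z info"
    and "has_design c (X_design T' N' K' W L 1 n)"
    and "rotation_matrix Q"
    and "\<And>i. i < syms c \<Longrightarrow>
           finite (alph c i) \<and> alph c i \<subseteq> {vec_nth (Q *v z) 1 | z. vec_nth z 1 \<in> \<int>}"
  shows "(\<forall>D. zf_decoder c D \<longrightarrow> full_diversity M c Z D) \<and>
         (\<forall>\<sigma> D. \<sigma> permutes {..<syms c} \<longrightarrow> zf_sic_decoder c \<sigma> D \<longrightarrow> full_diversity M c Z D)"
proof -
  note c = assms(8) and net = assms(9)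
  have alph: "alph c i \<subseteq> \<int>" if "i < syms c" for i
    using assms(12)[OF that] by (auto simp: rotation_matrix_1[OF assms(11)])
  obtain C where C: "C > 0" and err: "\<And>D P x \<omega> i. linear_decoder c D \<Longrightarrow>
      P \<ge> 1 \<Longrightarrow> x \<in> signal_set c \<Longrightarrow> i < syms c \<Longrightarrow>
      D (equiv_channel M c Z P \<omega>) (equiv_received M c Z P x \<omega>) i \<noteq> x i \<Longrightarrow>
      error_event c Z C P \<omega>"
    using decoding_error_event[OF assms(1,3,6,7) c net assms(10) alph] by metis
  have D1: "ants c \<ge> 1" using c unfolding valid_dstbc_def by blast
  define a where "a = 1 / (2 * C)"
  have a: "a > 0" using C by (simp add: a_def)
  define k where "k = (4 * real (relays c)) ^ (2 * relays c) * exp (1 / 2) * 2 ^ card (noise_index c)"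
  have k: "k > 0" using assms(2) by (simp add: k_def)
  define d where "d P = (if ants c = 1 then real (relays c) * (1 - ln (ln P) / ln P) else real (relays c))" for P :: real
  obtain b where b: "b > 0"
    and rate: "\<forall>\<^sub>F P in at_top. (\<Prod>j<relays c. \<Prod>l<ants c. gain_bound c (a * P) l) \<le> b * P powr (- d P)"
    using prod_gain_bound_rate[OF D1 a] unfolding d_def by blast
  have "full_diversity M c Z D"
    if D: "linear_decoder c D" for D
    unfolding full_diversity_def achieves_diversity_def d_def[symmetric]
  proof (intro exI conjI)
    show "k * b > 0" using k b by simp
    show "\<forall>\<^sub>F P in at_top. \<forall>x\<in>signal_set c. outer_measure_of M {\<omega> \<in> space M. \<exists>i<syms c.
            D (equiv_channel M c Z P \<omega>) (equiv_received M c Z P x \<omega>) i \<noteq> x i} \<le> ennreal (k * b * P powr (- d P))"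
      using rate eventually_ge_at_top[of "max 1 (2 * C)"]
    proof eventually_elim
      case (elim P)
      have P: "P \<ge> 1" "P / (2 * C) \<ge> 1" using elim(2) C by auto
      let ?Ev = "{\<omega> \<in> space M. error_event c Z C P \<omega>}"
      note Ev = decoding_error_probability[OF c net C P(2)]
      show ?case
      proof
        fix x assume x: "x \<in> signal_set c"
        \<comment> \<open>Monotonicity passes from the possibly non-measurable error set to the
          measurable event. An error in any coordinate lands in the same event, so no factor
          \<open>syms c\<close> appears.\<close>
        have "outer_measure_of M {\<omega> \<in> space M. \<exists>i<syms c.
            D (equiv_channel M c Z P \<omega>) (equiv_received M c Z P x \<omega>) i \<noteq> x i} \<le> outer_measure_of M ?Ev"
          using err[OF D P(1) x] by (intro outer_measure_of_mono) blast
        also have "\<dots> = emeasure M ?Ev" by (rule outer_measure_of_eq[OF Ev(1)])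
        also have "\<dots> \<le> ennreal (k * (\<Prod>j<relays c. \<Prod>l<ants c. gain_bound c (a * P) l))"
          using Ev(2) by (simp add: k_def a_def mult_ac)
        also have "\<dots> \<le> ennreal (k * b * P powr (- d P))"
          using elim(1) k by (intro ennreal_leI) (simp add: mult.assoc)
        finally show "outer_measure_of M {\<omega> \<in> space M. \<exists>i<syms c.
            D (equiv_channel M c Z P \<omega>) (equiv_received M c Z P x \<omega>) i \<noteq> x i} \<le> ennreal (k * b * P powr (- d P))" .
      qed
    qed
  qed
  then show ?thesis by blast
qed

end
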